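(* Consider the autoregressive stochastic-volatility model described in the context, in the mildly explosive regime $\rho_n = 1+\frac{c}{k_n}$, under the rate separation condition that $r_n^q=o(k_n)$ and $k_n r_n^q=o(n)$ for every fixed $q>0$, and with initial value satisfying $y_0=o_p(k_n^{1/2})$. Let $\ell_n=\exp\left\{\frac{\alpha^2}{2(1-\phi_n^2)}\right\}$ and $\widehat\rho_n=\sum_{t=1}^n y_{t-1}y_t\big/\sum_{t=1}^n y_{t-1}^2$. Then, as $n\to\infty$, $$\left(\frac{\rho_n^{-n}\sum_{t=1}^{n}y_{t-1}u_t}{\ell_n k_n},\;\frac{\rho_n^{-2n}\sum_{t=1}^{n}y_{t-1}^2}{\ell_n k_n^2}\right)\ \text{converges in distribution to}\ \left(WV,\frac{W^2}{2c}\right),$$ where $W$ and $V$ are independent $N(0,1/(2c))$ random variables, and consequently $$\left(\frac{k_n\rho_n^n}{2c}\right)(\widehat{\rho}_n-\rho_n)\ \text{converges in distribution to the standard Cauchy distribution}$$ (with density $x\mapsto\{\pi(1+x^2)\}^{-1}$).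
   Context: Model. Fixed constants: $c>0$, $d>0$, $\alpha>0$. Deterministic sequences: $k_n>0$ with $k_n\to\infty$ and $k_n=o(n)$; $r_n>1$, where either $r_n\to\infty$ or $r_n$ is constant. The volatility persistence parameter is $\phi_n=1-\frac{d}{\log r_n}$, and $|\phi_n|<1$. For each $n$ (triangular array; dependence on $n$ is suppressed in the notation) and $1\le t\le n$, $$y_t=\rho_n y_{t-1}+u_t,\qquad u_t=\sigma_t\varepsilon_t,\qquad \log\sigma_t^2=\phi_n\log\sigma_{t-1}^2+\eta_t .$$ Here $(\varepsilon_t)_{t\ge1}$ are i.i.d. with $\mathbb{E}[\varepsilon_t]=0$, $\mathbb{E}[\varepsilon_t^2]=1$, $\mathbb{E}[\varepsilon_t^4]<\infty$; $(\eta_t)_{t\ge1}$ are i.i.d. $N(0,\alpha^2)$; the sequences $(\varepsilon_t)$ and $(\eta_t)$ are independent of each other. The initial volatility is $\sigma_0=1$, and the initial value $y_0$ (possibly depending on $n$) is independent of $\{(\varepsilon_t,\eta_t):t\ge1\}$. The estimator $\widehat\rho_n$ is the least-squares estimator (defined when its denominator is nonzero). *)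

theory Defs
  imports "HOL-Probability.Probability" "HOL-Library.Landau_Symbols"
begin

(* The library constant weak_conv_m (via distribution functions) covers measures on the
   real line only; this is weak convergence in general, needed here on the plane. *)
definition weak_conv_top :: "(nat \<Rightarrow> 'b::topological_space measure) \<Rightarrow> 'b measure \<Rightarrow> bool" where
  "weak_conv_top \<mu> \<nu> \<longleftrightarrow>
     (\<forall>f :: 'b \<Rightarrow> real. continuous_on UNIV f \<longrightarrow> bounded (range f) \<longrightarrow>
        (\<lambda>n. \<integral>x. f x \<partial>\<mu> n) \<longlonglongrightarrow> (\<integral>x. f x \<partial>\<nu>))"

(* X n = o_p(a n); a is meant to be a positive deterministic sequence. *)
definition small_o_prob :: "'a measure \<Rightarrow> (nat \<Rightarrow> 'a \<Rightarrow> real) \<Rightarrow> (nat \<Rightarrow> real) \<Rightarrow> bool" where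
  "small_o_prob M X a \<longleftrightarrow>
     (\<forall>\<delta>>0. (\<lambda>n. measure M {\<omega> \<in> space M. \<bar>X n \<omega> / a n\<bar> > \<delta>}) \<longlonglongrightarrow> 0)"

(* normal_density takes the standard deviation, not the variance, as second argument. *)
definition normal_law :: "real \<Rightarrow> real \<Rightarrow> real measure" where
  "normal_law m v = density lborel (\<lambda>x. ennreal (normal_density m (sqrt v) x))"

definition std_cauchy_law :: "real measure" where
  "std_cauchy_law = density lborel (\<lambda>x. ennreal (1 / (pi * (1 + x\<^sup>2))))"

(* Law of (W V, W^2 / (2 c)), where W and V are the coordinates of the product of two copies
   of N(0, 1/(2 c)), i.e. independent random variables with that law. *)
definition limit_law :: "real \<Rightarrow> (real \<times> real) measure" where
  "limit_law c = distr (normal_law 0 (1 / (2 * c)) \<Otimes>\<^sub>M normal_law 0 (1 / (2 * c))) borel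
                   (\<lambda>(w, v). (w * v, w\<^sup>2 / (2 * c)))"

end

theory Submission
  imports Defs
begin

text \<open>
  Write $g = 1/\rho_n$, $\ell$ for \<open>ell n\<close> and $y_t = \rho_n^t S_t$, so that
  $S_t = y_0 + \sum_{j \le t} g^j u_j$. The process is governed by two weighted sums of the innovations:
  $W_n = (\ell k)^{-1/2} \sum_t g^t u_t$, which is dominated by the first $O(k)$ innovations, and
  $V_n = (\ell k)^{-1/2} \sum_t g^{n+1-t} u_t$, which is dominated by the last $O(k)$.

  \<^item> Replacing $S_{t-1}$ by $S_n$ in the two sums of the theorem gives, exactly,
  $S V_n$ and $\kappa S^2$ with $S = W_n + y_0/\sqrt{\ell k}$ and $\kappa \to 1/(2c)$, plus explicit remainders
  (\<open>explosive_sums_decomposition\<close>). The remainders have vanishing first or second moments.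
  The delicate one is the quadratic form in pairs $u_t u_j$ with $t < j$: since $g^n$ need not beat $n$, it is
  bounded in mean square, through orthogonality of the products $u_t u_j$, and not in mean.

  \<^item> For $(W_n, V_n)$ the characteristic function is computed conditionally on the volatilities. Given these, a linear
  combination $\sum_t a_t \sigma_t \epsilon_t$ is a sum of independent variables and its conditional characteristic function
  is close to $\exp(-\frac12 \sum_t a_t^2 \sigma_t^2)$. The random exponent concentrates at its stationary value because the
  covariance of $\sigma_t^2$ and $\sigma_s^2$ decays like $|\phi_n|^{|t-s|}$ (\<open>char_inno_linear_approx\<close>).
  The errors are controlled by powers of $\ell$ divided by $k$, and $\ell$ is bounded by a multiple of a power of $r_n$, so the
  rate separation makes them vanish. The cross term of the weights of $W_n$ and $V_n$ is of order $n g^n / k$, which makes the limits independent.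

  \<^item> A two-dimensional continuity theorem (\<open>joint_levy_continuity\<close>), reduced to the one-dimensional one by tilting the measure
  with the other coordinate, turns this into weak convergence on the plane. Remainders are appended as further
  coordinates that converge to \<open>0\<close>, so that one application of the continuous mapping theorem yields the first claim.

  \<^item> The normalised estimation error is the first coordinate divided by $2c$ times the second, hence converges to
  $WV/W^2 = V/W$, a ratio of independent centred normals with equal variance, which is Cauchy
  (\<open>ratio_of_independent_normals\<close>, \<open>weak_conv_m_ratio_cauchy\<close>).
\<close>


section \<open>Characteristic functions of pairs\<close>

text \<open>The bounded weights, divided by their total mass, turn \<open>M\<close> into another probability measure, under which the
  one-dimensional continuity theorem applies to \<open>Y n\<close>. The bounds 1 and 3 keep the mass away from 0 and the integrands bounded.\<close>

lemma levy_continuity_weighted: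
  fixes G Y :: "nat \<Rightarrow> 'a \<Rightarrow> real" and h :: "real \<Rightarrow> real"
  assumes "prob_space M" and \<nu>: "real_distribution \<nu>"
    and Gm[measurable]: "\<And>n. G n \<in> borel_measurable M" and Ym[measurable]: "\<And>n. Y n \<in> borel_measurable M"
    and G: "\<And>n \<omega>. 1 \<le> G n \<omega>" "\<And>n \<omega>. G n \<omega> \<le> 3"
    and lim: "\<And>t. (\<lambda>n. \<integral>\<omega>. complex_of_real (G n \<omega>) * iexp (t * Y n \<omega>) \<partial>M) \<longlonglongrightarrow> complex_of_real \<gamma> * char \<nu> t"
    and h: "continuous_on UNIV h" "\<And>x. \<bar>h x\<bar> \<le> B"
  shows "(\<lambda>n. \<integral>\<omega>. G n \<omega> * h (Y n \<omega>) \<partial>M) \<longlonglongrightarrow> \<gamma> * (\<integral>x. h x \<partial>\<nu>)"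
proof -
  interpret prob_space M by fact
  interpret \<nu>: real_distribution \<nu> by fact
  have [measurable]: "h \<in> borel_measurable borel"
    using h(1) by (rule borel_measurable_continuous_onI)
  have Gi: "integrable M (G n)" for n
  proof (rule integrable_const_bound[of _ 3])
    have "\<bar>G n \<omega>\<bar> \<le> 3" for \<omega> using G(1)[of n \<omega>] G(2)[of n \<omega>] by auto
    then show "AE \<omega> in M. norm (G n \<omega>) \<le> 3" by simp
  qed simp
  define C where "C n = (\<integral>\<omega>. G n \<omega> \<partial>M)" for n
  have C1: "1 \<le> C n" for n
    unfolding C_def using integral_mono[of M "\<lambda>_. 1" "G n"] G Gi by (simp add: prob_space)
  have "(\<lambda>n. complex_of_real (C n)) \<longlonglongrightarrow> complex_of_real \<gamma>"
    using lim[of 0] by (simp add: C_def \<nu>.char_zero)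
  then have C: "C \<longlonglongrightarrow> \<gamma>" by (simp add: tendsto_of_real_iff)
  have \<gamma>: "\<gamma> \<ge> 1" using C C1 by (intro LIMSEQ_le_const) auto
  \<comment> \<open>the law of \<open>Y n\<close> under the tilted measure\<close>
  define D where "D n = distr (density M (\<lambda>\<omega>. ennreal (G n \<omega> / C n))) borel (Y n)" for n
  have G0: "0 \<le> G n \<omega> / C n" for n \<omega> using G(1)[of n \<omega>] C1[of n] by simp
  have Dp: "prob_space (density M (\<lambda>\<omega>. ennreal (G n \<omega> / C n)))" for n
  proof (rule prob_spaceI)
    have "(\<integral>\<^sup>+ \<omega>. ennreal (G n \<omega> / C n) \<partial>M) = ennreal (\<integral>\<omega>. G n \<omega> / C n \<partial>M)"
      by (rule nn_integral_eq_integral) (use Gi G0 in auto)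
    also have "(\<integral>\<omega>. G n \<omega> / C n \<partial>M) = 1" using C1[of n] by (simp add: C_def)
    finally show "emeasure (density M (\<lambda>\<omega>. ennreal (G n \<omega> / C n))) (space (density M (\<lambda>\<omega>. ennreal (G n \<omega> / C n)))) = 1"
      by (simp add: emeasure_density cong: nn_integral_cong)
  qed
  have DR: "real_distribution (D n)" for n
    unfolding D_def by (intro prob_space.real_distribution_distr Dp) simp
  have int_D: "(\<integral>x. f x \<partial>D n) = (\<integral>\<omega>. G n \<omega> *\<^sub>R f (Y n \<omega>) \<partial>M) /\<^sub>R C n"
    if [measurable]: "f \<in> borel_measurable borel" for f :: "real \<Rightarrow> 'b::{banach,second_countable_topology}" and n
  proof -
    have "(\<integral>x. f x \<partial>D n) = (\<integral>\<omega>. (G n \<omega> / C n) *\<^sub>R f (Y n \<omega>) \<partial>M)"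
      unfolding D_def using G0 by (subst integral_distr; simp) (subst integral_density; simp)
    also have "\<dots> = (\<integral>\<omega>. (1 / C n) *\<^sub>R (G n \<omega> *\<^sub>R f (Y n \<omega>)) \<partial>M)" by (simp add: mult.commute)
    also have "\<dots> = (\<integral>\<omega>. G n \<omega> *\<^sub>R f (Y n \<omega>) \<partial>M) /\<^sub>R C n"
      by (subst integral_scaleR_right) (simp_all add: divide_inverse)
    finally show ?thesis .
  qed
  have "weak_conv_m D \<nu>"
  proof (rule levy_continuity[OF DR \<nu>])
    fix t
    have "char (D n) t = (\<integral>\<omega>. complex_of_real (G n \<omega>) * iexp (t * Y n \<omega>) \<partial>M) /\<^sub>R C n" for n
      unfolding char_def by (subst int_D) (auto simp: scaleR_conv_of_real)
    moreover have "(\<lambda>n. (\<integral>\<omega>. complex_of_real (G n \<omega>) * iexp (t * Y n \<omega>) \<partial>M) /\<^sub>R C n)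
        \<longlonglongrightarrow> (complex_of_real \<gamma> * char \<nu> t) /\<^sub>R \<gamma>"
      using \<gamma> by (intro tendsto_intros lim C) auto
    moreover have "(complex_of_real \<gamma> * char \<nu> t) /\<^sub>R \<gamma> = char \<nu> t"
      using \<gamma> by (simp add: scaleR_conv_of_real)
    ultimately show "(\<lambda>n. char (D n) t) \<longlonglongrightarrow> char \<nu> t" by simp
  qed
  then have "(\<lambda>n. \<integral>x. h x \<partial>D n) \<longlonglongrightarrow> (\<integral>x. h x \<partial>\<nu>)"
    using h by (intro weak_conv_imp_integral_bdd_continuous_conv[OF DR \<nu>, where B=B])
       (auto simp: continuous_on_eq_continuous_at)
  then have "(\<lambda>n. C n * (\<integral>x. h x \<partial>D n)) \<longlonglongrightarrow> \<gamma> * (\<integral>x. h x \<partial>\<nu>)"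
    by (intro tendsto_intros C)
  moreover have "C n * (\<integral>x. h x \<partial>D n) = (\<integral>\<omega>. G n \<omega> * h (Y n \<omega>) \<partial>M)" for n
    using C1[of n] by (subst int_D) auto
  ultimately show ?thesis by simp
qed

text \<open>Shifting a weight in $[-1,1]$ by 2 makes it admissible for the previous lemma; the
  contribution of the constant 2 is subtracted afterwards.\<close>

lemma levy_continuity_signed_weight:
  fixes G Y :: "nat \<Rightarrow> 'a \<Rightarrow> real" and h :: "real \<Rightarrow> real"
  assumes "prob_space M" and \<nu>: "real_distribution \<nu>"
    and Gm[measurable]: "\<And>n. G n \<in> borel_measurable M" and Ym[measurable]: "\<And>n. Y n \<in> borel_measurable M"
    and G: "\<And>n \<omega>. \<bar>G n \<omega>\<bar> \<le> 1"
    and lim0: "\<And>t. (\<lambda>n. \<integral>\<omega>. iexp (t * Y n \<omega>) \<partial>M) \<longlonglongrightarrow> char \<nu> t"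
    and lim: "\<And>t. (\<lambda>n. \<integral>\<omega>. complex_of_real (G n \<omega>) * iexp (t * Y n \<omega>) \<partial>M) \<longlonglongrightarrow> complex_of_real \<gamma> * char \<nu> t"
    and h: "continuous_on UNIV h" "\<And>x. \<bar>h x\<bar> \<le> B"
  shows "(\<lambda>n. \<integral>\<omega>. G n \<omega> * h (Y n \<omega>) \<partial>M) \<longlonglongrightarrow> \<gamma> * (\<integral>x. h x \<partial>\<nu>)"
proof -
  interpret prob_space M by fact
  have [measurable]: "h \<in> borel_measurable borel"
    using h(1) by (rule borel_measurable_continuous_onI)
  have B: "B \<ge> 0" using h(2)[of 0] by linarith
  have i1: "integrable M (\<lambda>\<omega>. iexp (t * Y n \<omega>))" for t n
    by (rule integrable_const_bound[of _ 1]) auto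
  have i2: "integrable M (\<lambda>\<omega>. complex_of_real (G n \<omega>) * iexp (t * Y n \<omega>))" for t n
    by (rule integrable_const_bound[of _ 1]) (auto simp: norm_mult G)
  have i3: "integrable M (\<lambda>\<omega>. h (Y n \<omega>))" for n
    by (rule integrable_const_bound[of _ B]) (auto simp: h)
  have i4: "integrable M (\<lambda>\<omega>. G n \<omega> * h (Y n \<omega>))" for n
  proof (rule integrable_const_bound[of _ "1 * B"])
    have "\<bar>G n \<omega> * h (Y n \<omega>)\<bar> \<le> 1 * B" for \<omega>
      unfolding abs_mult by (intro mult_mono G h(2)) auto
    then show "AE \<omega> in M. norm (G n \<omega> * h (Y n \<omega>)) \<le> 1 * B" by simp
  qed simp
  have l0: "(\<lambda>n. \<integral>\<omega>. 1 * h (Y n \<omega>) \<partial>M) \<longlonglongrightarrow> 1 * (\<integral>x. h x \<partial>\<nu>)"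
    by (rule levy_continuity_weighted[OF assms(1) \<nu>, where B=B]) (use lim0 h in auto)
  have G': "-1 \<le> G n \<omega>" "G n \<omega> \<le> 1" for n \<omega> using G[of n \<omega>] by auto
  have l1: "(\<lambda>n. \<integral>\<omega>. (2 + G n \<omega>) * h (Y n \<omega>) \<partial>M) \<longlonglongrightarrow> (2 + \<gamma>) * (\<integral>x. h x \<partial>\<nu>)"
  proof (rule levy_continuity_weighted[OF assms(1) \<nu>, where B=B])
    show "1 \<le> 2 + G n \<omega>" "2 + G n \<omega> \<le> 3" for n \<omega> using G'[of n \<omega>] by auto
    show "(\<lambda>n. \<integral>\<omega>. complex_of_real (2 + G n \<omega>) * iexp (t * Y n \<omega>) \<partial>M) \<longlonglongrightarrow> complex_of_real (2 + \<gamma>) * char \<nu> t" for t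
      using tendsto_add[OF tendsto_mult[OF tendsto_const[of 2] lim0[of t]] lim[of t]] i1 i2
      by (simp add: algebra_simps)
  qed (use h in auto)
  show ?thesis
    using tendsto_diff[OF l1 tendsto_mult[OF tendsto_const[of 2] l0]] i3 i4
    by (simp add: algebra_simps)
qed

text \<open>Two tilts suffice: first by $\cos(sX_n)$ and $\sin(sX_n)$, whose joint
  transforms with $Y_n$ are combinations of the given characteristic functions, which yields
  $E[e^{isX_n} h(Y_n)]$; then by the bounded weight $h(Y_n)$, which yields $E[g(X_n) h(Y_n)]$.\<close>

lemma joint_char_imp_product_conv:
  fixes X Y :: "nat \<Rightarrow> 'a \<Rightarrow> real" and g h :: "real \<Rightarrow> real"
  assumes P: "prob_space M" and \<mu>: "real_distribution \<mu>" and \<nu>: "real_distribution \<nu>"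
    and Xm[measurable]: "\<And>n. X n \<in> borel_measurable M" and Ym[measurable]: "\<And>n. Y n \<in> borel_measurable M"
    and lim: "\<And>s t. (\<lambda>n. \<integral>\<omega>. iexp (s * X n \<omega> + t * Y n \<omega>) \<partial>M) \<longlonglongrightarrow> char \<mu> s * char \<nu> t"
    and g: "continuous_on UNIV g" "\<And>x. \<bar>g x\<bar> \<le> A"
    and h: "continuous_on UNIV h" "\<And>x. \<bar>h x\<bar> \<le> B"
  shows "(\<lambda>n. \<integral>\<omega>. g (X n \<omega>) * h (Y n \<omega>) \<partial>M) \<longlonglongrightarrow> (\<integral>x. g x \<partial>\<mu>) * (\<integral>y. h y \<partial>\<nu>)"
proof -
  interpret prob_space M by fact
  interpret \<mu>: real_distribution \<mu> by fact
  interpret \<nu>: real_distribution \<nu> by fact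
  have [measurable]: "h \<in> borel_measurable borel"
    using h(1) by (rule borel_measurable_continuous_onI)
  have limX: "(\<lambda>n. \<integral>\<omega>. iexp (s * X n \<omega>) \<partial>M) \<longlonglongrightarrow> char \<mu> s" for s
    using lim[of s 0] by (simp add: \<nu>.char_zero)
  have limY: "(\<lambda>n. \<integral>\<omega>. iexp (t * Y n \<omega>) \<partial>M) \<longlonglongrightarrow> char \<nu> t" for t
    using lim[of 0 t] by (simp add: \<mu>.char_zero)
  have i1: "integrable M (\<lambda>\<omega>. iexp (s * X n \<omega> + t * Y n \<omega>))" for s t n
    by (rule integrable_const_bound[of _ 1]) auto
  have cc: "char \<mu> (-s) = cnj (char \<mu> s)" for s
    unfolding char_def by (subst Bochner_Integration.integral_cnj[symmetric]) (simp add: exp_cnj)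
  have cos_eq: "complex_of_real (cos x) * iexp y = (iexp (x + y) + iexp (-x + y)) / 2" for x y
    by (simp add: complex_eq_iff cos_add cos_diff sin_add sin_diff Re_exp Im_exp)
  have sin_eq: "complex_of_real (sin x) * iexp y = (iexp (x + y) - iexp (-x + y)) / (2 * \<i>)" for x y
    by (simp add: complex_eq_iff cos_add cos_diff sin_add sin_diff Re_exp Im_exp Re_divide Im_divide)
  have step: "(\<lambda>n. \<integral>\<omega>. cos (s * X n \<omega>) * h (Y n \<omega>) \<partial>M) \<longlonglongrightarrow> Re (char \<mu> s) * (\<integral>x. h x \<partial>\<nu>)"
   "(\<lambda>n. \<integral>\<omega>. sin (s * X n \<omega>) * h (Y n \<omega>) \<partial>M) \<longlonglongrightarrow> Im (char \<mu> s) * (\<integral>x. h x \<partial>\<nu>)" for s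
  proof -
    have e1: "(char \<mu> s * char \<nu> t + char \<mu> (- s) * char \<nu> t) / 2 = complex_of_real (Re (char \<mu> s)) * char \<nu> t" for t
      unfolding cc by (simp add: complex_eq_iff algebra_simps)
    have e2: "(char \<mu> s * char \<nu> t - char \<mu> (- s) * char \<nu> t) / (2 * \<i>) = complex_of_real (Im (char \<mu> s)) * char \<nu> t" for t
      unfolding cc by (simp add: complex_eq_iff algebra_simps Re_divide Im_divide)
    show "(\<lambda>n. \<integral>\<omega>. cos (s * X n \<omega>) * h (Y n \<omega>) \<partial>M) \<longlonglongrightarrow> Re (char \<mu> s) * (\<integral>x. h x \<partial>\<nu>)"
    proof (rule levy_continuity_signed_weight[OF P \<nu> _ _ _ limY _ h])
      show "(\<lambda>n. \<integral>\<omega>. complex_of_real (cos (s * X n \<omega>)) * iexp (t * Y n \<omega>) \<partial>M)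
          \<longlonglongrightarrow> complex_of_real (Re (char \<mu> s)) * char \<nu> t" for t
        using tendsto_divide[OF tendsto_add[OF lim[of s t] lim[of "-s" t]] tendsto_const[of 2]] i1[of s _ t] i1[of "-s" _ t]
        unfolding cos_eq e1[symmetric] by (simp del: of_real_add of_real_mult)
    qed auto
    show "(\<lambda>n. \<integral>\<omega>. sin (s * X n \<omega>) * h (Y n \<omega>) \<partial>M) \<longlonglongrightarrow> Im (char \<mu> s) * (\<integral>x. h x \<partial>\<nu>)"
    proof (rule levy_continuity_signed_weight[OF P \<nu> _ _ _ limY _ h])
      show "(\<lambda>n. \<integral>\<omega>. complex_of_real (sin (s * X n \<omega>)) * iexp (t * Y n \<omega>) \<partial>M)
          \<longlonglongrightarrow> complex_of_real (Im (char \<mu> s)) * char \<nu> t" for t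
        using tendsto_divide[OF tendsto_diff[OF lim[of s t] lim[of "-s" t]] tendsto_const[of "2*\<i>"]] i1[of s _ t] i1[of "-s" _ t]
        unfolding sin_eq e2[symmetric] by (simp del: of_real_add of_real_mult)
    qed auto
  qed
  \<comment> \<open>normalises \<open>h\<close> to a weight in $[-1, 1]$; the summand 1 avoids a division by 0\<close>
  define b where "b = 1 + B"
  have "B \<ge> 0" using h(2)[of 0] by linarith
  then have b: "b > 0" "\<And>x. \<bar>h x / b\<bar> \<le> 1"
    using h(2) by (auto simp: b_def abs_divide divide_le_eq add_increasing)
  have ih: "integrable M (\<lambda>\<omega>. complex_of_real (h (Y n \<omega>)) * iexp (s * X n \<omega>))" for n s
    by (rule integrable_const_bound[of _ B]) (auto simp: norm_mult h)
  have lh: "(\<lambda>n. \<integral>\<omega>. complex_of_real (h (Y n \<omega>) / b) * iexp (s * X n \<omega>) \<partial>M)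
      \<longlonglongrightarrow> complex_of_real ((\<integral>x. h x \<partial>\<nu>) / b) * char \<mu> s" for s
  proof -
    have "(\<integral>\<omega>. complex_of_real (h (Y n \<omega>)) * iexp (s * X n \<omega>) \<partial>M) =
      Complex (\<integral>\<omega>. cos (s * X n \<omega>) * h (Y n \<omega>) \<partial>M) (\<integral>\<omega>. sin (s * X n \<omega>) * h (Y n \<omega>) \<partial>M)" for n
      using integral_Re[OF ih[of n s]] integral_Im[OF ih[of n s]]
      by (simp add: complex_eq_iff Re_exp Im_exp mult.commute)
    then have "(\<lambda>n. \<integral>\<omega>. complex_of_real (h (Y n \<omega>)) * iexp (s * X n \<omega>) \<partial>M)
      \<longlonglongrightarrow> Complex (Re (char \<mu> s) * (\<integral>x. h x \<partial>\<nu>)) (Im (char \<mu> s) * (\<integral>x. h x \<partial>\<nu>))"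
      by (simp add: tendsto_Complex step)
    moreover have "Complex (Re (char \<mu> s) * (\<integral>x. h x \<partial>\<nu>)) (Im (char \<mu> s) * (\<integral>x. h x \<partial>\<nu>))
       = complex_of_real (\<integral>x. h x \<partial>\<nu>) * char \<mu> s"
      by (simp add: complex_eq_iff)
    ultimately have "(\<lambda>n. (\<integral>\<omega>. complex_of_real (h (Y n \<omega>)) * iexp (s * X n \<omega>) \<partial>M) / complex_of_real b)
      \<longlonglongrightarrow> complex_of_real (\<integral>x. h x \<partial>\<nu>) * char \<mu> s / complex_of_real b"
      using b(1) by (intro tendsto_divide) auto
    then show ?thesis by simp
  qed
  have "(\<lambda>n. \<integral>\<omega>. h (Y n \<omega>) / b * g (X n \<omega>) \<partial>M) \<longlonglongrightarrow> (\<integral>x. h x \<partial>\<nu>) / b * (\<integral>x. g x \<partial>\<mu>)"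
    by (rule levy_continuity_signed_weight[OF P \<mu> _ _ b(2) limX lh g]) auto
  from tendsto_mult[OF tendsto_const[of b] this] b(1) show ?thesis
    by (simp add: mult.commute)
qed

text \<open>The algebra generated by continuous functions of one coordinate. The factors may be unbounded, so that the
  coordinate projections belong to it and separate points.\<close>

inductive product_sum :: "(real \<times> real \<Rightarrow> real) \<Rightarrow> bool" where
  prod: "continuous_on UNIV g \<Longrightarrow> continuous_on UNIV h \<Longrightarrow> product_sum (\<lambda>z. g (fst z) * h (snd z))"
| add: "product_sum p \<Longrightarrow> product_sum q \<Longrightarrow> product_sum (\<lambda>z. p z + q z)"

lemma product_sum_mult:
  assumes "product_sum p" "product_sum q"
  shows "product_sum (\<lambda>z. p z * q z)"
  using assms
proof (induction p)
  case (prod g h)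
  from prod(3) show ?case
  proof (induction q)
    case (prod g' h')
    have "product_sum (\<lambda>z. (g (fst z) * g' (fst z)) * (h (snd z) * h' (snd z)))"
      by (rule product_sum.prod[of "\<lambda>x. g x * g' x" "\<lambda>x. h x * h' x"]) (intro continuous_intros prod \<open>continuous_on UNIV g\<close> \<open>continuous_on UNIV h\<close>)+
    then show ?case by (simp add: mult_ac)
  next
    case (add p q)
    then show ?case using product_sum.add by (auto simp: algebra_simps)
  qed
next
  case (add p q)
  then show ?case using product_sum.add by (auto simp: algebra_simps)
qed

lemma product_sum_continuous: "product_sum p \<Longrightarrow> continuous_on S p"
proof (induction p rule: product_sum.induct)
  case (prod g h)
  show ?case
    by (intro continuous_intros continuous_on_compose2[OF prod(1)] continuous_on_compose2[OF prod(2)]) auto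
qed (auto intro: continuous_intros)

lemma product_sum_approx:
  assumes "compact S" "continuous_on S f" "e > 0"
  obtains p where "product_sum p" "\<And>z. z \<in> S \<Longrightarrow> \<bar>f z - p z\<bar> < e"
proof -
  have "\<exists>p. product_sum p \<and> (\<forall>x\<in>S. \<bar>f x - p x\<bar> < e)"
  proof (rule Stone_Weierstrass_HOL[OF assms(1) _ _ _ _ _ assms(2,3)])
    show "product_sum (\<lambda>_. c)" for c using product_sum.prod[of "\<lambda>_. c" "\<lambda>_. 1"] by simp
    fix x y :: "real \<times> real" assume "x \<in> S \<and> y \<in> S \<and> x \<noteq> y"
    then have "fst x \<noteq> fst y \<or> snd x \<noteq> snd y" by (auto simp: prod_eq_iff)
    moreover have "product_sum fst" "product_sum snd"
      using product_sum.prod[of "\<lambda>x. x" "\<lambda>_. 1"] product_sum.prod[of "\<lambda>x. 1" "\<lambda>x. x"] by simp_all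
    ultimately show "\<exists>f. product_sum f \<and> f x \<noteq> f y" by blast
  qed (auto intro: product_sum.add product_sum_mult product_sum_continuous)
  then show ?thesis using that by blast
qed

text \<open>The continuous cutoff dominates the indicator of a large ball's complement, so that tightness of a
  weakly convergent sequence can be read off from a single test function.\<close>

lemma tail_cutoff_small:
  fixes \<nu> :: "'b::real_normed_vector measure"
  assumes "prob_space \<nu>" and [measurable_cong]: "sets \<nu> = sets borel" and "e > 0"
  shows "eventually (\<lambda>m::nat. (\<integral>x. min 1 (max 0 (norm x - real m)) \<partial>\<nu>) < e) sequentially"
proof -
  interpret prob_space \<nu> by fact
  have "(\<lambda>m::nat. \<integral>x. min 1 (max 0 (norm x - real m)) \<partial>\<nu>) \<longlonglongrightarrow> (\<integral>x. 0 \<partial>\<nu>)"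
  proof (rule integral_dominated_convergence[where w="\<lambda>_. 1"])
    have "(\<lambda>m. min 1 (max 0 (norm x - real m))) \<longlonglongrightarrow> 0" for x :: 'b
    proof (rule tendsto_eventually)
      show "eventually (\<lambda>m. min 1 (max 0 (norm x - real m)) = 0) sequentially"
        using eventually_ge_at_top[of "nat \<lceil>norm x\<rceil>"]
        by eventually_elim (simp add: nat_ceiling_le_eq)
    qed
    then show "AE x in \<nu>. (\<lambda>m. min 1 (max 0 (norm x - real m))) \<longlonglongrightarrow> 0" by simp
  qed auto
  then show ?thesis using \<open>e > 0\<close> by (simp add: order_tendsto_iff)
qed

text \<open>On a large square a continuous function is uniformly close to a sum of products
  (Stone--Weierstrass). Clamping the coordinates to the square makes such a sum bounded without changing it there, so its expectations
  converge by the product case; what happens outside the square is controlled by the cutoffs of the two marginals.\<close>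

lemma joint_levy_continuity:
  fixes X Y :: "nat \<Rightarrow> 'a \<Rightarrow> real"
  assumes P: "prob_space M" and \<mu>: "real_distribution \<mu>" and \<nu>: "real_distribution \<nu>"
    and Xm[measurable]: "\<And>n. X n \<in> borel_measurable M" and Ym[measurable]: "\<And>n. Y n \<in> borel_measurable M"
    and lim: "\<And>s t. (\<lambda>n. \<integral>\<omega>. iexp (s * X n \<omega> + t * Y n \<omega>) \<partial>M) \<longlonglongrightarrow> char \<mu> s * char \<nu> t"
  shows "weak_conv_top (\<lambda>n. distr M borel (\<lambda>\<omega>. (X n \<omega>, Y n \<omega>))) (distr (\<mu> \<Otimes>\<^sub>M \<nu>) borel (\<lambda>z. z))"
  unfolding weak_conv_top_def
proof (intro allI impI)
  fix f :: "real \<times> real \<Rightarrow> real"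
  assume f: "continuous_on UNIV f" and "bounded (range f)"
  then obtain B where B: "\<And>z. \<bar>f z\<bar> \<le> B" by (auto simp: bounded_iff)
  have B0: "B \<ge> 0" using B[of 0] by linarith
  interpret prob_space M by fact
  interpret \<mu>: real_distribution \<mu> by fact
  interpret \<nu>: real_distribution \<nu> by fact
  interpret Z: pair_prob_space \<mu> \<nu> ..
  let ?Z = "\<mu> \<Otimes>\<^sub>M \<nu>"
  have [measurable]: "f \<in> borel_measurable borel" using f by (rule borel_measurable_continuous_onI)
  have "sets ?Z = sets (borel \<Otimes>\<^sub>M borel)" by (intro sets_pair_measure_cong) simp_all
  then have id_Z: "(\<lambda>z. z) \<in> ?Z \<rightarrow>\<^sub>M borel"
    by (intro measurable_ident_sets) (simp only: borel_prod)
  have Z_product: "(\<integral>z. g (fst z) * h (snd z) \<partial>?Z) = (\<integral>x. g x \<partial>\<mu>) * (\<integral>y. h y \<partial>\<nu>)"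
    if [measurable]: "g \<in> borel_measurable borel" "h \<in> borel_measurable borel"
      and bd: "\<And>x. \<bar>g x\<bar> \<le> b" "\<And>x. \<bar>h x\<bar> \<le> b" for g h :: "real \<Rightarrow> real" and b
  proof -
    have "b \<ge> 0" using bd(1)[of 0] by linarith
    then have "\<bar>g x * h y\<bar> \<le> b * b" for x y unfolding abs_mult by (intro mult_mono bd) auto
    then have "integrable ?Z (\<lambda>z. g (fst z) * h (snd z))"
      by (intro Z.integrable_const_bound[of _ "b * b"]) auto
    then show ?thesis using Z.integral_fst'[of "\<lambda>z. g (fst z) * h (snd z)"] by simp
  qed
  show "(\<lambda>n. \<integral>z. f z \<partial>distr M borel (\<lambda>\<omega>. (X n \<omega>, Y n \<omega>))) \<longlonglongrightarrow> (\<integral>z. f z \<partial>distr ?Z borel (\<lambda>z. z))"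
  proof (rule LIMSEQ_I)
    fix e' :: real assume "e' > 0"
    \<comment> \<open>room for two approximation errors $e + (2B + 1) \cdot 2e$ and one convergence error $e$\<close>
    define e where "e = min 1 (e' / (8 * B + 8))"
    have e: "e > 0" "e \<le> 1" "e * (8 * B + 8) \<le> e'"
    proof -
      have "e \<le> e' / (8 * B + 8)" by (simp add: e_def)
      then have "e * (8 * B + 8) \<le> e' / (8 * B + 8) * (8 * B + 8)" using B0 by (intro mult_right_mono) auto
      then show "e * (8 * B + 8) \<le> e'" using B0 by simp
    qed (use \<open>e' > 0\<close> B0 in \<open>auto simp: e_def\<close>)
    obtain L :: nat where L: "(\<integral>x. min 1 (max 0 (norm x - real L)) \<partial>\<mu>) < e" "(\<integral>x. min 1 (max 0 (norm x - real L)) \<partial>\<nu>) < e"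
      using eventually_happens'[OF _ eventually_conj[OF tail_cutoff_small[OF \<mu>.prob_space_axioms _ e(1)] tail_cutoff_small[OF \<nu>.prob_space_axioms _ e(1)]]] by auto
    define cut where "cut x = min 1 (max 0 (norm x - real L))" for x :: real
    have cut: "continuous_on UNIV cut" "\<And>x. \<bar>cut x\<bar> \<le> 1" "\<And>x. 0 \<le> cut x" "\<And>x. \<bar>x\<bar> > real L + 1 \<Longrightarrow> cut x = 1"
      unfolding cut_def by (intro continuous_intros) auto
    have [measurable]: "cut \<in> borel_measurable borel" using cut(1) by (rule borel_measurable_continuous_onI)
    define cl where "cl x = max (- (real L + 1)) (min (real L + 1) x)" for x
    have cl: "continuous_on UNIV cl" "\<And>x. cl x \<in> {- (real L + 1)..real L + 1}" "\<And>x. \<bar>x\<bar> \<le> real L + 1 \<Longrightarrow> cl x = x"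
      unfolding cl_def by (intro continuous_intros) auto
    have [measurable]: "cl \<in> borel_measurable borel" using cl(1) by (rule borel_measurable_continuous_onI)
    let ?K = "{- (real L + 1)..real L + 1} \<times> {- (real L + 1)..real L + 1}"
    obtain p where p: "product_sum p" "\<And>z. z \<in> ?K \<Longrightarrow> \<bar>f z - p z\<bar> < e"
      using product_sum_approx[of ?K f e] continuous_on_subset[OF f] e(1) by (auto intro: compact_Times)
    have [measurable]: "p \<in> borel_measurable borel"
      using product_sum_continuous[OF p(1)] by (rule borel_measurable_continuous_onI)
    define q where "q z = p (cl (fst z), cl (snd z))" for z
    have q_bd: "\<bar>q z\<bar> \<le> B + 1" for z
      using p(2)[of "(cl (fst z), cl (snd z))"] B[of "(cl (fst z), cl (snd z))"] cl(2) e(2)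
      unfolding q_def by auto
    have fq: "\<bar>f z - q z\<bar> \<le> e + (2 * B + 1) * (cut (fst z) + cut (snd z))" for z
    proof (cases "\<bar>fst z\<bar> \<le> real L + 1 \<and> \<bar>snd z\<bar> \<le> real L + 1")
      case True
      then have "cl (fst z) = fst z" "cl (snd z) = snd z" using cl(3) by auto
      then have "q z = p z" "z \<in> ?K" using cl(2)[of "fst z"] cl(2)[of "snd z"] by (auto simp: q_def mem_Times_iff)
      then have "\<bar>f z - q z\<bar> \<le> e" using p(2)[of z] by simp
      moreover have "0 \<le> (2 * B + 1) * (cut (fst z) + cut (snd z))"
        using B0 cut(3) by (intro mult_nonneg_nonneg add_nonneg_nonneg) auto
      ultimately show ?thesis by linarith
    next
      case False
      then have "1 \<le> cut (fst z) + cut (snd z)"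
        using cut(3)[of "fst z"] cut(3)[of "snd z"] cut(4)[of "fst z"] cut(4)[of "snd z"]
        by (cases "\<bar>fst z\<bar> \<le> real L + 1") (simp_all add: not_le)
      then have "(2 * B + 1) * 1 \<le> (2 * B + 1) * (cut (fst z) + cut (snd z))"
        using B0 by (intro mult_left_mono) auto
      moreover have "\<bar>f z - q z\<bar> \<le> B + (B + 1)" using B[of z] q_bd[of z] by linarith
      ultimately show ?thesis using e(1) by simp
    qed
    have approx: "\<bar>(\<integral>\<omega>. f (U \<omega>, V \<omega>) \<partial>N) - (\<integral>\<omega>. q (U \<omega>, V \<omega>) \<partial>N)\<bar>
         \<le> e + (2 * B + 1) * ((\<integral>\<omega>. cut (U \<omega>) \<partial>N) + (\<integral>\<omega>. cut (V \<omega>) \<partial>N))"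
      if N: "prob_space N" and [measurable]: "U \<in> borel_measurable N" "V \<in> borel_measurable N" for N :: "'c measure" and U V
    proof -
      interpret N: prob_space N by fact
      have [measurable]: "q \<in> borel_measurable borel" unfolding q_def borel_prod[symmetric] by measurable
      have i: "integrable N (\<lambda>\<omega>. cut (U \<omega>))" "integrable N (\<lambda>\<omega>. cut (V \<omega>))"
        by (rule N.integrable_const_bound[of _ 1]; use cut(2) in simp)+
      have i2: "integrable N (\<lambda>\<omega>. f (U \<omega>, V \<omega>))" by (rule N.integrable_const_bound[of _ B]) (use B in auto)
      have i3: "integrable N (\<lambda>\<omega>. q (U \<omega>, V \<omega>))" by (rule N.integrable_const_bound[of _ "B + 1"]) (use q_bd in auto)
      have "\<bar>(\<integral>\<omega>. f (U \<omega>, V \<omega>) \<partial>N) - (\<integral>\<omega>. q (U \<omega>, V \<omega>) \<partial>N)\<bar> = \<bar>\<integral>\<omega>. f (U \<omega>, V \<omega>) - q (U \<omega>, V \<omega>) \<partial>N\<bar>"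
        using i2 i3 by simp
      also have "\<dots> \<le> (\<integral>\<omega>. \<bar>f (U \<omega>, V \<omega>) - q (U \<omega>, V \<omega>)\<bar> \<partial>N)" by (rule integral_abs_bound)
      also have "\<dots> \<le> (\<integral>\<omega>. e + (2 * B + 1) * (cut (U \<omega>) + cut (V \<omega>)) \<partial>N)"
        using i i2 i3 fq by (intro integral_mono) auto
      also have "\<dots> = e + (2 * B + 1) * ((\<integral>\<omega>. cut (U \<omega>) \<partial>N) + (\<integral>\<omega>. cut (V \<omega>) \<partial>N))"
        using i by (simp add: N.prob_space)
      finally show ?thesis .
    qed
    have q_lim: "(\<lambda>n. \<integral>\<omega>. q (X n \<omega>, Y n \<omega>) \<partial>M) \<longlonglongrightarrow> (\<integral>z. q z \<partial>?Z)"
    proof -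
      have bdd: "\<exists>b. \<forall>x. \<bar>g (cl x)\<bar> \<le> b" if "continuous_on UNIV g" for g :: "real \<Rightarrow> real"
      proof -
        have "bounded (g ` {- (real L + 1)..real L + 1})"
          by (intro compact_imp_bounded compact_continuous_image continuous_on_subset[OF that]) auto
        then show ?thesis using cl(2) unfolding bounded_iff by force
      qed
      have "(\<lambda>n. \<integral>\<omega>. p (cl (X n \<omega>), cl (Y n \<omega>)) \<partial>M) \<longlonglongrightarrow> (\<integral>z. p (cl (fst z), cl (snd z)) \<partial>?Z)
         \<and> (\<exists>b. \<forall>x y. \<bar>p (cl x, cl y)\<bar> \<le> b)"
        using p(1)
      proof (induction p)
        case (prod g h)
        obtain a b where a: "\<And>x. \<bar>g (cl x)\<bar> \<le> a" and b: "\<And>x. \<bar>h (cl x)\<bar> \<le> b"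
          using bdd[OF prod(1)] bdd[OF prod(2)] by auto
        have c: "continuous_on UNIV (\<lambda>x. g (cl x))" "continuous_on UNIV (\<lambda>x. h (cl x))"
          by (auto intro: continuous_on_compose2[OF prod(1) cl(1)] continuous_on_compose2[OF prod(2) cl(1)])
        have [measurable]: "(\<lambda>x. g (cl x)) \<in> borel_measurable borel" "(\<lambda>x. h (cl x)) \<in> borel_measurable borel"
          using c by (auto intro: borel_measurable_continuous_onI)
        have "(\<integral>z. g (cl (fst z)) * h (cl (snd z)) \<partial>?Z) = (\<integral>x. g (cl x) \<partial>\<mu>) * (\<integral>x. h (cl x) \<partial>\<nu>)"
          by (rule Z_product[of _ _ "max a b"]) (use a b in \<open>auto simp: le_max_iff_disj\<close>)
        moreover have "\<bar>g (cl x) * h (cl y)\<bar> \<le> a * b" for x y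
          unfolding abs_mult by (intro mult_mono a b order_trans[OF abs_ge_zero a]) auto
        ultimately show ?case
          using joint_char_imp_product_conv[OF P \<mu> \<nu> Xm Ym lim c(1) a c(2) b] by auto
      next
        case (add p q)
        from add.IH obtain a b where a: "\<And>x y. \<bar>p (cl x, cl y)\<bar> \<le> a" and b: "\<And>x y. \<bar>q (cl x, cl y)\<bar> \<le> b" by blast
        have [measurable]: "p \<in> borel_measurable borel" "q \<in> borel_measurable borel"
          using add.hyps by (auto intro: borel_measurable_continuous_onI product_sum_continuous)
        have i: "integrable N (\<lambda>z. p (cl (U z), cl (V z)))" "integrable N (\<lambda>z. q (cl (U z), cl (V z)))"
          if "prob_space N" and [measurable]: "U \<in> borel_measurable N" "V \<in> borel_measurable N" for N :: "'d measure" and U V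
        proof -
          interpret N: prob_space N by fact
          show "integrable N (\<lambda>z. p (cl (U z), cl (V z)))" by (rule N.integrable_const_bound[of _ a]) (use a in auto)
          show "integrable N (\<lambda>z. q (cl (U z), cl (V z)))" by (rule N.integrable_const_bound[of _ b]) (use b in auto)
        qed
        have "\<bar>p (cl x, cl y) + q (cl x, cl y)\<bar> \<le> a + b" for x y using a[of x y] b[of x y] by linarith
        moreover have "(\<lambda>n. (\<integral>\<omega>. p (cl (X n \<omega>), cl (Y n \<omega>)) \<partial>M) + (\<integral>\<omega>. q (cl (X n \<omega>), cl (Y n \<omega>)) \<partial>M)) \<longlonglongrightarrow>
           (\<integral>z. p (cl (fst z), cl (snd z)) \<partial>?Z) + (\<integral>z. q (cl (fst z), cl (snd z)) \<partial>?Z)"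
          using add.IH by (intro tendsto_add) auto
        ultimately show ?case
          using i[OF P Xm Ym] i[OF Z.prob_space_axioms, of fst snd] by auto
      qed
      then show ?thesis unfolding q_def by simp
    qed
    have "(\<lambda>n. (\<integral>\<omega>. cut (X n \<omega>) \<partial>M) + (\<integral>\<omega>. cut (Y n \<omega>) \<partial>M)) \<longlonglongrightarrow> (\<integral>x. cut x \<partial>\<mu>) + (\<integral>x. cut x \<partial>\<nu>)"
      using joint_char_imp_product_conv[OF P \<mu> \<nu> Xm Ym lim cut(1,2), of "\<lambda>_. 1" 1]
       joint_char_imp_product_conv[OF P \<mu> \<nu> Xm Ym lim _ _ cut(1,2), of "\<lambda>_. 1" 1]
       \<mu>.prob_space \<nu>.prob_space
      by (intro tendsto_add) auto
    moreover have lt: "(\<integral>x. cut x \<partial>\<mu>) + (\<integral>x. cut x \<partial>\<nu>) < 2 * e" using L unfolding cut_def by simp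
    ultimately have ev1: "eventually (\<lambda>n. (\<integral>\<omega>. cut (X n \<omega>) \<partial>M) + (\<integral>\<omega>. cut (Y n \<omega>) \<partial>M) < 2 * e) sequentially"
      by (rule order_tendstoD)
    have ev2: "eventually (\<lambda>n. \<bar>(\<integral>\<omega>. q (X n \<omega>, Y n \<omega>) \<partial>M) - (\<integral>z. q z \<partial>?Z)\<bar> < e) sequentially"
      using tendstoD[OF q_lim e(1)] by (simp add: dist_real_def)
    have "(\<integral>z. cut (fst z) \<partial>?Z) = (\<integral>x. cut x \<partial>\<mu>)" "(\<integral>z. cut (snd z) \<partial>?Z) = (\<integral>x. cut x \<partial>\<nu>)"
      using Z_product[of cut "\<lambda>_. 1" 1] Z_product[of "\<lambda>_. 1" cut 1] cut(2) \<mu>.prob_space \<nu>.prob_space by auto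
    then have Zf: "\<bar>(\<integral>z. f z \<partial>?Z) - (\<integral>z. q z \<partial>?Z)\<bar> \<le> e + (2 * B + 1) * ((\<integral>x. cut x \<partial>\<mu>) + (\<integral>x. cut x \<partial>\<nu>))"
      using approx[OF Z.prob_space_axioms, of fst snd] by simp
    have small: "e + (2 * B + 1) * s \<le> e + (2 * B + 1) * (2 * e)" if "s < 2 * e" for s
      using that B0 by (intro add_left_mono mult_left_mono) auto
    have "eventually (\<lambda>n. \<bar>(\<integral>\<omega>. f (X n \<omega>, Y n \<omega>) \<partial>M) - (\<integral>z. f z \<partial>?Z)\<bar> < e') sequentially"
      using ev1 ev2
    proof eventually_elim
      case (elim n)
      have "\<bar>(\<integral>\<omega>. f (X n \<omega>, Y n \<omega>) \<partial>M) - (\<integral>z. f z \<partial>?Z)\<bar> < 2 * (e + (2 * B + 1) * (2 * e)) + e"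
        using order_trans[OF approx[OF P Xm Ym] small[OF elim(1)]] elim(2)
          order_trans[OF Zf small[OF lt]]
        by (smt (verit))
      also have "\<dots> \<le> e'" using e(1,3) by (simp add: algebra_simps)
      finally show ?case .
    qed
    then obtain N where "\<And>n. n \<ge> N \<Longrightarrow> \<bar>(\<integral>\<omega>. f (X n \<omega>, Y n \<omega>) \<partial>M) - (\<integral>z. f z \<partial>?Z)\<bar> < e'"
      unfolding eventually_sequentially by blast
    then show "\<exists>N. \<forall>n\<ge>N. norm ((\<integral>z. f z \<partial>distr M borel (\<lambda>\<omega>. (X n \<omega>, Y n \<omega>))) - (\<integral>z. f z \<partial>distr ?Z borel (\<lambda>z. z))) < e'"
      by (intro exI[of _ N]) (simp add: integral_distr integral_distr[OF id_Z])
  qed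
qed

section \<open>Slutsky-type results in Euclidean space\<close>

lemma weak_conv_top_continuous_map:
  fixes X :: "nat \<Rightarrow> 'a \<Rightarrow> 'b::topological_space" and T :: "'b \<Rightarrow> 'c::topological_space"
  assumes X[measurable]: "\<And>n. X n \<in> borel_measurable M" and \<nu>[measurable_cong]: "sets \<nu> = sets borel"
    and w: "weak_conv_top (\<lambda>n. distr M borel (X n)) \<nu>" and T: "continuous_on UNIV T"
  shows "weak_conv_top (\<lambda>n. distr M borel (\<lambda>\<omega>. T (X n \<omega>))) (distr \<nu> borel T)"
  unfolding weak_conv_top_def
proof (intro allI impI)
  fix f :: "'c \<Rightarrow> real" assume f: "continuous_on UNIV f" "bounded (range f)"
  have [measurable]: "f \<in> borel_measurable borel" "T \<in> borel_measurable borel"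
    using f(1) T by (auto intro: borel_measurable_continuous_onI)
  have "continuous_on UNIV (\<lambda>x. f (T x))" by (rule continuous_on_compose2[OF f(1) T]) auto
  moreover have "bounded (range (\<lambda>x. f (T x)))" using f(2) by (rule bounded_subset) auto
  ultimately have "(\<lambda>n. \<integral>x. f (T x) \<partial>distr M borel (X n)) \<longlonglongrightarrow> (\<integral>x. f (T x) \<partial>\<nu>)"
    using w unfolding weak_conv_top_def by blast
  then show "(\<lambda>n. \<integral>x. f x \<partial>distr M borel (\<lambda>\<omega>. T (X n \<omega>))) \<longlonglongrightarrow> (\<integral>x. f x \<partial>distr \<nu> borel T)"
    by (simp add: integral_distr)
qed

lemma weak_conv_top_slutsky:
  fixes X Y :: "nat \<Rightarrow> 'a \<Rightarrow> 'b::euclidean_space"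
  assumes P: "prob_space M" and X[measurable]: "\<And>n. X n \<in> borel_measurable M" and Y[measurable]: "\<And>n. Y n \<in> borel_measurable M"
    and \<nu>: "prob_space \<nu>" "sets \<nu> = sets borel"
    and w: "weak_conv_top (\<lambda>n. distr M borel (X n)) \<nu>"
    and d: "\<And>\<delta>. \<delta> > 0 \<Longrightarrow> (\<lambda>n. measure M {\<omega> \<in> space M. norm (X n \<omega> - Y n \<omega>) > \<delta>}) \<longlonglongrightarrow> 0"
  shows "weak_conv_top (\<lambda>n. distr M borel (Y n)) \<nu>"
  unfolding weak_conv_top_def
proof (intro allI impI)
  fix f :: "'b \<Rightarrow> real"
  assume f: "continuous_on UNIV f" and bf: "bounded (range f)"
  then obtain B where B: "\<And>z. \<bar>f z\<bar> \<le> B" by (auto simp: bounded_iff)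
  have B0: "B \<ge> 0" using B[of 0] by linarith
  interpret prob_space M by fact
  have [measurable]: "f \<in> borel_measurable borel" using f by (rule borel_measurable_continuous_onI)
  have iX: "integrable M (\<lambda>\<omega>. f (X n \<omega>))" for n by (rule integrable_const_bound[of _ B]) (use B in auto)
  have iY: "integrable M (\<lambda>\<omega>. f (Y n \<omega>))" for n by (rule integrable_const_bound[of _ B]) (use B in auto)
  have "(\<lambda>n. (\<integral>\<omega>. f (X n \<omega>) \<partial>M) - (\<integral>\<omega>. f (Y n \<omega>) \<partial>M)) \<longlonglongrightarrow> 0"
  proof (rule LIMSEQ_I)
    fix e' :: real assume "e' > 0"
    \<comment> \<open>the estimate at the end is $e + 2B (e + e)$, strictly below \<open>e'\<close>\<close>
    define e where "e = e' / (4 * B + 2)"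
    have e: "e > 0" "e * (4 * B + 2) = e'"
      using \<open>e' > 0\<close> B0 by (auto simp: e_def field_simps)
    obtain L :: nat where L: "(\<integral>x. min 1 (max 0 (norm x - real L)) \<partial>\<nu>) < e"
      using eventually_happens'[OF _ tail_cutoff_small[OF \<nu> e(1)]] by auto
    define cut where "cut x = min 1 (max 0 (norm x - real L))" for x :: 'b
    have cut: "continuous_on UNIV cut" "\<And>x. \<bar>cut x\<bar> \<le> 1" "\<And>x. 0 \<le> cut x" "\<And>x. norm x > real L + 1 \<Longrightarrow> cut x = 1"
      unfolding cut_def by (intro continuous_intros) auto
    have [measurable]: "cut \<in> borel_measurable borel" using cut(1) by (rule borel_measurable_continuous_onI)
    have icut: "integrable M (\<lambda>\<omega>. cut (X n \<omega>))" for n by (rule integrable_const_bound[of _ 1]) (use cut in auto)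
    have "bounded (range cut)" using cut(2) by (auto simp: bounded_iff)
    then have "(\<lambda>n. \<integral>x. cut x \<partial>distr M borel (X n)) \<longlonglongrightarrow> (\<integral>x. cut x \<partial>\<nu>)"
      using w cut(1) unfolding weak_conv_top_def by blast
    then have "(\<lambda>n. \<integral>\<omega>. cut (X n \<omega>) \<partial>M) \<longlonglongrightarrow> (\<integral>x. cut x \<partial>\<nu>)" by (simp add: integral_distr)
    then have ev1: "eventually (\<lambda>n. (\<integral>\<omega>. cut (X n \<omega>) \<partial>M) < e) sequentially"
      using L unfolding cut_def by (rule order_tendstoD)
    have "uniformly_continuous_on (cball 0 (real L + 2)) f"
      by (intro compact_uniformly_continuous continuous_on_subset[OF f]) auto
    then obtain \<delta>' where \<delta>': "\<delta>' > 0" "\<And>x y. x \<in> cball 0 (real L + 2) \<Longrightarrow> y \<in> cball 0 (real L + 2) \<Longrightarrow> dist y x < \<delta>' \<Longrightarrow> dist (f y) (f x) < e"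
      unfolding uniformly_continuous_on_def using e(1) by metis
    define \<delta> where "\<delta> = min 1 (\<delta>' / 2)"
    have \<delta>: "\<delta> > 0" "\<delta> \<le> 1" "\<delta> < \<delta>'" using \<delta>'(1) by (auto simp: \<delta>_def)
    let ?A = "\<lambda>n. {\<omega> \<in> space M. norm (X n \<omega> - Y n \<omega>) > \<delta>}"
    have ev2: "eventually (\<lambda>n. measure M (?A n) < e) sequentially"
      using d[OF \<delta>(1)] e(1) by (simp add: order_tendsto_iff)
    have pw: "\<bar>f (X n \<omega>) - f (Y n \<omega>)\<bar> \<le> e + 2 * B * (cut (X n \<omega>) + indicator (?A n) \<omega>)" if "\<omega> \<in> space M" for n \<omega>
    proof (cases "norm (X n \<omega>) \<le> real L + 1 \<and> norm (X n \<omega> - Y n \<omega>) \<le> \<delta>")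
      case True
      have "norm (Y n \<omega>) \<le> norm (X n \<omega>) + norm (X n \<omega> - Y n \<omega>)"
        by (metis norm_minus_commute norm_triangle_sub add.commute)
      then have "dist (f (X n \<omega>)) (f (Y n \<omega>)) < e"
        using True \<delta> by (intro \<delta>'(2)) (auto simp: dist_norm)
      moreover have "0 \<le> 2 * B * (cut (X n \<omega>) + indicator (?A n) \<omega>)"
        using B0 cut(3)[of "X n \<omega>"] by simp
      ultimately show ?thesis by (simp add: dist_real_def)
    next
      case False
      then have "1 \<le> cut (X n \<omega>) + indicator (?A n) \<omega>"
        using cut(3)[of "X n \<omega>"] cut(4)[of "X n \<omega>"] that by (auto simp: indicator_def)
      then have "2 * B * 1 \<le> 2 * B * (cut (X n \<omega>) + indicator (?A n) \<omega>)" using B0 by (intro mult_left_mono) auto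
      then show ?thesis using B[of "X n \<omega>"] B[of "Y n \<omega>"] e(1) by linarith
    qed
    have "eventually (\<lambda>n. norm ((\<integral>\<omega>. f (X n \<omega>) \<partial>M) - (\<integral>\<omega>. f (Y n \<omega>) \<partial>M) - 0) < e') sequentially"
      using ev1 ev2
    proof eventually_elim
      case (elim n)
      have "\<bar>(\<integral>\<omega>. f (X n \<omega>) \<partial>M) - (\<integral>\<omega>. f (Y n \<omega>) \<partial>M)\<bar> = \<bar>\<integral>\<omega>. f (X n \<omega>) - f (Y n \<omega>) \<partial>M\<bar>"
        using iX iY by simp
      also have "\<dots> \<le> (\<integral>\<omega>. \<bar>f (X n \<omega>) - f (Y n \<omega>)\<bar> \<partial>M)" by (rule integral_abs_bound)
      also have "\<dots> \<le> (\<integral>\<omega>. e + 2 * B * (cut (X n \<omega>) + indicator (?A n) \<omega>) \<partial>M)"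
        using iX iY icut pw by (intro integral_mono) (auto intro!: integrable_real_indicator simp: emeasure_eq_measure)
      also have "\<dots> = e + 2 * B * ((\<integral>\<omega>. cut (X n \<omega>) \<partial>M) + measure M (?A n))"
        using icut by (simp add: prob_space emeasure_eq_measure)
      also have "\<dots> \<le> e + 2 * B * (e + e)" using elim B0 by (intro add_left_mono mult_left_mono) auto
      also have "\<dots> < e'" using e by (simp add: algebra_simps)
      finally show ?case by simp
    qed
    then show "\<exists>N. \<forall>n\<ge>N. norm ((\<integral>\<omega>. f (X n \<omega>) \<partial>M) - (\<integral>\<omega>. f (Y n \<omega>) \<partial>M) - 0) < e'"
      unfolding eventually_sequentially .
  qed
  moreover have "(\<lambda>n. \<integral>\<omega>. f (X n \<omega>) \<partial>M) \<longlonglongrightarrow> (\<integral>x. f x \<partial>\<nu>)"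
    using w f bf unfolding weak_conv_top_def by (auto simp: integral_distr)
  ultimately have "(\<lambda>n. \<integral>\<omega>. f (Y n \<omega>) \<partial>M) \<longlonglongrightarrow> (\<integral>x. f x \<partial>\<nu>)"
    using tendsto_diff[of "\<lambda>n. \<integral>\<omega>. f (X n \<omega>) \<partial>M"] by fastforce
  then show "(\<lambda>n. \<integral>x. f x \<partial>distr M borel (Y n)) \<longlonglongrightarrow> (\<integral>x. f x \<partial>\<nu>)" by (simp add: integral_distr)
qed

lemma small_o_prob_if_L1:
  assumes P: "prob_space M" and i: "\<And>n. integrable M (R n)"
    and l: "(\<lambda>n. \<integral>\<omega>. \<bar>R n \<omega>\<bar> \<partial>M) \<longlonglongrightarrow> 0"
  shows "small_o_prob M R (\<lambda>_. 1)"
  unfolding small_o_prob_def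
proof (intro allI impI)
  fix \<delta> :: real assume \<delta>: "\<delta> > 0"
  interpret prob_space M by fact
  have [measurable]: "R n \<in> borel_measurable M" for n using i by auto
  have markov: "norm (measure M {\<omega> \<in> space M. \<bar>R n \<omega> / 1\<bar> > \<delta>}) \<le> (\<integral>\<omega>. \<bar>R n \<omega>\<bar> \<partial>M) / \<delta>" for n
  proof -
    have "measure M {\<omega> \<in> space M. \<bar>R n \<omega> / 1\<bar> > \<delta>} \<le> measure M {\<omega> \<in> space M. \<bar>R n \<omega>\<bar> \<ge> \<delta>}"
      by (intro finite_measure_mono) auto
    also have "\<dots> \<le> (\<integral>\<omega>. \<bar>R n \<omega>\<bar> \<partial>M) / \<delta>"
      using i \<delta> by (intro integral_Markov_inequality_measure[where A="{}"]) auto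
    finally show ?thesis by simp
  qed
  have "(\<lambda>n. (\<integral>\<omega>. \<bar>R n \<omega>\<bar> \<partial>M) / \<delta>) \<longlonglongrightarrow> 0" using tendsto_divide[OF l tendsto_const[of \<delta>]] \<delta> by simp
  then show "(\<lambda>n. measure M {\<omega> \<in> space M. \<bar>R n \<omega> / 1\<bar> > \<delta>}) \<longlonglongrightarrow> 0"
    by (rule Lim_null_comparison[OF always_eventually[OF allI[OF markov]]])
qed

lemma small_o_prob_if_L2:
  assumes P: "prob_space M" and R[measurable]: "\<And>n. R n \<in> borel_measurable M" and i: "\<And>n. integrable M (\<lambda>\<omega>. (R n \<omega>)\<^sup>2)"
    and l: "(\<lambda>n. \<integral>\<omega>. (R n \<omega>)\<^sup>2 \<partial>M) \<longlonglongrightarrow> 0"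
  shows "small_o_prob M R (\<lambda>_. 1)"
  unfolding small_o_prob_def
proof (intro allI impI)
  fix \<delta> :: real assume \<delta>: "\<delta> > 0"
  have "small_o_prob M (\<lambda>n \<omega>. (R n \<omega>)\<^sup>2) (\<lambda>_. 1)"
    by (rule small_o_prob_if_L1[OF P]) (use i l in auto)
  from this[unfolded small_o_prob_def, rule_format, of "\<delta>\<^sup>2"]
  have "(\<lambda>n. measure M {\<omega> \<in> space M. \<bar>(R n \<omega>)\<^sup>2 / 1\<bar> > \<delta>\<^sup>2}) \<longlonglongrightarrow> 0"
    using \<delta> by simp
  moreover have "\<bar>x\<^sup>2 / 1\<bar> > \<delta>\<^sup>2 \<longleftrightarrow> \<bar>x / 1\<bar> > \<delta>" for x
    using \<delta> abs_le_square_iff[of x \<delta>] by (auto simp: not_less[symmetric])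
  ultimately show "(\<lambda>n. measure M {\<omega> \<in> space M. \<bar>R n \<omega> / 1\<bar> > \<delta>}) \<longlonglongrightarrow> 0"
    by (simp only:)
qed

text \<open>Convergence in probability to a constant is joint with any weak convergence.
  Remainders handled as extra coordinates need no separate calculus of stochastic orders.\<close>

lemma weak_conv_top_append_null:
  fixes X :: "nat \<Rightarrow> 'a \<Rightarrow> 'b::euclidean_space" and R :: "nat \<Rightarrow> 'a \<Rightarrow> real"
  assumes P: "prob_space M" and X[measurable]: "\<And>n. X n \<in> borel_measurable M" and R[measurable]: "\<And>n. R n \<in> borel_measurable M"
    and \<nu>: "prob_space \<nu>" and \<nu>s[measurable_cong]: "sets \<nu> = sets borel"
    and w: "weak_conv_top (\<lambda>n. distr M borel (X n)) \<nu>"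
    and R0: "small_o_prob M R (\<lambda>_. 1)"
  shows "weak_conv_top (\<lambda>n. distr M borel (\<lambda>\<omega>. (X n \<omega>, R n \<omega>))) (distr \<nu> borel (\<lambda>x. (x, 0)))"
proof -
  have "(\<lambda>x. (x, 0::real)) \<in> borel \<rightarrow>\<^sub>M (borel :: ('b \<times> real) measure)"
    by (intro borel_measurable_continuous_onI continuous_intros)
  then have "(\<lambda>x. (x, 0::real)) \<in> \<nu> \<rightarrow>\<^sub>M borel"
    unfolding measurable_cong_sets[OF \<nu>s refl] .
  then have p: "prob_space (distr \<nu> borel (\<lambda>x. (x, 0::real)))"
    by (rule prob_space.prob_space_distr[OF \<nu>])
  have w0: "weak_conv_top (\<lambda>n. distr M borel (\<lambda>\<omega>. (X n \<omega>, 0))) (distr \<nu> borel (\<lambda>x. (x, 0::real)))"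
    by (rule weak_conv_top_continuous_map[OF X \<nu>s w, where T="\<lambda>x. (x, 0::real)"]) (intro continuous_intros)
  have null: "(\<lambda>n. measure M {\<omega> \<in> space M. \<delta> < norm ((X n \<omega>, 0) - (X n \<omega>, R n \<omega>))}) \<longlonglongrightarrow> 0" if "\<delta> > 0" for \<delta>
  proof -
    have "norm ((X n \<omega>, 0) - (X n \<omega>, R n \<omega>)) = \<bar>R n \<omega> / 1\<bar>" for n \<omega> by (simp add: norm_Pair)
    then show ?thesis using R0[unfolded small_o_prob_def, rule_format, OF that] by (simp only:)
  qed
  show ?thesis
  proof (rule weak_conv_top_slutsky[OF P _ _ p _ w0])
    show "(\<lambda>\<omega>. (X n \<omega>, 0::real)) \<in> borel_measurable M" for n
      by (rule borel_measurable_Pair[OF X borel_measurable_const])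
    show "(\<lambda>\<omega>. (X n \<omega>, R n \<omega>)) \<in> borel_measurable M" for n
      by (rule borel_measurable_Pair[OF X R])
  qed (rule sets_distr, rule null)
qed

lemma weak_conv_top_append_null_distr:
  fixes X :: "nat \<Rightarrow> 'a \<Rightarrow> 'b::euclidean_space" and R :: "nat \<Rightarrow> 'a \<Rightarrow> real" and T :: "'q \<Rightarrow> 'b"
  assumes P: "prob_space M" and X: "\<And>n. X n \<in> borel_measurable M" and R: "\<And>n. R n \<in> borel_measurable M"
    and Q: "prob_space Q" and T: "T \<in> borel_measurable Q"
    and w: "weak_conv_top (\<lambda>n. distr M borel (X n)) (distr Q borel T)"
    and R0: "small_o_prob M R (\<lambda>_. 1)"
  shows "weak_conv_top (\<lambda>n. distr M borel (\<lambda>\<omega>. (X n \<omega>, R n \<omega>))) (distr Q borel (\<lambda>z. (T z, 0)))"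
proof -
  have "(\<lambda>x. (x, 0::real)) \<in> borel \<rightarrow>\<^sub>M (borel :: ('b \<times> real) measure)"
    by (intro borel_measurable_continuous_onI continuous_intros)
  then have "distr (distr Q borel T) borel (\<lambda>x. (x, 0::real)) = distr Q borel (\<lambda>z. (T z, 0))"
    by (simp add: distr_distr[OF _ T] comp_def)
  then show ?thesis
    using weak_conv_top_append_null[OF P X R prob_space.prob_space_distr[OF Q T] sets_distr w R0] by simp
qed

section \<open>Normal laws and the Cauchy ratio\<close>

lemma real_distribution_normal_law: "v > 0 \<Longrightarrow> real_distribution (normal_law m v)"
  unfolding real_distribution_def real_distribution_axioms_def normal_law_def
  using prob_space_normal_density[of "sqrt v" m] by auto

lemma normal_law_eq_distr_std:
  assumes "v > 0"
  shows "normal_law 0 v = distr std_normal_distribution borel (\<lambda>x. sqrt v * x)"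
proof -
  interpret N: prob_space std_normal_distribution by (rule prob_space_normal_density) simp
  have "distributed std_normal_distribution lborel (\<lambda>x. x) std_normal_density"
    unfolding distributed_def by (auto simp: distr_id2)
  from N.normal_density_affine[OF this, of "sqrt v" 0] assms
  have "distributed std_normal_distribution lborel (\<lambda>x. sqrt v * x) (normal_density 0 (sqrt v))" by simp
  then have "distr std_normal_distribution lborel (\<lambda>x. sqrt v * x) = normal_law 0 v"
    unfolding distributed_def normal_law_def by auto
  then show ?thesis by (metis distr_cong sets_lborel)
qed

lemma char_normal_law:
  assumes "v > 0"
  shows "char (normal_law 0 v) t = complex_of_real (exp (- v * t\<^sup>2 / 2))"
proof -
  have "char (normal_law 0 v) t = char std_normal_distribution (t * sqrt v)"
    unfolding normal_law_eq_distr_std[OF assms] char_def by (subst integral_distr) (auto simp: mult.assoc)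
  also have "\<dots> = complex_of_real (exp (- v * t\<^sup>2 / 2))"
    using assms by (simp add: char_std_normal_distribution power_mult_distrib mult.commute)
  finally show ?thesis .
qed

text \<open>Completing the square: exponential tilting of a normal law only shifts its mean.\<close>

lemma normal_density_mult_exp:
  assumes "s > 0"
  shows "normal_density 0 s x * exp (b * x) = exp (s\<^sup>2 * b\<^sup>2 / 2) * normal_density (s\<^sup>2 * b) s x"
proof -
  have "- (x - 0)\<^sup>2 / (2 * s\<^sup>2) + b * x = s\<^sup>2 * b\<^sup>2 / 2 + - (x - s\<^sup>2 * b)\<^sup>2 / (2 * s\<^sup>2)"
    using assms by (simp add: field_simps power2_eq_square)
  then show ?thesis
    unfolding normal_density_def by (simp add: exp_add[symmetric] field_simps del: diff_0_right)
qed

lemma normal_law_mgf: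
  assumes "v > 0"
  shows "integrable (normal_law 0 v) (\<lambda>x. exp (b * x))" "(\<integral>x. exp (b * x) \<partial>normal_law 0 v) = exp (v * b\<^sup>2 / 2)"
proof -
  have e: "normal_density 0 (sqrt v) x * exp (b * x) = exp (v * b\<^sup>2 / 2) * normal_density (v * b) (sqrt v) x" for x
    using normal_density_mult_exp[of "sqrt v" x b] assms by simp
  show "integrable (normal_law 0 v) (\<lambda>x. exp (b * x))"
    unfolding normal_law_def using assms by (subst integrable_density) (auto simp: e)
  show "(\<integral>x. exp (b * x) \<partial>normal_law 0 v) = exp (v * b\<^sup>2 / 2)"
    unfolding normal_law_def using assms by (subst integral_density) (auto simp: e)
qed

text \<open>The product of the two densities is a multiple of a centred normal density in \<open>w\<close>, with variance
  $s^2/(1+x^2)$, so the integral is its first absolute moment.\<close>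

lemma nn_integral_abs_normal_product:
  assumes "s > 0"
  shows "(\<integral>\<^sup>+w. ennreal (\<bar>w\<bar> * (normal_density 0 s w * normal_density 0 s (x * w))) \<partial>lborel) = ennreal (1 / (pi * (1 + x\<^sup>2)))"
proof -
  have x2: "1 + x\<^sup>2 > 0" by (simp add: add_pos_nonneg)
  define \<tau> where "\<tau> = s / sqrt (1 + x\<^sup>2)"
  have \<tau>: "\<tau> > 0" "\<tau>\<^sup>2 = s\<^sup>2 / (1 + x\<^sup>2)" using assms x2 by (auto simp: \<tau>_def power_divide)
  have e: "\<bar>w\<bar> * (normal_density 0 s w * normal_density 0 s (x * w))
      = (sqrt (2 * pi * \<tau>\<^sup>2) / (2 * pi * s\<^sup>2)) * (normal_density 0 \<tau> w * \<bar>w - 0\<bar> ^ (2 * 0 + 1))" for w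
  proof -
    have "- w\<^sup>2 / (2 * s\<^sup>2) + - (x * w)\<^sup>2 / (2 * s\<^sup>2) = - w\<^sup>2 / (2 * \<tau>\<^sup>2)"
      unfolding \<tau>(2) using assms x2 by (simp add: field_simps)
    then have "exp (- w\<^sup>2 / (2 * s\<^sup>2)) * exp (- (x * w)\<^sup>2 / (2 * s\<^sup>2)) = exp (- w\<^sup>2 / (2 * \<tau>\<^sup>2))"
      by (simp add: exp_add[symmetric])
    then have "normal_density 0 s w * normal_density 0 s (x * w)
        = 1 / (sqrt (2 * pi * s\<^sup>2) * sqrt (2 * pi * s\<^sup>2)) * exp (- w\<^sup>2 / (2 * \<tau>\<^sup>2))"
      unfolding normal_density_def by (simp add: algebra_simps)
    also have "sqrt (2 * pi * s\<^sup>2) * sqrt (2 * pi * s\<^sup>2) = 2 * pi * s\<^sup>2" by simp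
    also have "exp (- w\<^sup>2 / (2 * \<tau>\<^sup>2)) = sqrt (2 * pi * \<tau>\<^sup>2) * normal_density 0 \<tau> w"
      using \<tau>(1) by (simp add: normal_density_def)
    finally show ?thesis by simp
  qed
  have "has_bochner_integral lborel (\<lambda>w. normal_density 0 \<tau> w * \<bar>w - 0\<bar> ^ (2 * 0 + 1)) (2 ^ 0 * \<tau> ^ (2 * 0 + 1) * fact 0 * sqrt (2 / pi))"
    by (rule normal_moment_abs_odd[OF \<tau>(1)])
  then have "has_bochner_integral lborel (\<lambda>w. \<bar>w\<bar> * (normal_density 0 s w * normal_density 0 s (x * w)))
     ((sqrt (2 * pi * \<tau>\<^sup>2) / (2 * pi * s\<^sup>2)) * (2 ^ 0 * \<tau> ^ (2 * 0 + 1) * fact 0 * sqrt (2 / pi)))"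
    unfolding e by - (rule has_bochner_integral_mult_right)
  moreover have "(sqrt (2 * pi * \<tau>\<^sup>2) / (2 * pi * s\<^sup>2)) * (2 ^ 0 * \<tau> ^ (2 * 0 + 1) * fact 0 * sqrt (2 / pi)) = 1 / (pi * (1 + x\<^sup>2))"
  proof -
    have "sqrt (2 * pi * \<tau>\<^sup>2) * sqrt (2 / pi) = sqrt ((2 * pi * \<tau>\<^sup>2) * (2 / pi))"
      by (rule real_sqrt_mult[symmetric])
    also have "(2 * pi * \<tau>\<^sup>2) * (2 / pi) = (2 * \<tau>)\<^sup>2" by (simp add: power2_eq_square)
    also have "sqrt ((2 * \<tau>)\<^sup>2) = 2 * \<tau>" using \<tau>(1) by (subst real_sqrt_abs) simp
    finally have sq: "sqrt (2 * pi * \<tau>\<^sup>2) * sqrt (2 / pi) = 2 * \<tau>" .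
    have "(sqrt (2 * pi * \<tau>\<^sup>2) / (2 * pi * s\<^sup>2)) * (2 ^ 0 * \<tau> ^ (2 * 0 + 1) * fact 0 * sqrt (2 / pi))
        = (sqrt (2 * pi * \<tau>\<^sup>2) * sqrt (2 / pi)) * \<tau> / (2 * pi * s\<^sup>2)"
      by simp
    also have "\<dots> = 2 * \<tau>\<^sup>2 / (2 * pi * s\<^sup>2)" unfolding sq by (simp add: power2_eq_square)
    also have "\<dots> = 1 / (pi * (1 + x\<^sup>2))" unfolding \<tau>(2)
    proof -
      have "2 * (a / b) / (2 * pi * a) = 1 / (pi * b)" if "a > 0" "b > 0" for a b :: real
        using that by (simp add: field_simps)
      then show "2 * (s\<^sup>2 / (1 + x\<^sup>2)) / (2 * pi * s\<^sup>2) = 1 / (pi * (1 + x\<^sup>2))"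
        using assms x2 by simp
    qed
    finally show ?thesis .
  qed
  ultimately show ?thesis
    by (subst nn_integral_eq_integral) (auto simp: has_bochner_integral_iff)
qed

text \<open>Substituting $v = xw$ for fixed $w \neq 0$ produces the Jacobian $|w|$; integrating over \<open>w\<close> first leaves
  the Cauchy density.\<close>

lemma ratio_of_independent_normals:
  assumes v: "v > 0"
  shows "distr (normal_law 0 v \<Otimes>\<^sub>M normal_law 0 v) borel (\<lambda>z. snd z / fst z) = std_cauchy_law"
proof (rule measure_eqI)
  fix A assume "A \<in> sets (distr (normal_law 0 v \<Otimes>\<^sub>M normal_law 0 v) borel (\<lambda>z. snd z / fst z))"
  then have [measurable]: "A \<in> sets borel" by simp
  define s where "s = sqrt v"
  have s: "s > 0" using v by (simp add: s_def)
  interpret N: real_distribution "normal_law 0 v" by (rule real_distribution_normal_law[OF v])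
  interpret Z: pair_prob_space "normal_law 0 v" "normal_law 0 v" ..
  have [measurable_cong]: "sets (normal_law 0 v) = sets borel" by simp
  have "emeasure (distr (normal_law 0 v \<Otimes>\<^sub>M normal_law 0 v) borel (\<lambda>z. snd z / fst z)) A
     = (\<integral>\<^sup>+z. indicator A (snd z / fst z) \<partial>(normal_law 0 v \<Otimes>\<^sub>M normal_law 0 v))"
    by (subst nn_integral_indicator[symmetric], simp) (subst nn_integral_distr; simp)
  also have "\<dots> = (\<integral>\<^sup>+w. \<integral>\<^sup>+x. indicator A (x / w) \<partial>normal_law 0 v \<partial>normal_law 0 v)"
    by (subst N.nn_integral_fst[symmetric]) simp_all
  also have "\<dots> = (\<integral>\<^sup>+w. (\<integral>\<^sup>+x. ennreal (normal_density 0 s x) * indicator A (x / w) \<partial>lborel) \<partial>normal_law 0 v)"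
    by (rule nn_integral_cong) (simp add: normal_law_def s_def nn_integral_density)
  also have "\<dots> = (\<integral>\<^sup>+w. ennreal (normal_density 0 s w) * (\<integral>\<^sup>+x. ennreal (normal_density 0 s x) * indicator A (x / w) \<partial>lborel) \<partial>lborel)"
    unfolding normal_law_def s_def[symmetric] by (rule nn_integral_density) simp_all
  also have "\<dots> = (\<integral>\<^sup>+w. \<integral>\<^sup>+x. ennreal (\<bar>w\<bar> * (normal_density 0 s w * normal_density 0 s (x * w))) * indicator A x \<partial>lborel \<partial>lborel)"
  proof (rule nn_integral_cong_AE)
    have "ennreal (normal_density 0 s w) * (\<integral>\<^sup>+x. ennreal (normal_density 0 s x) * indicator A (x / w) \<partial>lborel)
       = (\<integral>\<^sup>+x. ennreal (\<bar>w\<bar> * (normal_density 0 s w * normal_density 0 s (x * w))) * indicator A x \<partial>lborel)" if "w \<noteq> 0" for w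
    proof -
      have "(\<integral>\<^sup>+x. ennreal (normal_density 0 s x) * indicator A (x / w) \<partial>lborel)
        = \<bar>w\<bar> * (\<integral>\<^sup>+x. ennreal (normal_density 0 s (0 + w * x)) * indicator A ((0 + w * x) / w) \<partial>lborel)"
        by (rule nn_integral_real_affine) (use that in auto)
      also have "\<dots> = \<bar>w\<bar> * (\<integral>\<^sup>+x. ennreal (normal_density 0 s (x * w)) * indicator A x \<partial>lborel)"
        using that by (simp add: mult.commute)
      finally show ?thesis
        by (simp add: nn_integral_cmult[symmetric] ennreal_mult mult_ac)
    qed
    then show "AE w in lborel. ennreal (normal_density 0 s w) * (\<integral>\<^sup>+x. ennreal (normal_density 0 s x) * indicator A (x / w) \<partial>lborel)
       = (\<integral>\<^sup>+x. ennreal (\<bar>w\<bar> * (normal_density 0 s w * normal_density 0 s (x * w))) * indicator A x \<partial>lborel)"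
      using AE_lborel_singleton[of "0::real"] by auto
  qed
  also have "\<dots> = (\<integral>\<^sup>+x. \<integral>\<^sup>+w. ennreal (\<bar>w\<bar> * (normal_density 0 s w * normal_density 0 s (x * w))) * indicator A x \<partial>lborel \<partial>lborel)"
    by (rule lborel_pair.Fubini') simp
  also have "\<dots> = (\<integral>\<^sup>+x. ennreal (1 / (pi * (1 + x\<^sup>2))) * indicator A x \<partial>lborel)"
    by (simp add: nn_integral_multc nn_integral_abs_normal_product[OF s])
  also have "\<dots> = emeasure std_cauchy_law A"
    unfolding std_cauchy_law_def by (subst emeasure_density) auto
  finally show "emeasure (distr (normal_law 0 v \<Otimes>\<^sub>M normal_law 0 v) borel (\<lambda>z. snd z / fst z)) A = emeasure std_cauchy_law A" .
qed (simp add: std_cauchy_law_def)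

text \<open>The quotient is not a continuous function of the pair, but it is one where the denominator exceeds a threshold
  \<open>\<theta>\<close>. A continuous cutoff in the denominator costs at most the probability that the limit $w^2/(2c)$ is small, and
  this tends to 0 with \<open>\<theta>\<close> as $w \neq 0$ almost surely.\<close>

lemma weak_conv_m_ratio_cauchy:
  fixes A B R :: "nat \<Rightarrow> 'a \<Rightarrow> real"
  assumes P: "prob_space M" and c: "c > 0"
    and A[measurable]: "\<And>n. A n \<in> borel_measurable M" and B[measurable]: "\<And>n. B n \<in> borel_measurable M"
    and R[measurable]: "\<And>n. R n \<in> borel_measurable M"
    and w: "weak_conv_top (\<lambda>n. distr M borel (\<lambda>\<omega>. (A n \<omega>, B n \<omega>))) (limit_law c)"
    and eq: "eventually (\<lambda>n. \<forall>\<omega>\<in>space M. B n \<omega> \<noteq> 0 \<longrightarrow> R n \<omega> = A n \<omega> / (2 * c * B n \<omega>)) sequentially"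
  shows "weak_conv_m (\<lambda>n. distr M borel (R n)) std_cauchy_law"
proof -
  interpret prob_space M by fact
  define v where "v = 1 / (2 * c)"
  have v: "v > 0" using c by (simp add: v_def)
  interpret N: real_distribution "normal_law 0 v" by (rule real_distribution_normal_law[OF v])
  interpret Z: pair_prob_space "normal_law 0 v" "normal_law 0 v" ..
  have [measurable_cong]: "sets (normal_law 0 v) = sets borel" by simp
  let ?Z = "normal_law 0 v \<Otimes>\<^sub>M normal_law 0 v"
  have Cd: "real_distribution std_cauchy_law"
    unfolding ratio_of_independent_normals[OF v, symmetric] by (rule Z.real_distribution_distr) simp
  have w_nz: "AE w in normal_law 0 v. w \<noteq> 0"
    unfolding normal_law_def using AE_lborel_singleton[of "0::real"] by (subst AE_density) auto
  have Z_nz: "AE z in ?Z. fst z \<noteq> 0"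
  proof (rule Z.AE_pair_measure)
    have "open {z :: real \<times> real. fst z \<noteq> 0}" by (intro open_Collect_neq continuous_intros)
    then have "{z :: real \<times> real. fst z \<noteq> 0} \<in> sets (borel \<Otimes>\<^sub>M borel)" unfolding borel_prod by simp
    moreover have "sets ?Z = sets (borel \<Otimes>\<^sub>M borel)" by (intro sets_pair_measure_cong) simp_all
    moreover have "space ?Z = UNIV" by (simp add: space_pair_measure)
    ultimately show "{z \<in> space ?Z. fst z \<noteq> 0} \<in> sets ?Z" by simp
  qed (use w_nz in auto)
  \<comment> \<open>vanishes for $b \le \theta/2$ and equals 1 for $b \ge \theta$\<close>
  define cut where "cut \<theta> b = max 0 (min 1 (2 * b / \<theta> - 1))" for \<theta> b :: real
  have cut_small: "\<exists>\<theta>>0. (\<integral>z. 1 - cut \<theta> (v * (fst z)\<^sup>2) \<partial>?Z) < e" if e: "e > 0" for e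
  proof -
    have "(\<lambda>m. \<integral>z. 1 - cut (1 / real (Suc m)) (v * (fst z)\<^sup>2) \<partial>?Z) \<longlonglongrightarrow> (\<integral>z. 0 \<partial>?Z)"
    proof (rule integral_dominated_convergence[where w="\<lambda>_. 1"])
      have "(\<lambda>m. 1 - cut (1 / real (Suc m)) (v * w\<^sup>2)) \<longlonglongrightarrow> 0" if "w \<noteq> 0" for w
      proof (rule tendsto_eventually)
        have pos: "v * w\<^sup>2 > 0" using that v by simp
        show "eventually (\<lambda>m. 1 - cut (1 / real (Suc m)) (v * w\<^sup>2) = 0) sequentially"
          using eventually_ge_at_top[of "nat \<lceil>1 / (v * w\<^sup>2)\<rceil>"]
        proof (eventually_elim)
          case (elim m)
          then have "1 / (v * w\<^sup>2) \<le> real (Suc m)" by linarith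
          then have "1 \<le> real (Suc m) * (v * w\<^sup>2)" using pos by (simp add: field_simps)
          then show ?case by (simp add: cut_def max_def min_def algebra_simps)
        qed
      qed
      then show "AE z in ?Z. (\<lambda>m. 1 - cut (1 / real (Suc m)) (v * (fst z)\<^sup>2)) \<longlonglongrightarrow> 0"
        using Z_nz by auto
    qed (auto simp: cut_def)
    then have "eventually (\<lambda>m. (\<integral>z. 1 - cut (1 / real (Suc m)) (v * (fst z)\<^sup>2) \<partial>?Z) < e) sequentially"
      using e by (simp add: order_tendsto_iff)
    then obtain m where m: "(\<integral>z. 1 - cut (1 / real (Suc m)) (v * (fst z)\<^sup>2) \<partial>?Z) < e"
      unfolding eventually_sequentially by blast
    show ?thesis by (rule exI[of _ "1 / real (Suc m)"], rule conjI, simp, rule m)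
  qed
  have Dn: "real_distribution (distr M borel (R n))" for n by (rule real_distribution_distr) simp
  show ?thesis
  proof (rule integral_bdd_continuous_conv_imp_weak_conv[OF Dn Cd])
    fix f :: "real \<Rightarrow> real" assume f: "\<And>x. isCont f x" "\<And>x. \<bar>f x\<bar> \<le> 1"
    have fc: "continuous_on UNIV f" using f(1) by (simp add: continuous_on_eq_continuous_at)
    have [measurable]: "f \<in> borel_measurable borel" using fc by (rule borel_measurable_continuous_onI)
    have limE: "(\<integral>x. f x \<partial>std_cauchy_law) = (\<integral>z. f (snd z / fst z) \<partial>?Z)"
      unfolding ratio_of_independent_normals[OF v, symmetric] by (subst integral_distr) auto
    have "(\<lambda>n. \<integral>\<omega>. f (R n \<omega>) \<partial>M) \<longlonglongrightarrow> (\<integral>z. f (snd z / fst z) \<partial>?Z)"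
    proof (rule LIMSEQ_I)
      fix e' :: real assume "e' > 0"
      define e where "e = e' / 3"
      have e: "e > 0" using \<open>e' > 0\<close> by (simp add: e_def)
      obtain \<theta> where \<theta>: "\<theta> > 0" "(\<integral>z. 1 - cut \<theta> (v * (fst z)\<^sup>2) \<partial>?Z) < e" using cut_small[OF e] by blast
      have cut01: "0 \<le> cut \<theta> b" "cut \<theta> b \<le> 1" for b by (auto simp: cut_def)
      have cutc: "continuous_on UNIV (cut \<theta>)" unfolding cut_def using \<theta>(1) by (intro continuous_intros) auto
      define g where "g z = f (fst z / (2 * c * max (snd z) (\<theta> / 2))) * cut \<theta> (snd z)" for z
      have gc: "continuous_on UNIV g"
        unfolding g_def using \<theta>(1) c
        by (intro continuous_intros continuous_on_compose2[OF fc] continuous_on_compose2[OF cutc]) auto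
      have g1: "\<bar>g z\<bar> \<le> 1" for z
        unfolding g_def abs_mult using f(2) cut01 by (intro mult_le_one) (auto simp: abs_of_nonneg)
      have [measurable]: "g \<in> borel_measurable borel" "cut \<theta> \<in> borel_measurable borel"
        using gc cutc by (auto intro: borel_measurable_continuous_onI)
      have key: "\<bar>f r - g (a, b)\<bar> \<le> 1 - cut \<theta> b" if "b \<noteq> 0 \<longrightarrow> r = a / (2 * c * b)" for r a b
      proof (cases "b \<le> \<theta> / 2")
        case True
        then have "cut \<theta> b = 0" using \<theta>(1) by (simp add: cut_def field_simps)
        then show ?thesis using f(2)[of r] by (simp add: g_def)
      next
        case False
        then have "b \<noteq> 0" "max b (\<theta> / 2) = b" using \<theta>(1) by auto
        then have "f r - g (a, b) = f r * (1 - cut \<theta> b)" using that by (simp add: g_def algebra_simps)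
        then have "\<bar>f r - g (a, b)\<bar> = \<bar>f r\<bar> * (1 - cut \<theta> b)" using cut01(2)[of b] by (simp add: abs_mult)
        also have "\<dots> \<le> 1 * (1 - cut \<theta> b)" using f(2) cut01(2)[of b] by (intro mult_right_mono) auto
        finally show ?thesis by simp
      qed
      have diff: "\<bar>(\<integral>\<omega>. f (r \<omega>) \<partial>Q) - (\<integral>\<omega>. g (a \<omega>, b \<omega>) \<partial>Q)\<bar> \<le> (\<integral>\<omega>. 1 - cut \<theta> (b \<omega>) \<partial>Q)"
        if Q: "prob_space Q" and [measurable]: "r \<in> borel_measurable Q" "a \<in> borel_measurable Q" "b \<in> borel_measurable Q"
          and ae: "AE \<omega> in Q. b \<omega> \<noteq> 0 \<longrightarrow> r \<omega> = a \<omega> / (2 * c * b \<omega>)" for Q :: "'c measure" and r a b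
      proof -
        interpret Q: prob_space Q by fact
        have i: "integrable Q (\<lambda>\<omega>. f (r \<omega>))" "integrable Q (\<lambda>\<omega>. g (a \<omega>, b \<omega>))" "integrable Q (\<lambda>\<omega>. 1 - cut \<theta> (b \<omega>))"
          by (rule Q.integrable_const_bound[of _ 1]; use f(2) g1 cut01 in simp)+
        have "\<bar>(\<integral>\<omega>. f (r \<omega>) \<partial>Q) - (\<integral>\<omega>. g (a \<omega>, b \<omega>) \<partial>Q)\<bar> = \<bar>\<integral>\<omega>. f (r \<omega>) - g (a \<omega>, b \<omega>) \<partial>Q\<bar>"
          using i by simp
        also have "\<dots> \<le> (\<integral>\<omega>. \<bar>f (r \<omega>) - g (a \<omega>, b \<omega>)\<bar> \<partial>Q)" by (rule integral_abs_bound)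
        also have "\<dots> \<le> (\<integral>\<omega>. 1 - cut \<theta> (b \<omega>) \<partial>Q)"
          using i ae by (intro integral_mono_AE) (auto elim!: eventually_mono intro: key)
        finally show ?thesis .
      qed
      have wc: "(\<lambda>n. \<integral>z. h z \<partial>distr M borel (\<lambda>\<omega>. (A n \<omega>, B n \<omega>))) \<longlonglongrightarrow> (\<integral>z. h z \<partial>limit_law c)"
        if "continuous_on UNIV h" "\<And>z. \<bar>h z\<bar> \<le> 1" for h :: "real \<times> real \<Rightarrow> real"
      proof -
        have "bounded (range h)" using that(2) by (auto simp: bounded_iff)
        then show ?thesis using w that(1) unfolding weak_conv_top_def by blast
      qed
      have lim_int: "(\<integral>z. h z \<partial>limit_law c) = (\<integral>z. h (fst z * snd z, v * (fst z)\<^sup>2) \<partial>?Z)"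
        if "continuous_on UNIV h" for h :: "real \<times> real \<Rightarrow> real"
      proof -
        have [measurable]: "h \<in> borel_measurable borel" using that by (rule borel_measurable_continuous_onI)
        have "limit_law c = distr ?Z borel (\<lambda>z. (fst z * snd z, v * (fst z)\<^sup>2))"
          unfolding limit_law_def v_def by (simp add: case_prod_beta')
        then show ?thesis by (simp add: integral_distr)
      qed
      have l1: "(\<lambda>n. \<integral>\<omega>. g (A n \<omega>, B n \<omega>) \<partial>M) \<longlonglongrightarrow> (\<integral>z. g (fst z * snd z, v * (fst z)\<^sup>2) \<partial>?Z)"
        using wc[OF gc g1] unfolding lim_int[OF gc] by (simp add: integral_distr)
      have cc: "continuous_on UNIV (\<lambda>z::real \<times> real. 1 - cut \<theta> (snd z))"
        by (intro continuous_intros continuous_on_compose2[OF cutc]) auto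
      have l2: "(\<lambda>n. \<integral>\<omega>. 1 - cut \<theta> (B n \<omega>) \<partial>M) \<longlonglongrightarrow> (\<integral>z. 1 - cut \<theta> (v * (fst z)\<^sup>2) \<partial>?Z)"
      proof -
        have "(\<lambda>n. \<integral>z. 1 - cut \<theta> (snd z) \<partial>distr M borel (\<lambda>\<omega>. (A n \<omega>, B n \<omega>)))
            \<longlonglongrightarrow> (\<integral>z. 1 - cut \<theta> (v * (fst z)\<^sup>2) \<partial>?Z)"
          using wc[OF cc] cut01 unfolding lim_int[OF cc] by simp
        then show ?thesis
          by (simp add: integral_distr[OF _ borel_measurable_continuous_onI[OF cc]])
      qed
      have zd: "\<bar>(\<integral>z. f (snd z / fst z) \<partial>?Z) - (\<integral>z. g (fst z * snd z, v * (fst z)\<^sup>2) \<partial>?Z)\<bar> < e"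
      proof (rule le_less_trans[OF diff[OF Z.prob_space_axioms] \<theta>(2)])
        show "AE z in ?Z. v * (fst z)\<^sup>2 \<noteq> 0 \<longrightarrow> snd z / fst z = fst z * snd z / (2 * c * (v * (fst z)\<^sup>2))"
          using c by (auto simp: v_def power2_eq_square)
      qed auto
      have "eventually (\<lambda>n. \<bar>(\<integral>\<omega>. f (R n \<omega>) \<partial>M) - (\<integral>z. f (snd z / fst z) \<partial>?Z)\<bar> < e') sequentially"
        using eq order_tendstoD(2)[OF l2 \<theta>(2)] tendstoD[OF l1 e]
      proof eventually_elim
        case (elim n)
        have "\<bar>(\<integral>\<omega>. f (R n \<omega>) \<partial>M) - (\<integral>\<omega>. g (A n \<omega>, B n \<omega>) \<partial>M)\<bar> < e"
          by (rule le_less_trans[OF diff[OF P] elim(2)]) (use elim(1) in auto)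
        then show ?case using zd elim(3) unfolding dist_real_def e_def by linarith
      qed
      then show "\<exists>N. \<forall>n\<ge>N. norm ((\<integral>\<omega>. f (R n \<omega>) \<partial>M) - (\<integral>z. f (snd z / fst z) \<partial>?Z)) < e'"
        unfolding eventually_sequentially by simp
    qed
    then show "(\<lambda>n. \<integral>x. f x \<partial>distr M borel (R n)) \<longlonglongrightarrow> (\<integral>x. f x \<partial>std_cauchy_law)"
      unfolding limE by (simp add: integral_distr)
  qed
qed

section \<open>Noise, volatility and their moments\<close>

text \<open>The solution of the log-volatility recursion started at 0, as a function of the path of shocks. Working with paths
  allows Fubini's theorem to be applied to the joint law of the two noise sequences.\<close>

definition logvol :: "real \<Rightarrow> (nat \<Rightarrow> real) \<Rightarrow> nat \<Rightarrow> real" where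
  "logvol \<phi> h t = (\<Sum>s=1..t. \<phi> ^ (t - s) * h s)"

definition vol :: "real \<Rightarrow> (nat \<Rightarrow> real) \<Rightarrow> nat \<Rightarrow> real" where
  "vol \<phi> h t = exp (logvol \<phi> h t / 2)"

lemma measurable_vol_path [measurable]: "(\<lambda>h. vol \<phi> h t) \<in> borel_measurable (PiM {1..} (\<lambda>_. borel))"
  unfolding vol_def logvol_def
  by (intro borel_measurable_exp[THEN measurable_compose_rev] borel_measurable_divide borel_measurable_sum
       borel_measurable_times borel_measurable_const measurable_component_singleton) auto

lemma vol_cong: "(\<And>s. 1 \<le> s \<Longrightarrow> h s = h' s) \<Longrightarrow> vol \<phi> h t = vol \<phi> h' t"
  unfolding vol_def logvol_def by (intro arg_cong[of _ _ exp] arg_cong2[of _ _ _ _ "(/)"] sum.cong) auto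

lemma vol_pos [simp]: "0 < vol \<phi> h t" "0 \<le> vol \<phi> h t"
  by (simp_all add: vol_def)

lemma expectation_square_orthogonal:
  fixes X :: "'i \<Rightarrow> 'a \<Rightarrow> real"
  assumes "finite I"
    and i: "\<And>i j. i \<in> I \<Longrightarrow> j \<in> I \<Longrightarrow> integrable M (\<lambda>\<omega>. X i \<omega> * X j \<omega>)"
    and o: "\<And>i j. i \<in> I \<Longrightarrow> j \<in> I \<Longrightarrow> i \<noteq> j \<Longrightarrow> (\<integral>\<omega>. X i \<omega> * X j \<omega> \<partial>M) = 0"
  shows "integrable M (\<lambda>\<omega>. (\<Sum>i\<in>I. X i \<omega>)\<^sup>2)"
    and "(\<integral>\<omega>. (\<Sum>i\<in>I. X i \<omega>)\<^sup>2 \<partial>M) = (\<Sum>i\<in>I. \<integral>\<omega>. (X i \<omega>)\<^sup>2 \<partial>M)"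
proof -
  have e: "(\<Sum>i\<in>I. X i \<omega>)\<^sup>2 = (\<Sum>i\<in>I. \<Sum>j\<in>I. X i \<omega> * X j \<omega>)" for \<omega>
    by (simp add: power2_eq_square sum_product)
  show "integrable M (\<lambda>\<omega>. (\<Sum>i\<in>I. X i \<omega>)\<^sup>2)" unfolding e by (intro Bochner_Integration.integrable_sum i)
  have "(\<integral>\<omega>. (\<Sum>i\<in>I. X i \<omega>)\<^sup>2 \<partial>M) = (\<Sum>i\<in>I. \<Sum>j\<in>I. \<integral>\<omega>. X i \<omega> * X j \<omega> \<partial>M)"
    unfolding e using i by (simp add: Bochner_Integration.integral_sum Bochner_Integration.integrable_sum)
  also have "\<dots> = (\<Sum>i\<in>I. \<integral>\<omega>. X i \<omega> * X i \<omega> \<partial>M)"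
  proof (rule sum.cong[OF refl])
    fix i assume "i \<in> I"
    then have "(\<Sum>j\<in>I. \<integral>\<omega>. X i \<omega> * X j \<omega> \<partial>M) = (\<Sum>j\<in>I. if j = i then (\<integral>\<omega>. X i \<omega> * X i \<omega> \<partial>M) else 0)"
      using o by (intro sum.cong) auto
    then show "(\<Sum>j\<in>I. \<integral>\<omega>. X i \<omega> * X j \<omega> \<partial>M) = (\<integral>\<omega>. X i \<omega> * X i \<omega> \<partial>M)"
      using \<open>finite I\<close> \<open>i \<in> I\<close> by simp
  qed
  finally show "(\<integral>\<omega>. (\<Sum>i\<in>I. X i \<omega>)\<^sup>2 \<partial>M) = (\<Sum>i\<in>I. \<integral>\<omega>. (X i \<omega>)\<^sup>2 \<partial>M)"
    by (simp add: power2_eq_square)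
qed

locale sv_noise = prob_space M for M :: "'a measure" +
  fixes \<alpha> :: real and \<epsilon> \<eta> :: "nat \<Rightarrow> 'a \<Rightarrow> real"
  assumes \<alpha>_pos: "\<alpha> > 0"
    and \<epsilon>_indep: "indep_vars (\<lambda>_. borel) \<epsilon> {1..}"
    and \<epsilon>_ident: "\<And>t. t \<ge> 1 \<Longrightarrow> distr M borel (\<epsilon> t) = distr M borel (\<epsilon> 1)"
    and \<epsilon>_mean: "\<And>t. t \<ge> 1 \<Longrightarrow> (\<integral>\<omega>. \<epsilon> t \<omega> \<partial>M) = 0"
    and \<epsilon>_var: "\<And>t. t \<ge> 1 \<Longrightarrow> (\<integral>\<omega>. (\<epsilon> t \<omega>)\<^sup>2 \<partial>M) = 1"
    and \<epsilon>_fourth: "\<And>t. t \<ge> 1 \<Longrightarrow> integrable M (\<lambda>\<omega>. (\<epsilon> t \<omega>) ^ 4)"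
    and \<eta>_indep: "indep_vars (\<lambda>_. borel) \<eta> {1..}"
    and \<eta>_normal: "\<And>t. t \<ge> 1 \<Longrightarrow> distr M borel (\<eta> t) = normal_law 0 (\<alpha>\<^sup>2)"
    and \<epsilon>_\<eta>_indep: "indep_var
           (PiM {1..} (\<lambda>_. borel)) (\<lambda>\<omega>. \<lambda>t\<in>{1..}. \<epsilon> t \<omega>)
           (PiM {1..} (\<lambda>_. borel)) (\<lambda>\<omega>. \<lambda>t\<in>{1..}. \<eta> t \<omega>)"
begin

lemma measurable_\<epsilon>: "t \<ge> 1 \<Longrightarrow> \<epsilon> t \<in> borel_measurable M"
  using \<epsilon>_indep unfolding indep_vars_def by auto

lemma measurable_\<eta>: "t \<ge> 1 \<Longrightarrow> \<eta> t \<in> borel_measurable M"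
  using \<eta>_indep unfolding indep_vars_def by auto

definition sig :: "real \<Rightarrow> nat \<Rightarrow> 'a \<Rightarrow> real" where
  "sig \<phi> t \<omega> = vol \<phi> (\<lambda>s. \<eta> s \<omega>) t"

lemma sig_path: "sig \<phi> t \<omega> = vol \<phi> (\<lambda>t\<in>{1..}. \<eta> t \<omega>) t"
  unfolding sig_def by (rule vol_cong) simp

lemma sig_pos [simp]: "0 < sig \<phi> t \<omega>" "0 \<le> sig \<phi> t \<omega>"
  by (simp_all add: sig_def)

lemma measurable_sig [measurable]: "sig \<phi> t \<in> borel_measurable M"
proof -
  have "(\<lambda>\<omega>. \<lambda>t\<in>{1..}. \<eta> t \<omega>) \<in> M \<rightarrow>\<^sub>M PiM {1..} (\<lambda>_. borel)"
    using \<epsilon>_\<eta>_indep by (rule indep_var_rv2)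
  from measurable_compose[OF this measurable_vol_path[of \<phi> t]] show ?thesis
    unfolding sig_path[abs_def] .
qed

lemma integrable_\<epsilon>_power:
  assumes "t \<ge> 1" "m \<le> 4"
  shows "integrable M (\<lambda>\<omega>. \<epsilon> t \<omega> ^ m)"
proof (rule Bochner_Integration.integrable_bound)
  show "integrable M (\<lambda>\<omega>. 1 + \<epsilon> t \<omega> ^ 4)" using \<epsilon>_fourth[OF assms(1)] by simp
  have "\<bar>x\<bar> ^ m \<le> 1 + x ^ 4" for x :: real
  proof (cases "\<bar>x\<bar> \<le> 1")
    case True
    then have "\<bar>x\<bar> ^ m \<le> 1" by (simp add: power_le_one)
    moreover have "0 \<le> x ^ 4" by simp
    ultimately show ?thesis by linarith
  next
    case False
    then have "\<bar>x\<bar> ^ m \<le> \<bar>x\<bar> ^ 4" using assms(2) by (intro power_increasing) auto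
    then show ?thesis by (simp add: power_even_abs)
  qed
  then show "AE \<omega> in M. norm (\<epsilon> t \<omega> ^ m) \<le> norm (1 + \<epsilon> t \<omega> ^ 4)"
    by (auto simp: power_abs)
qed (use measurable_\<epsilon>[OF assms(1)] in measurable)

lemma expectation_\<epsilon>_powers:
  assumes "finite I" "I \<subseteq> {1..}" "\<And>l. l \<in> I \<Longrightarrow> m l \<le> 4"
  shows "integrable M (\<lambda>\<omega>. \<Prod>l\<in>I. \<epsilon> l \<omega> ^ m l)" (is ?i)
    and "(\<integral>\<omega>. (\<Prod>l\<in>I. \<epsilon> l \<omega> ^ m l) \<partial>M) = (\<Prod>l\<in>I. \<integral>\<omega>. \<epsilon> l \<omega> ^ m l \<partial>M)" (is ?e)
proof -
  have "indep_vars (\<lambda>_. borel) (\<lambda>l \<omega>. \<epsilon> l \<omega> ^ m l) I"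
    by (rule indep_vars_compose2[OF indep_vars_subset[OF \<epsilon>_indep assms(2)]]) simp
  then show ?i ?e
    using assms by (auto intro!: indep_vars_integrable indep_vars_lebesgue_integral integrable_\<epsilon>_power)
qed

lemma expectation_\<epsilon>_pair:
  assumes "t \<ge> 1" "s \<ge> 1"
  shows "integrable M (\<lambda>\<omega>. \<epsilon> t \<omega> * \<epsilon> s \<omega>)"
    and "t \<noteq> s \<Longrightarrow> (\<integral>\<omega>. \<epsilon> t \<omega> * \<epsilon> s \<omega> \<partial>M) = 0"
proof -
  show "integrable M (\<lambda>\<omega>. \<epsilon> t \<omega> * \<epsilon> s \<omega>)"
  proof (cases "t = s")
    case True
    then show ?thesis using integrable_\<epsilon>_power[OF assms(1), of 2] by (simp add: power2_eq_square)
  next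
    case False
    then show ?thesis using expectation_\<epsilon>_powers(1)[of "{t, s}" "\<lambda>_. 1"] assms by simp
  qed
  assume "t \<noteq> s"
  then show "(\<integral>\<omega>. \<epsilon> t \<omega> * \<epsilon> s \<omega> \<partial>M) = 0"
    using expectation_\<epsilon>_powers(2)[of "{t, s}" "\<lambda>_. 1"] assms by (simp add: \<epsilon>_mean)
qed

text \<open>If the two pairs differ, some index occurs exactly once among the four, and its mean 0 factors out.\<close>

lemma expectation_\<epsilon>_quadruple:
  assumes "1 \<le> t" "t < j" "1 \<le> s" "s < i"
  shows "integrable M (\<lambda>\<omega>. (\<epsilon> t \<omega> * \<epsilon> j \<omega>) * (\<epsilon> s \<omega> * \<epsilon> i \<omega>))" (is ?int)
    and "(t, j) \<noteq> (s, i) \<Longrightarrow> (\<integral>\<omega>. (\<epsilon> t \<omega> * \<epsilon> j \<omega>) * (\<epsilon> s \<omega> * \<epsilon> i \<omega>) \<partial>M) = 0"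
    and "(\<integral>\<omega>. (\<epsilon> t \<omega> * \<epsilon> j \<omega>)\<^sup>2 \<partial>M) = 1"
proof -
  \<comment> \<open>the multiplicity of \<open>l\<close> among the four indices\<close>
  define m :: "nat \<Rightarrow> nat" where "m l = of_bool (l = t) + of_bool (l = j) + of_bool (l = s) + of_bool (l = i)" for l
  let ?I = "{t, j, s, i}"
  have pick: "(\<Prod>l\<in>?I. x l ^ of_bool (l = a)) = x a" if "a \<in> ?I" for a and x :: "nat \<Rightarrow> real"
  proof -
    have "(\<Prod>l\<in>?I. x l ^ of_bool (l = a)) = (\<Prod>l\<in>?I. if l = a then x a else 1)" by (intro prod.cong) auto
    also have "\<dots> = x a" using that by (subst prod.delta) auto
    finally show ?thesis .
  qed
  have P: "(\<Prod>l\<in>?I. \<epsilon> l \<omega> ^ m l) = (\<epsilon> t \<omega> * \<epsilon> j \<omega>) * (\<epsilon> s \<omega> * \<epsilon> i \<omega>)" for \<omega>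
    unfolding m_def power_add prod.distrib by (subst pick, simp)+ (simp add: mult.assoc)
  have m4: "m l \<le> 4" for l by (simp add: m_def)
  have I1: "?I \<subseteq> {1..}" using assms by auto
  note E = expectation_\<epsilon>_powers[of ?I m, OF _ I1 m4, simplified P]
  show ?int using E(1) by simp
  show "(\<integral>\<omega>. (\<epsilon> t \<omega> * \<epsilon> j \<omega>) * (\<epsilon> s \<omega> * \<epsilon> i \<omega>) \<partial>M) = 0" if ne: "(t, j) \<noteq> (s, i)"
  proof -
    have "\<exists>l\<in>?I. m l = 1"
    proof (cases "j = i")
      case True
      then have "m t = 1" using ne assms by (auto simp: m_def)
      then show ?thesis by blast
    next
      case False
      then have "m (max j i) = 1" using assms by (auto simp: m_def max_def)
      then show ?thesis by (auto simp: max_def split: if_splits)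
    qed
    then obtain l where l: "l \<in> ?I" "m l = 1" by blast
    then have "(\<integral>\<omega>. \<epsilon> l \<omega> ^ m l \<partial>M) = 0" using I1 \<epsilon>_mean[of l] by auto
    then have "(\<Prod>l\<in>?I. \<integral>\<omega>. \<epsilon> l \<omega> ^ m l \<partial>M) = 0" using l(1) by (intro prod_zero) auto
    then show ?thesis using E(2) by simp
  qed
  show "(\<integral>\<omega>. (\<epsilon> t \<omega> * \<epsilon> j \<omega>)\<^sup>2 \<partial>M) = 1"
    using expectation_\<epsilon>_powers(2)[of "{t, j}" "\<lambda>_. 2"] assms by (simp add: power_mult_distrib \<epsilon>_var)
qed

text \<open>Independence of the two noise sequences as a product rule for functionals of the whole paths.\<close>

lemma expectation_product_\<epsilon>_\<eta>:
  fixes p :: "(nat \<Rightarrow> real) \<Rightarrow> real" and q :: "(nat \<Rightarrow> real) \<Rightarrow> real"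
  assumes [measurable]: "p \<in> borel_measurable (PiM {1..} (\<lambda>_. borel))" "q \<in> borel_measurable (PiM {1..} (\<lambda>_. borel))"
    and i: "integrable M (\<lambda>\<omega>. p (\<lambda>t\<in>{1..}. \<epsilon> t \<omega>))" "integrable M (\<lambda>\<omega>. q (\<lambda>t\<in>{1..}. \<eta> t \<omega>))"
  shows "integrable M (\<lambda>\<omega>. p (\<lambda>t\<in>{1..}. \<epsilon> t \<omega>) * q (\<lambda>t\<in>{1..}. \<eta> t \<omega>))"
    and "(\<integral>\<omega>. p (\<lambda>t\<in>{1..}. \<epsilon> t \<omega>) * q (\<lambda>t\<in>{1..}. \<eta> t \<omega>) \<partial>M)
       = (\<integral>\<omega>. p (\<lambda>t\<in>{1..}. \<epsilon> t \<omega>) \<partial>M) * (\<integral>\<omega>. q (\<lambda>t\<in>{1..}. \<eta> t \<omega>) \<partial>M)"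
proof -
  have "indep_var borel (p \<circ> (\<lambda>\<omega>. \<lambda>t\<in>{1..}. \<epsilon> t \<omega>)) borel (q \<circ> (\<lambda>\<omega>. \<lambda>t\<in>{1..}. \<eta> t \<omega>))"
    by (rule indep_var_compose[OF \<epsilon>_\<eta>_indep]) measurable
  then have ind: "indep_var borel (\<lambda>\<omega>. p (\<lambda>t\<in>{1..}. \<epsilon> t \<omega>)) borel (\<lambda>\<omega>. q (\<lambda>t\<in>{1..}. \<eta> t \<omega>))"
    by (simp add: comp_def)
  show "integrable M (\<lambda>\<omega>. p (\<lambda>t\<in>{1..}. \<epsilon> t \<omega>) * q (\<lambda>t\<in>{1..}. \<eta> t \<omega>))"
    by (rule indep_var_integrable[OF ind i])
  show "(\<integral>\<omega>. p (\<lambda>t\<in>{1..}. \<epsilon> t \<omega>) * q (\<lambda>t\<in>{1..}. \<eta> t \<omega>) \<partial>M)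
       = (\<integral>\<omega>. p (\<lambda>t\<in>{1..}. \<epsilon> t \<omega>) \<partial>M) * (\<integral>\<omega>. q (\<lambda>t\<in>{1..}. \<eta> t \<omega>) \<partial>M)"
    by (rule indep_var_lebesgue_integral[OF ind i])
qed

lemma expectation_exp_\<eta>:
  "integrable M (\<lambda>\<omega>. exp (\<Sum>s=1..n. b s * \<eta> s \<omega>))"
  "(\<integral>\<omega>. exp (\<Sum>s=1..n. b s * \<eta> s \<omega>) \<partial>M) = exp (\<alpha>\<^sup>2 / 2 * (\<Sum>s=1..n. (b s)\<^sup>2))"
proof -
  have ind: "indep_vars (\<lambda>_. borel) (\<lambda>s \<omega>. exp (b s * \<eta> s \<omega>)) {1..n}"
    by (rule indep_vars_compose2[OF indep_vars_subset[OF \<eta>_indep]]) auto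
  have one: "integrable M (\<lambda>\<omega>. exp (b s * \<eta> s \<omega>))" "(\<integral>\<omega>. exp (b s * \<eta> s \<omega>) \<partial>M) = exp (\<alpha>\<^sup>2 * (b s)\<^sup>2 / 2)" if "s \<in> {1..n}" for s
  proof -
    have [measurable]: "\<eta> s \<in> borel_measurable M" using that by (intro measurable_\<eta>) auto
    have d: "distr M borel (\<eta> s) = normal_law 0 (\<alpha>\<^sup>2)" using that by (intro \<eta>_normal) auto
    have a: "\<alpha>\<^sup>2 > 0" using \<alpha>_pos by simp
    show "integrable M (\<lambda>\<omega>. exp (b s * \<eta> s \<omega>))"
      using normal_law_mgf(1)[OF a, of "b s"] unfolding d[symmetric] by (subst (asm) integrable_distr_eq) auto
    show "(\<integral>\<omega>. exp (b s * \<eta> s \<omega>) \<partial>M) = exp (\<alpha>\<^sup>2 * (b s)\<^sup>2 / 2)"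
      using normal_law_mgf(2)[OF a, of "b s"] unfolding d[symmetric] by (subst (asm) integral_distr) auto
  qed
  show "integrable M (\<lambda>\<omega>. exp (\<Sum>s=1..n. b s * \<eta> s \<omega>))"
    unfolding exp_sum[OF finite_atLeastAtMost] by (rule indep_vars_integrable[OF _ ind one(1)]) auto
  have "(\<integral>\<omega>. exp (\<Sum>s=1..n. b s * \<eta> s \<omega>) \<partial>M) = (\<Prod>s=1..n. \<integral>\<omega>. exp (b s * \<eta> s \<omega>) \<partial>M)"
    unfolding exp_sum[OF finite_atLeastAtMost] by (rule indep_vars_lebesgue_integral[OF _ ind one(1)]) auto
  also have "\<dots> = exp (\<Sum>s=1..n. \<alpha>\<^sup>2 * (b s)\<^sup>2 / 2)" by (simp add: exp_sum one(2))
  also have "(\<Sum>s=1..n. \<alpha>\<^sup>2 * (b s)\<^sup>2 / 2) = \<alpha>\<^sup>2 / 2 * (\<Sum>s=1..n. (b s)\<^sup>2)"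
    by (simp add: sum_distrib_left)
  finally show "(\<integral>\<omega>. exp (\<Sum>s=1..n. b s * \<eta> s \<omega>) \<partial>M) = exp (\<alpha>\<^sup>2 / 2 * (\<Sum>s=1..n. (b s)\<^sup>2))" .
qed

text \<open>The covariance of the log-volatilities $\log\sigma_t^2$ and $\log\sigma_s^2$.\<close>

definition lcov :: "real \<Rightarrow> nat \<Rightarrow> nat \<Rightarrow> real" where
  "lcov \<phi> t s = \<alpha>\<^sup>2 * \<phi> ^ (max t s - min t s) * (1 - \<phi> ^ (2 * min t s)) / (1 - \<phi>\<^sup>2)"

lemma lcov_eq_sum:
  assumes "\<bar>\<phi>\<bar> < 1" "t \<le> n" "s \<le> n"
  shows "\<alpha>\<^sup>2 * (\<Sum>i=1..n. (if i \<le> t then \<phi> ^ (t - i) else 0) * (if i \<le> s then \<phi> ^ (s - i) else 0)) = lcov \<phi> t s"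
proof -
  define m where "m = min t s"
  have "\<phi>\<^sup>2 \<noteq> 1" using assms(1) by (simp add: abs_square_eq_1)
  have "(\<Sum>i=1..n. (if i \<le> t then \<phi> ^ (t - i) else 0) * (if i \<le> s then \<phi> ^ (s - i) else 0))
     = (\<Sum>i\<in>{1..m}. \<phi> ^ (max t s - m) * \<phi> ^ (2 * (m - i)))"
  proof (rule sum.mono_neutral_cong_right)
    fix i assume "i \<in> {1..m}"
    then have "(t - i) + (s - i) = (max t s - m) + 2 * (m - i)" "i \<le> t" "i \<le> s" unfolding m_def by auto
    then show "(if i \<le> t then \<phi> ^ (t - i) else 0) * (if i \<le> s then \<phi> ^ (s - i) else 0) = \<phi> ^ (max t s - m) * \<phi> ^ (2 * (m - i))"
      by (simp add: power_add[symmetric])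
  qed (use assms in \<open>auto simp: m_def\<close>)
  also have "\<dots> = \<phi> ^ (max t s - m) * (\<Sum>i\<in>{1..m}. (\<phi>\<^sup>2) ^ (m - i))" by (simp add: sum_distrib_left power_mult)
  also have "(\<Sum>i\<in>{1..m}. (\<phi>\<^sup>2) ^ (m - i)) = (\<Sum>i<m. (\<phi>\<^sup>2) ^ i)"
    by (rule sum.reindex_bij_witness[of _ "\<lambda>i. m - i" "\<lambda>i. m - i"]) auto
  also have "\<dots> = (1 - \<phi> ^ (2 * m)) / (1 - \<phi>\<^sup>2)"
    using \<open>\<phi>\<^sup>2 \<noteq> 1\<close> by (simp add: sum_gp_strict power_mult)
  finally show ?thesis unfolding lcov_def m_def by simp
qed

text \<open>The product is the exponential of a centred normal variable, so its mean is the exponential of half the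
  variance.\<close>

lemma expectation_sig_powers:
  assumes "\<bar>\<phi>\<bar> < 1"
  shows "integrable M (\<lambda>\<omega>. sig \<phi> t \<omega> ^ p * sig \<phi> s \<omega> ^ q)"
    and "(\<integral>\<omega>. sig \<phi> t \<omega> ^ p * sig \<phi> s \<omega> ^ q \<partial>M)
      = exp ((real p ^ 2 * lcov \<phi> t t + 2 * real p * real q * lcov \<phi> t s + real q ^ 2 * lcov \<phi> s s) / 8)"
proof -
  define n where "n = max t s"
  define c where "c t i = (if i \<le> t then \<phi> ^ (t - i) else 0)" for t i :: nat
  define b where "b i = (real p / 2) * c t i + (real q / 2) * c s i" for i
  have lv: "logvol \<phi> h r = (\<Sum>i=1..n. c r i * h i)" if "r \<le> n" for r h
    unfolding logvol_def c_def by (rule sum.mono_neutral_cong_left) (use that in auto)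
  have e: "sig \<phi> t \<omega> ^ p * sig \<phi> s \<omega> ^ q = exp (\<Sum>i=1..n. b i * \<eta> i \<omega>)" for \<omega>
  proof -
    have "sig \<phi> t \<omega> ^ p * sig \<phi> s \<omega> ^ q = exp (real p * (logvol \<phi> (\<lambda>i. \<eta> i \<omega>) t / 2) + real q * (logvol \<phi> (\<lambda>i. \<eta> i \<omega>) s / 2))"
      unfolding sig_def vol_def exp_add exp_of_nat_mult ..
    also have "real p * (logvol \<phi> (\<lambda>i. \<eta> i \<omega>) t / 2) + real q * (logvol \<phi> (\<lambda>i. \<eta> i \<omega>) s / 2) = (\<Sum>i=1..n. b i * \<eta> i \<omega>)"
      by (subst (1 2) lv) (auto simp: n_def b_def sum_distrib_left sum_divide_distrib sum.distrib algebra_simps)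
    finally show ?thesis .
  qed
  show "integrable M (\<lambda>\<omega>. sig \<phi> t \<omega> ^ p * sig \<phi> s \<omega> ^ q)" unfolding e by (rule expectation_exp_\<eta>)
  have cc: "\<alpha>\<^sup>2 * (\<Sum>i=1..n. c x i * c y i) = lcov \<phi> x y" if "x \<le> n" "y \<le> n" for x y
    unfolding c_def by (rule lcov_eq_sum[OF assms that])
  have "(\<Sum>i=1..n. (b i)\<^sup>2) = (real p)\<^sup>2 / 4 * (\<Sum>i=1..n. c t i * c t i) + real p * real q / 2 * (\<Sum>i=1..n. c t i * c s i) + (real q)\<^sup>2 / 4 * (\<Sum>i=1..n. c s i * c s i)"
    unfolding b_def by (simp add: sum_distrib_left sum.distrib[symmetric] power2_eq_square algebra_simps)
  then have "\<alpha>\<^sup>2 / 2 * (\<Sum>i=1..n. (b i)\<^sup>2) = (real p)\<^sup>2 / 8 * (\<alpha>\<^sup>2 * (\<Sum>i=1..n. c t i * c t i)) + real p * real q / 4 * (\<alpha>\<^sup>2 * (\<Sum>i=1..n. c t i * c s i)) + (real q)\<^sup>2 / 8 * (\<alpha>\<^sup>2 * (\<Sum>i=1..n. c s i * c s i))"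
    by (simp add: algebra_simps)
  also have "\<dots> = (real p ^ 2 * lcov \<phi> t t + 2 * real p * real q * lcov \<phi> t s + real q ^ 2 * lcov \<phi> s s) / 8"
    by (subst (1 2 3) cc) (auto simp: n_def algebra_simps)
  finally show "(\<integral>\<omega>. sig \<phi> t \<omega> ^ p * sig \<phi> s \<omega> ^ q \<partial>M)
      = exp ((real p ^ 2 * lcov \<phi> t t + 2 * real p * real q * lcov \<phi> t s + real q ^ 2 * lcov \<phi> s s) / 8)"
    unfolding e expectation_exp_\<eta>(2) by simp
qed

end

section \<open>Conditional central limit estimate\<close>

lemma sum_distinct_powers_le:
  fixes x :: real
  assumes "0 \<le> x" "x < 1" "finite S" "inj_on g S"
  shows "(\<Sum>s\<in>S. x ^ g s) \<le> 1 / (1 - x)"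
proof -
  have "(\<Sum>s\<in>S. x ^ g s) = (\<Sum>i\<in>g ` S. x ^ i)" using assms(4) by (simp add: sum.reindex)
  also have "\<dots> \<le> (\<Sum>i. x ^ i)" using assms by (intro sum_le_suminf summable_geometric) auto
  also have "\<dots> = 1 / (1 - x)" using assms by (intro suminf_geometric) auto
  finally show ?thesis .
qed

lemma abs_exp_minus_one_le: "\<bar>exp z - 1\<bar> \<le> \<bar>z\<bar> * exp \<bar>z\<bar>" for z :: real
proof (cases "z \<ge> 0")
  case True
  have "1 - z \<le> exp (- z)" using exp_ge_add_one_self[of "-z"] by simp
  then have "(1 - z) * exp z \<le> exp (- z) * exp z" by (intro mult_right_mono) auto
  then have "exp z - 1 \<le> z * exp z" by (simp add: exp_minus algebra_simps)
  then show ?thesis using True by simp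
next
  case False
  then have "exp z \<le> 1" by simp
  then have "\<bar>exp z - 1\<bar> \<le> \<bar>z\<bar> * 1" using exp_ge_add_one_self[of z] by linarith
  also have "\<dots> \<le> \<bar>z\<bar> * exp \<bar>z\<bar>" by (intro mult_left_mono) auto
  finally show ?thesis .
qed

lemma exp_minus_half_square_approx: "\<bar>exp (- (x\<^sup>2) / 2) - (1 - x\<^sup>2 / 2)\<bar> \<le> \<bar>x\<bar> ^ 3" for x :: real
proof -
  define y where "y = x\<^sup>2 / 2"
  have y: "y \<ge> 0" by (simp add: y_def)
  have l: "1 - y \<le> exp (- y)" using exp_ge_add_one_self[of "-y"] by simp
  have "exp (- y) - (1 - y) \<le> \<bar>x\<bar> ^ 3"
  proof (cases "\<bar>x\<bar> \<le> 1")
    case True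
    have "exp (- y) \<le> 1 / (1 + y)" using exp_ge_add_one_self[of y] y by (simp add: exp_minus field_simps)
    then have "exp (- y) - (1 - y) \<le> y\<^sup>2 / (1 + y)" using y by (simp add: field_simps power2_eq_square)
    also have "\<dots> \<le> y\<^sup>2" using y by (simp add: divide_le_eq mult_le_cancel_left1)
    also have "\<dots> \<le> \<bar>x\<bar> ^ 4" by (simp add: y_def power_divide power_even_abs flip: power_mult)
    also have "\<dots> \<le> \<bar>x\<bar> ^ 3" using True by (intro power_decreasing) auto
    finally show ?thesis .
  next
    case False
    have "exp (- y) \<le> 1" using y by simp
    then have "exp (- y) - (1 - y) \<le> y" by simp
    also have "\<dots> \<le> \<bar>x\<bar> ^ 2" by (simp add: y_def)
    also have "\<dots> \<le> \<bar>x\<bar> ^ 3" using False by (intro power_increasing) auto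
    finally show ?thesis .
  qed
  then show ?thesis using l by (simp add: y_def)
qed

lemma abs_exp_neg_diff_le:
  fixes a b :: real
  assumes "0 \<le> a" "0 \<le> b"
  shows "\<bar>exp (- a) - exp (- b)\<bar> \<le> \<bar>a - b\<bar>"
proof -
  have *: "exp (- c) - exp (- d) \<le> d - c" if "0 \<le> c" "c \<le> d" for c d :: real
  proof -
    have "exp (- c) - exp (- d) = exp (- c) * (1 - exp (- (d - c)))" by (simp add: algebra_simps flip: exp_add)
    also have "\<dots> \<le> 1 * (d - c)"
    proof (rule mult_mono)
      show "1 - exp (- (d - c)) \<le> d - c" using exp_ge_add_one_self[of "-(d - c)"] by linarith
    qed (use that in auto)
    finally show ?thesis by simp
  qed
  show ?thesis
  proof (cases "a \<le> b")
    case True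
    then show ?thesis using *[of a b] assms by simp
  next
    case False
    then show ?thesis using *[of b a] assms by simp
  qed
qed

lemma (in prob_space) expectation_abs_le_sqrt:
  assumes [measurable]: "Y \<in> borel_measurable M" and i: "integrable M (\<lambda>\<omega>. (Y \<omega>)\<^sup>2)"
  shows "integrable M Y" "(\<integral>\<omega>. \<bar>Y \<omega>\<bar> \<partial>M) \<le> sqrt (\<integral>\<omega>. (Y \<omega>)\<^sup>2 \<partial>M)"
proof -
  show iY: "integrable M Y" by (rule square_integrable_imp_integrable) (use i in auto)
  have "variance (\<lambda>\<omega>. \<bar>Y \<omega>\<bar>) = (\<integral>\<omega>. \<bar>Y \<omega>\<bar>\<^sup>2 \<partial>M) - (\<integral>\<omega>. \<bar>Y \<omega>\<bar> \<partial>M)\<^sup>2"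
    by (rule variance_eq) (use i iY in auto)
  moreover have "variance (\<lambda>\<omega>. \<bar>Y \<omega>\<bar>) \<ge> 0" by (rule variance_positive)
  ultimately have "(\<integral>\<omega>. \<bar>Y \<omega>\<bar> \<partial>M)\<^sup>2 \<le> (\<integral>\<omega>. (Y \<omega>)\<^sup>2 \<partial>M)" by simp
  then show "(\<integral>\<omega>. \<bar>Y \<omega>\<bar> \<partial>M) \<le> sqrt (\<integral>\<omega>. (Y \<omega>)\<^sup>2 \<partial>M)" by (rule real_le_rsqrt)
qed

context sv_noise
begin

text \<open>The stationary variance of the log-volatility; the next definition is the stationary mean of $\sigma_t^2$, the normalisation
  $\ell_n$ of the theorem. Every effect of the persistence of the volatility is bounded by a power of \<open>msq\<close>, so the rates only have to compare
  such powers with \<open>k\<close> and the sample size.\<close>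

definition lvar :: "real \<Rightarrow> real" where "lvar \<phi> = \<alpha>\<^sup>2 / (1 - \<phi>\<^sup>2)"

definition msq :: "real \<Rightarrow> real" where "msq \<phi> = exp (lvar \<phi> / 2)"

lemma lvar_nonneg: "\<bar>\<phi>\<bar> < 1 \<Longrightarrow> 0 \<le> lvar \<phi>"
  unfolding lvar_def by (intro divide_nonneg_nonneg) (auto simp: abs_square_less_1 intro: less_imp_le)

lemma msq_ge_1: "\<bar>\<phi>\<bar> < 1 \<Longrightarrow> 1 \<le> msq \<phi>"
  unfolding msq_def using lvar_nonneg by simp

lemma msq_power: "msq \<phi> ^ m = exp (real m * lvar \<phi> / 2)"
  unfolding msq_def by (simp add: exp_of_nat_mult[symmetric])

lemma lvar_le_msq: "lvar \<phi> \<le> msq \<phi> ^ 2"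
proof -
  have "lvar \<phi> \<le> exp (lvar \<phi>)" using exp_ge_add_one_self[of "lvar \<phi>"] by linarith
  then show ?thesis by (simp add: msq_power)
qed

text \<open>The relaxation time of the volatility is itself, up to a constant, at most a power of \<open>msq\<close>, so summing geometrically decaying
  covariances costs no new rate.\<close>

lemma inverse_gap_le:
  assumes "\<bar>\<phi>\<bar> < 1"
  shows "1 / (1 - \<bar>\<phi>\<bar>) \<le> 2 * msq \<phi> ^ 2 / \<alpha>\<^sup>2"
proof -
  have p: "1 - \<phi>\<^sup>2 > 0" using assms by (simp add: abs_square_less_1)
  have "1 - \<phi>\<^sup>2 = (1 - \<bar>\<phi>\<bar>) * (1 + \<bar>\<phi>\<bar>)" by (simp add: algebra_simps power2_eq_square abs_mult_self_eq)
  also have "\<dots> \<le> (1 - \<bar>\<phi>\<bar>) * 2" using assms by (intro mult_left_mono) auto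
  finally have "1 / (1 - \<bar>\<phi>\<bar>) \<le> 2 / (1 - \<phi>\<^sup>2)" using p assms by (simp add: field_simps)
  also have "\<dots> = 2 * lvar \<phi> / \<alpha>\<^sup>2" using \<alpha>_pos by (simp add: lvar_def)
  also have "\<dots> \<le> 2 * msq \<phi> ^ 2 / \<alpha>\<^sup>2" using lvar_le_msq by (intro divide_right_mono mult_left_mono) auto
  finally show ?thesis .
qed

lemma lcov_diag: "lcov \<phi> t t = lvar \<phi> * (1 - \<phi> ^ (2 * t))"
  by (simp add: lcov_def lvar_def)

lemma lcov_bounds:
  assumes "\<bar>\<phi>\<bar> < 1"
  shows "\<bar>lcov \<phi> t s\<bar> \<le> lvar \<phi> * \<bar>\<phi>\<bar> ^ (max t s - min t s)" "\<bar>lcov \<phi> t s\<bar> \<le> lvar \<phi>" "0 \<le> lcov \<phi> t t"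
proof -
  let ?m = "min t s"
  have e01: "0 \<le> 1 - \<phi> ^ (2 * m)" "1 - \<phi> ^ (2 * m) \<le> 1" for m :: nat
  proof -
    have "0 \<le> (\<phi>\<^sup>2) ^ m" by (intro zero_le_power zero_le_power2)
    moreover have "(\<phi>\<^sup>2) ^ m \<le> 1"
      using assms by (intro power_le_one[of "\<phi>\<^sup>2"]) (auto simp: abs_square_le_1)
    ultimately show "0 \<le> 1 - \<phi> ^ (2 * m)" "1 - \<phi> ^ (2 * m) \<le> 1" by (simp_all add: power_mult)
  qed
  have p: "1 - \<phi>\<^sup>2 > 0" using assms by (simp add: abs_square_less_1)
  have "lcov \<phi> t s = lvar \<phi> * \<phi> ^ (max t s - ?m) * (1 - \<phi> ^ (2 * ?m))"
    by (simp add: lcov_def lvar_def)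
  then have "\<bar>lcov \<phi> t s\<bar> = lvar \<phi> * \<bar>\<phi>\<bar> ^ (max t s - ?m) * (1 - \<phi> ^ (2 * ?m))"
    using lvar_nonneg[OF assms] e01[of ?m] by (simp add: abs_mult power_abs)
  also have "\<dots> \<le> lvar \<phi> * \<bar>\<phi>\<bar> ^ (max t s - ?m) * 1"
    using lvar_nonneg[OF assms] e01 by (intro mult_left_mono mult_nonneg_nonneg) auto
  finally show a: "\<bar>lcov \<phi> t s\<bar> \<le> lvar \<phi> * \<bar>\<phi>\<bar> ^ (max t s - min t s)" by simp
  also have "\<dots> \<le> lvar \<phi> * 1" using assms lvar_nonneg[OF assms] by (intro mult_left_mono power_le_one) auto
  finally show "\<bar>lcov \<phi> t s\<bar> \<le> lvar \<phi>" by simp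
  show "0 \<le> lcov \<phi> t t" unfolding lcov_diag using lvar_nonneg[OF assms] e01 by simp
qed

lemma expectation_sig_sq:
  assumes "\<bar>\<phi>\<bar> < 1"
  shows "integrable M (\<lambda>\<omega>. (sig \<phi> t \<omega>)\<^sup>2)" "(\<integral>\<omega>. (sig \<phi> t \<omega>)\<^sup>2 \<partial>M) = exp (lcov \<phi> t t / 2)"
    "(\<integral>\<omega>. (sig \<phi> t \<omega>)\<^sup>2 \<partial>M) \<le> msq \<phi>"
    "msq \<phi> - (\<integral>\<omega>. (sig \<phi> t \<omega>)\<^sup>2 \<partial>M) \<le> msq \<phi> * lvar \<phi> * (\<phi>\<^sup>2) ^ t / 2"
proof -
  show "integrable M (\<lambda>\<omega>. (sig \<phi> t \<omega>)\<^sup>2)" using expectation_sig_powers(1)[OF assms, of t 2 t 0] by simp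
  show e: "(\<integral>\<omega>. (sig \<phi> t \<omega>)\<^sup>2 \<partial>M) = exp (lcov \<phi> t t / 2)"
    using expectation_sig_powers(2)[OF assms, of t 2 t 0] by simp
  show "(\<integral>\<omega>. (sig \<phi> t \<omega>)\<^sup>2 \<partial>M) \<le> msq \<phi>"
    unfolding e msq_def using lcov_bounds(2)[OF assms, of t t] by simp
  define z where "z = lvar \<phi> * (\<phi>\<^sup>2) ^ t / 2"
  have "exp (lcov \<phi> t t / 2) = msq \<phi> * exp (- z)"
    unfolding msq_def lcov_diag z_def exp_add[symmetric] by (simp add: algebra_simps diff_divide_distrib flip: power_mult)
  moreover have "msq \<phi> * (1 - z) \<le> msq \<phi> * exp (- z)"
    using exp_ge_add_one_self[of "-z"] by (intro mult_left_mono) (auto simp: msq_def)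
  ultimately show "msq \<phi> - (\<integral>\<omega>. (sig \<phi> t \<omega>)\<^sup>2 \<partial>M) \<le> msq \<phi> * lvar \<phi> * (\<phi>\<^sup>2) ^ t / 2"
    unfolding e by (simp add: z_def algebra_simps)
qed

lemma expectation_sig_cube:
  assumes "\<bar>\<phi>\<bar> < 1"
  shows "integrable M (\<lambda>\<omega>. sig \<phi> t \<omega> ^ 3)" "(\<integral>\<omega>. sig \<phi> t \<omega> ^ 3 \<partial>M) \<le> msq \<phi> ^ 4"
proof -
  show "integrable M (\<lambda>\<omega>. sig \<phi> t \<omega> ^ 3)" using expectation_sig_powers(1)[OF assms, of t 3 t 0] by simp
  have "(\<integral>\<omega>. sig \<phi> t \<omega> ^ 3 \<partial>M) = exp (9 * lcov \<phi> t t / 8)"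
    using expectation_sig_powers(2)[OF assms, of t 3 t 0] by simp
  also have "\<dots> \<le> msq \<phi> ^ 4"
    unfolding msq_power using lcov_bounds(2)[OF assms, of t t] lvar_nonneg[OF assms] by simp
  finally show "(\<integral>\<omega>. sig \<phi> t \<omega> ^ 3 \<partial>M) \<le> msq \<phi> ^ 4" .
qed

lemma expectation_sig_sq_pair:
  assumes "\<bar>\<phi>\<bar> < 1"
  shows "integrable M (\<lambda>\<omega>. (sig \<phi> t \<omega>)\<^sup>2 * (sig \<phi> s \<omega>)\<^sup>2)"
    "(\<integral>\<omega>. (sig \<phi> t \<omega>)\<^sup>2 * (sig \<phi> s \<omega>)\<^sup>2 \<partial>M) \<le> msq \<phi> ^ 4"
    "\<bar>(\<integral>\<omega>. (sig \<phi> t \<omega>)\<^sup>2 * (sig \<phi> s \<omega>)\<^sup>2 \<partial>M) - (\<integral>\<omega>. (sig \<phi> t \<omega>)\<^sup>2 \<partial>M) * (\<integral>\<omega>. (sig \<phi> s \<omega>)\<^sup>2 \<partial>M)\<bar>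
       \<le> msq \<phi> ^ 6 * \<bar>\<phi>\<bar> ^ (max t s - min t s)"
proof -
  let ?x = "lcov \<phi> t t" and ?y = "lcov \<phi> s s" and ?z = "lcov \<phi> t s"
  have b: "?x \<le> lvar \<phi>" "?y \<le> lvar \<phi>" "\<bar>?z\<bar> \<le> lvar \<phi>" "\<bar>?z\<bar> \<le> lvar \<phi> * \<bar>\<phi>\<bar> ^ (max t s - min t s)"
    using lcov_bounds(2)[OF assms, of t t] lcov_bounds(2)[OF assms, of s s] lcov_bounds(1,2)[OF assms, of t s] by auto
  show "integrable M (\<lambda>\<omega>. (sig \<phi> t \<omega>)\<^sup>2 * (sig \<phi> s \<omega>)\<^sup>2)" by (rule expectation_sig_powers(1)[OF assms])
  have e: "(\<integral>\<omega>. (sig \<phi> t \<omega>)\<^sup>2 * (sig \<phi> s \<omega>)\<^sup>2 \<partial>M) = exp ((?x + ?y) / 2) * exp ?z"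
    using expectation_sig_powers(2)[OF assms, of t 2 s 2] by (simp add: add_divide_distrib flip: exp_add)
  have e2: "(\<integral>\<omega>. (sig \<phi> t \<omega>)\<^sup>2 \<partial>M) * (\<integral>\<omega>. (sig \<phi> s \<omega>)\<^sup>2 \<partial>M) = exp ((?x + ?y) / 2)"
    using expectation_sig_sq(2)[OF assms] by (simp add: add_divide_distrib exp_add)
  show "(\<integral>\<omega>. (sig \<phi> t \<omega>)\<^sup>2 * (sig \<phi> s \<omega>)\<^sup>2 \<partial>M) \<le> msq \<phi> ^ 4"
  proof -
    have "(?x + ?y) / 2 + ?z \<le> real 4 * lvar \<phi> / 2" using b(1,2) abs_le_D1[OF b(3)] by (simp add: field_simps)
    then show ?thesis unfolding e msq_power exp_add[symmetric] exp_le_cancel_iff .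
  qed
  have "\<bar>exp ((?x + ?y) / 2) * exp ?z - exp ((?x + ?y) / 2)\<bar> = exp ((?x + ?y) / 2) * \<bar>exp ?z - 1\<bar>"
  proof -
    have "exp ((?x + ?y) / 2) * exp ?z - exp ((?x + ?y) / 2) = exp ((?x + ?y) / 2) * (exp ?z - 1)" by (simp add: algebra_simps)
    then show ?thesis by (simp only: abs_mult abs_exp_cancel)
  qed
  also have "\<dots> \<le> exp (lvar \<phi>) * (\<bar>?z\<bar> * exp \<bar>?z\<bar>)"
    using b abs_exp_minus_one_le[of ?z] by (intro mult_mono) auto
  also have "\<dots> \<le> exp (lvar \<phi>) * ((exp (lvar \<phi>) * \<bar>\<phi>\<bar> ^ (max t s - min t s)) * exp (lvar \<phi>))"
  proof -
    have "\<bar>?z\<bar> \<le> exp (lvar \<phi>) * \<bar>\<phi>\<bar> ^ (max t s - min t s)"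
    proof (rule order_trans[OF b(4)])
      have "lvar \<phi> \<le> exp (lvar \<phi>)" using exp_ge_add_one_self[of "lvar \<phi>"] by linarith
      then show "lvar \<phi> * \<bar>\<phi>\<bar> ^ (max t s - min t s) \<le> exp (lvar \<phi>) * \<bar>\<phi>\<bar> ^ (max t s - min t s)"
        by (intro mult_right_mono) auto
    qed
    then show ?thesis using b by (intro mult_left_mono mult_mono) auto
  qed
  also have "\<dots> = msq \<phi> ^ 6 * \<bar>\<phi>\<bar> ^ (max t s - min t s)"
  proof -
    have "msq \<phi> ^ 6 = exp (lvar \<phi> + lvar \<phi> + lvar \<phi>)" unfolding msq_power by simp
    then show ?thesis by (simp only: exp_add mult_ac)
  qed
  finally show "\<bar>(\<integral>\<omega>. (sig \<phi> t \<omega>)\<^sup>2 * (sig \<phi> s \<omega>)\<^sup>2 \<partial>M) - (\<integral>\<omega>. (sig \<phi> t \<omega>)\<^sup>2 \<partial>M) * (\<integral>\<omega>. (sig \<phi> s \<omega>)\<^sup>2 \<partial>M)\<bar>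
       \<le> msq \<phi> ^ 6 * \<bar>\<phi>\<bar> ^ (max t s - min t s)"
    unfolding e e2 .
qed

lemma sum_abs_power_lag_le:
  assumes "\<bar>\<phi>\<bar> < 1"
  shows "(\<Sum>s=1..n. \<bar>\<phi>\<bar> ^ (max t s - min t s)) \<le> 4 * msq \<phi> ^ 2 / \<alpha>\<^sup>2"
proof -
  have "(\<Sum>s=1..n. \<bar>\<phi>\<bar> ^ (max t s - min t s)) = (\<Sum>s\<in>{1..n} \<inter> {..t}. \<bar>\<phi>\<bar> ^ (max t s - min t s)) + (\<Sum>s\<in>{1..n} - {..t}. \<bar>\<phi>\<bar> ^ (max t s - min t s))"
    by (subst sum.Int_Diff[of _ _ "{..t}"]) auto
  also have "\<dots> \<le> 1 / (1 - \<bar>\<phi>\<bar>) + 1 / (1 - \<bar>\<phi>\<bar>)"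
    using assms by (intro add_mono sum_distinct_powers_le) (auto simp: inj_on_def)
  also have "\<dots> \<le> 4 * msq \<phi> ^ 2 / \<alpha>\<^sup>2" using inverse_gap_le[OF assms] by simp
  finally show ?thesis .
qed

text \<open>Expanding the square gives covariances that decay geometrically in the lag; the sum over one index is
  therefore bounded by the relaxation time, and the sum over the other by the total weight.\<close>

lemma variance_weighted_sig_sq:
  assumes \<phi>: "\<bar>\<phi>\<bar> < 1" and w: "\<And>t. t \<in> {1..n} \<Longrightarrow> 0 \<le> w t" "\<And>t. t \<in> {1..n} \<Longrightarrow> w t \<le> W"
  defines "Y \<equiv> \<lambda>\<omega>. \<Sum>t=1..n. w t * ((sig \<phi> t \<omega>)\<^sup>2 - (\<integral>\<omega>. (sig \<phi> t \<omega>)\<^sup>2 \<partial>M))"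
  shows "integrable M (\<lambda>\<omega>. (Y \<omega>)\<^sup>2)" "(\<integral>\<omega>. (Y \<omega>)\<^sup>2 \<partial>M) \<le> 4 * msq \<phi> ^ 8 / \<alpha>\<^sup>2 * W * (\<Sum>t=1..n. w t)"
proof -
  let ?m = "\<lambda>t. \<integral>\<omega>. (sig \<phi> t \<omega>)\<^sup>2 \<partial>M"
  have e: "(Y \<omega>)\<^sup>2 = (\<Sum>t=1..n. \<Sum>s=1..n. w t * w s * (((sig \<phi> t \<omega>)\<^sup>2 - ?m t) * ((sig \<phi> s \<omega>)\<^sup>2 - ?m s)))" for \<omega>
    unfolding Y_def by (simp add: power2_eq_square sum_product mult_ac)
  have e1: "((sig \<phi> t \<omega>)\<^sup>2 - ?m t) * ((sig \<phi> s \<omega>)\<^sup>2 - ?m s)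
      = (sig \<phi> t \<omega>)\<^sup>2 * (sig \<phi> s \<omega>)\<^sup>2 - ?m s * (sig \<phi> t \<omega>)\<^sup>2 - ?m t * (sig \<phi> s \<omega>)\<^sup>2 + ?m t * ?m s" for t s \<omega>
    by (simp add: algebra_simps)
  note ii = expectation_sig_sq(1)[OF \<phi>] expectation_sig_sq_pair(1)[OF \<phi>]
  have i: "integrable M (\<lambda>\<omega>. ((sig \<phi> t \<omega>)\<^sup>2 - ?m t) * ((sig \<phi> s \<omega>)\<^sup>2 - ?m s))" for t s
    unfolding e1 using ii by simp
  have c: "(\<integral>\<omega>. ((sig \<phi> t \<omega>)\<^sup>2 - ?m t) * ((sig \<phi> s \<omega>)\<^sup>2 - ?m s) \<partial>M) \<le> msq \<phi> ^ 6 * \<bar>\<phi>\<bar> ^ (max t s - min t s)" for t s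
  proof -
    have "(\<integral>\<omega>. ((sig \<phi> t \<omega>)\<^sup>2 - ?m t) * ((sig \<phi> s \<omega>)\<^sup>2 - ?m s) \<partial>M) = (\<integral>\<omega>. (sig \<phi> t \<omega>)\<^sup>2 * (sig \<phi> s \<omega>)\<^sup>2 \<partial>M) - ?m t * ?m s"
      unfolding e1 using ii by (simp add: prob_space)
    then show ?thesis using expectation_sig_sq_pair(3)[OF \<phi>, of t s] by linarith
  qed
  show "integrable M (\<lambda>\<omega>. (Y \<omega>)\<^sup>2)"
    unfolding e by (intro Bochner_Integration.integrable_sum integrable_mult_right i)
  have "(\<integral>\<omega>. (Y \<omega>)\<^sup>2 \<partial>M) = (\<Sum>t=1..n. \<Sum>s=1..n. w t * w s * (\<integral>\<omega>. ((sig \<phi> t \<omega>)\<^sup>2 - ?m t) * ((sig \<phi> s \<omega>)\<^sup>2 - ?m s) \<partial>M))"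
    unfolding e using i by (simp add: Bochner_Integration.integral_sum Bochner_Integration.integrable_sum)
  also have "\<dots> \<le> (\<Sum>t=1..n. \<Sum>s=1..n. w t * W * (msq \<phi> ^ 6 * \<bar>\<phi>\<bar> ^ (max t s - min t s)))"
  proof (intro sum_mono)
    fix t s assume ts: "t \<in> {1..n}" "s \<in> {1..n}"
    have "w t * w s * (\<integral>\<omega>. ((sig \<phi> t \<omega>)\<^sup>2 - ?m t) * ((sig \<phi> s \<omega>)\<^sup>2 - ?m s) \<partial>M) \<le> w t * w s * (msq \<phi> ^ 6 * \<bar>\<phi>\<bar> ^ (max t s - min t s))"
      using w ts by (intro mult_left_mono c mult_nonneg_nonneg) auto
    also have "\<dots> \<le> w t * W * (msq \<phi> ^ 6 * \<bar>\<phi>\<bar> ^ (max t s - min t s))"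
      using w ts msq_ge_1[OF \<phi>] by (intro mult_right_mono mult_left_mono mult_nonneg_nonneg) auto
    finally show "w t * w s * (\<integral>\<omega>. ((sig \<phi> t \<omega>)\<^sup>2 - ?m t) * ((sig \<phi> s \<omega>)\<^sup>2 - ?m s) \<partial>M) \<le> w t * W * (msq \<phi> ^ 6 * \<bar>\<phi>\<bar> ^ (max t s - min t s))" .
  qed
  also have "\<dots> = (\<Sum>t=1..n. w t * W * msq \<phi> ^ 6 * (\<Sum>s=1..n. \<bar>\<phi>\<bar> ^ (max t s - min t s)))"
    by (simp add: sum_distrib_left mult.assoc)
  also have "\<dots> \<le> (\<Sum>t=1..n. w t * W * msq \<phi> ^ 6 * (4 * msq \<phi> ^ 2 / \<alpha>\<^sup>2))"
  proof (intro sum_mono mult_left_mono sum_abs_power_lag_le \<phi>)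
    fix t assume t: "t \<in> {1..n}"
    then have "0 \<le> W" using w(1)[OF t] w(2)[OF t] by linarith
    then show "0 \<le> w t * W * msq \<phi> ^ 6" using w(1)[OF t] msq_ge_1[OF \<phi>] by simp
  qed
  also have "\<dots> = 4 * (msq \<phi> ^ 6 * msq \<phi> ^ 2) / \<alpha>\<^sup>2 * W * (\<Sum>t=1..n. w t)"
    by (simp add: sum_distrib_left sum_distrib_right mult_ac sum_divide_distrib)
  also have "msq \<phi> ^ 6 * msq \<phi> ^ 2 = msq \<phi> ^ 8" by (simp flip: power_add)
  finally show "(\<integral>\<omega>. (Y \<omega>)\<^sup>2 \<partial>M) \<le> 4 * msq \<phi> ^ 8 / \<alpha>\<^sup>2 * W * (\<Sum>t=1..n. w t)" .
qed

definition inno :: "real \<Rightarrow> nat \<Rightarrow> 'a \<Rightarrow> real" where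
  "inno \<phi> t \<omega> = sig \<phi> t \<omega> * \<epsilon> t \<omega>"

lemma measurable_inno: "t \<ge> 1 \<Longrightarrow> inno \<phi> t \<in> borel_measurable M"
  unfolding inno_def[abs_def] using measurable_\<epsilon>[of t] by measurable

lemma measurable_path_component: "t \<ge> 1 \<Longrightarrow> (\<lambda>e. e t) \<in> borel_measurable (PiM {1..} (\<lambda>_::nat. borel :: real measure))"
  by (rule measurable_component_singleton) simp

lemma expectation_inno_pair:
  assumes \<phi>: "\<bar>\<phi>\<bar> < 1" and t: "t \<ge> 1" "s \<ge> 1"
  shows "integrable M (\<lambda>\<omega>. inno \<phi> t \<omega> * inno \<phi> s \<omega>)"
    "t \<noteq> s \<Longrightarrow> (\<integral>\<omega>. inno \<phi> t \<omega> * inno \<phi> s \<omega> \<partial>M) = 0"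
proof -
  have m[measurable]: "(\<lambda>e :: nat \<Rightarrow> real. e t * e s) \<in> borel_measurable (PiM {1..} (\<lambda>_. borel))"
    using t by (intro borel_measurable_times measurable_path_component)
  have q[measurable]: "(\<lambda>h. vol \<phi> h t * vol \<phi> h s) \<in> borel_measurable (PiM {1..} (\<lambda>_. borel))" by measurable
  have "integrable M (\<lambda>\<omega>. sig \<phi> t \<omega> * sig \<phi> s \<omega>)" using expectation_sig_powers(1)[OF \<phi>, of t 1 s 1] by simp
  then have i2: "integrable M (\<lambda>\<omega>. vol \<phi> (\<lambda>t\<in>{1..}. \<eta> t \<omega>) t * vol \<phi> (\<lambda>t\<in>{1..}. \<eta> t \<omega>) s)" unfolding sig_path .
  have i1: "integrable M (\<lambda>\<omega>. (\<lambda>t\<in>{1..}. \<epsilon> t \<omega>) t * (\<lambda>t\<in>{1..}. \<epsilon> t \<omega>) s)" using expectation_\<epsilon>_pair(1)[OF t] t by simp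
  note L = expectation_product_\<epsilon>_\<eta>[OF m q i1 i2]
  have e: "inno \<phi> t \<omega> * inno \<phi> s \<omega> = ((\<lambda>t\<in>{1..}. \<epsilon> t \<omega>) t * (\<lambda>t\<in>{1..}. \<epsilon> t \<omega>) s) * (vol \<phi> (\<lambda>t\<in>{1..}. \<eta> t \<omega>) t * vol \<phi> (\<lambda>t\<in>{1..}. \<eta> t \<omega>) s)" for \<omega>
    using t unfolding inno_def sig_path by simp
  show "integrable M (\<lambda>\<omega>. inno \<phi> t \<omega> * inno \<phi> s \<omega>)" unfolding e by (rule L(1))
  show "(\<integral>\<omega>. inno \<phi> t \<omega> * inno \<phi> s \<omega> \<partial>M) = 0" if "t \<noteq> s"
    unfolding e L(2) using expectation_\<epsilon>_pair(2)[OF t that] t by simp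
qed

lemma expectation_inno_sq:
  assumes \<phi>: "\<bar>\<phi>\<bar> < 1" and t: "t \<ge> 1"
  shows "(\<integral>\<omega>. (inno \<phi> t \<omega>)\<^sup>2 \<partial>M) = (\<integral>\<omega>. (sig \<phi> t \<omega>)\<^sup>2 \<partial>M)"
proof -
  have m[measurable]: "(\<lambda>e :: nat \<Rightarrow> real. (e t)\<^sup>2) \<in> borel_measurable (PiM {1..} (\<lambda>_. borel))"
    using t by (intro borel_measurable_power measurable_path_component)
  have q[measurable]: "(\<lambda>h. (vol \<phi> h t)\<^sup>2) \<in> borel_measurable (PiM {1..} (\<lambda>_. borel))" by measurable
  have i2: "integrable M (\<lambda>\<omega>. (vol \<phi> (\<lambda>t\<in>{1..}. \<eta> t \<omega>) t)\<^sup>2)"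
    using expectation_sig_sq(1)[OF \<phi>, of t] unfolding sig_path .
  have i1: "integrable M (\<lambda>\<omega>. ((\<lambda>t\<in>{1..}. \<epsilon> t \<omega>) t)\<^sup>2)" using integrable_\<epsilon>_power[of t 2] t by simp
  have e: "(inno \<phi> t \<omega>)\<^sup>2 = ((\<lambda>t\<in>{1..}. \<epsilon> t \<omega>) t)\<^sup>2 * (vol \<phi> (\<lambda>t\<in>{1..}. \<eta> t \<omega>) t)\<^sup>2" for \<omega>
    using t unfolding inno_def sig_path by (simp add: power_mult_distrib)
  show ?thesis unfolding e expectation_product_\<epsilon>_\<eta>(2)[OF m q i1 i2] using t by (simp add: \<epsilon>_var sig_path)
qed

lemma expectation_inno_linear_sq:
  assumes \<phi>: "\<bar>\<phi>\<bar> < 1" and T: "finite T" "T \<subseteq> {1..}"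
  shows "integrable M (\<lambda>\<omega>. (\<Sum>t\<in>T. b t * inno \<phi> t \<omega>)\<^sup>2)"
    "(\<integral>\<omega>. (\<Sum>t\<in>T. b t * inno \<phi> t \<omega>)\<^sup>2 \<partial>M) \<le> msq \<phi> * (\<Sum>t\<in>T. (b t)\<^sup>2)"
proof -
  have e: "b t * inno \<phi> t \<omega> * (b s * inno \<phi> s \<omega>) = b t * b s * (inno \<phi> t \<omega> * inno \<phi> s \<omega>)" for t s \<omega> by simp
  have i: "integrable M (\<lambda>\<omega>. b t * inno \<phi> t \<omega> * (b s * inno \<phi> s \<omega>))" if "t \<in> T" "s \<in> T" for t s
    unfolding e using that T by (intro integrable_mult_right expectation_inno_pair(1)[OF \<phi>]) auto
  have o: "(\<integral>\<omega>. b t * inno \<phi> t \<omega> * (b s * inno \<phi> s \<omega>) \<partial>M) = 0" if "t \<in> T" "s \<in> T" "t \<noteq> s" for t s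
    unfolding e using that T expectation_inno_pair(2)[OF \<phi>, of t s] by auto
  note L = expectation_square_orthogonal[where X = "\<lambda>t \<omega>. b t * inno \<phi> t \<omega>", OF T(1) i o]
  show "integrable M (\<lambda>\<omega>. (\<Sum>t\<in>T. b t * inno \<phi> t \<omega>)\<^sup>2)" by (rule L(1))
  have "(\<integral>\<omega>. (\<Sum>t\<in>T. b t * inno \<phi> t \<omega>)\<^sup>2 \<partial>M) = (\<Sum>t\<in>T. (b t)\<^sup>2 * (\<integral>\<omega>. (sig \<phi> t \<omega>)\<^sup>2 \<partial>M))"
    using T by (subst L(2)) (auto intro!: sum.cong simp: power_mult_distrib expectation_inno_sq[OF \<phi>])
  also have "\<dots> \<le> (\<Sum>t\<in>T. (b t)\<^sup>2 * msq \<phi>)" by (intro sum_mono mult_left_mono expectation_sig_sq(3)[OF \<phi>]) simp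
  finally show "(\<integral>\<omega>. (\<Sum>t\<in>T. b t * inno \<phi> t \<omega>)\<^sup>2 \<partial>M) \<le> msq \<phi> * (\<Sum>t\<in>T. (b t)\<^sup>2)"
    by (simp add: sum_distrib_left mult.commute)
qed

lemma expectation_inno_sum_sq:
  assumes \<phi>: "\<bar>\<phi>\<bar> < 1"
  shows "integrable M (\<lambda>\<omega>. \<Sum>t=1..n. (inno \<phi> t \<omega>)\<^sup>2)" "(\<integral>\<omega>. (\<Sum>t=1..n. (inno \<phi> t \<omega>)\<^sup>2) \<partial>M) \<le> real n * msq \<phi>"
proof -
  have i: "integrable M (\<lambda>\<omega>. (inno \<phi> t \<omega>)\<^sup>2)" if "t \<in> {1..n}" for t
    using expectation_inno_pair(1)[OF \<phi>, of t t] that by (simp add: power2_eq_square)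
  show "integrable M (\<lambda>\<omega>. \<Sum>t=1..n. (inno \<phi> t \<omega>)\<^sup>2)" by (intro Bochner_Integration.integrable_sum i)
  have "(\<integral>\<omega>. (\<Sum>t=1..n. (inno \<phi> t \<omega>)\<^sup>2) \<partial>M) = (\<Sum>t=1..n. \<integral>\<omega>. (sig \<phi> t \<omega>)\<^sup>2 \<partial>M)"
    using i by (subst Bochner_Integration.integral_sum) (auto intro!: sum.cong simp: expectation_inno_sq[OF \<phi>])
  also have "\<dots> \<le> (\<Sum>t=1..n. msq \<phi>)" by (intro sum_mono expectation_sig_sq(3)[OF \<phi>])
  finally show "(\<integral>\<omega>. (\<Sum>t=1..n. (inno \<phi> t \<omega>)\<^sup>2) \<partial>M) \<le> real n * msq \<phi>" by simp
qed

text \<open>The products $u_t u_j$ with $t<j$ are pairwise orthogonal, so no cross terms survive.\<close>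

lemma expectation_inno_bilinear_sq:
  assumes \<phi>: "\<bar>\<phi>\<bar> < 1" and P: "finite P" "\<And>t j. (t, j) \<in> P \<Longrightarrow> 1 \<le> t \<and> t < j"
  shows "integrable M (\<lambda>\<omega>. (\<Sum>(t, j)\<in>P. b t j * (inno \<phi> t \<omega> * inno \<phi> j \<omega>))\<^sup>2)"
    "(\<integral>\<omega>. (\<Sum>(t, j)\<in>P. b t j * (inno \<phi> t \<omega> * inno \<phi> j \<omega>))\<^sup>2 \<partial>M) \<le> msq \<phi> ^ 4 * (\<Sum>(t, j)\<in>P. (b t j)\<^sup>2)"
proof -
  define X where "X = (\<lambda>(t, j) \<omega>. b t j * (inno \<phi> t \<omega> * inno \<phi> j \<omega>))"
  have XX: "integrable M (\<lambda>\<omega>. X (t, j) \<omega> * X (s, i) \<omega>) \<and>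
      ((t, j) \<noteq> (s, i) \<longrightarrow> (\<integral>\<omega>. X (t, j) \<omega> * X (s, i) \<omega> \<partial>M) = 0) \<and>
      (\<integral>\<omega>. (X (t, j) \<omega>)\<^sup>2 \<partial>M) \<le> (b t j)\<^sup>2 * msq \<phi> ^ 4"
    if tj: "1 \<le> t" "t < j" and si: "1 \<le> s" "s < i" for t j s i
  proof -
    let ?E = "\<lambda>\<omega>. \<lambda>t\<in>{1..}. \<epsilon> t \<omega>" and ?H = "\<lambda>\<omega>. \<lambda>t\<in>{1..}. \<eta> t \<omega>"
    define p where "p e = (e t * e j) * (e s * e i)" for e :: "nat \<Rightarrow> real"
    define q where "q h = (vol \<phi> h t * vol \<phi> h j) * (vol \<phi> h s * vol \<phi> h i)" for h
    have m: "p \<in> borel_measurable (PiM {1..} (\<lambda>_. borel))"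
      unfolding p_def[abs_def] using that by (intro borel_measurable_times measurable_path_component) auto
    have mq: "q \<in> borel_measurable (PiM {1..} (\<lambda>_. borel))" unfolding q_def[abs_def] by measurable
    have pe: "p (?E \<omega>) = (\<epsilon> t \<omega> * \<epsilon> j \<omega>) * (\<epsilon> s \<omega> * \<epsilon> i \<omega>)" for \<omega> using that by (simp add: p_def)
    have qe: "q (?H \<omega>) = (sig \<phi> t \<omega> * sig \<phi> j \<omega>) * (sig \<phi> s \<omega> * sig \<phi> i \<omega>)" for \<omega> by (simp add: q_def sig_path)
    have i1: "integrable M (\<lambda>\<omega>. p (?E \<omega>))" unfolding pe by (rule expectation_\<epsilon>_quadruple(1)[OF tj si])
    have i2: "integrable M (\<lambda>\<omega>. q (?H \<omega>))"
    proof (rule Bochner_Integration.integrable_bound)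
      show "integrable M (\<lambda>\<omega>. (sig \<phi> t \<omega>)\<^sup>2 * (sig \<phi> j \<omega>)\<^sup>2 + (sig \<phi> s \<omega>)\<^sup>2 * (sig \<phi> i \<omega>)\<^sup>2)"
        using expectation_sig_sq_pair(1)[OF \<phi>] by simp
      have "\<bar>x * y\<bar> \<le> x\<^sup>2 + y\<^sup>2" for x y :: real
      proof -
        have "2 * \<bar>x * y\<bar> \<le> x\<^sup>2 + y\<^sup>2" using sum_squares_bound[of "\<bar>x\<bar>" "\<bar>y\<bar>"] by (simp add: abs_mult mult.assoc)
        then show ?thesis by (smt (verit) abs_ge_zero)
      qed
      from this[of "sig \<phi> t \<omega> * sig \<phi> j \<omega>" "sig \<phi> s \<omega> * sig \<phi> i \<omega>" for \<omega>]
      show "AE \<omega> in M. norm (q (?H \<omega>)) \<le> norm ((sig \<phi> t \<omega>)\<^sup>2 * (sig \<phi> j \<omega>)\<^sup>2 + (sig \<phi> s \<omega>)\<^sup>2 * (sig \<phi> i \<omega>)\<^sup>2)"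
        unfolding qe by (auto simp: power_mult_distrib)
    qed (unfold qe, measurable)
    note L = expectation_product_\<epsilon>_\<eta>[OF m mq i1 i2]
    have e: "X (t, j) \<omega> * X (s, i) \<omega> = b t j * b s i * (p (?E \<omega>) * q (?H \<omega>))" for \<omega>
      unfolding X_def inno_def pe qe by simp
    have a: "integrable M (\<lambda>\<omega>. X (t, j) \<omega> * X (s, i) \<omega>)" unfolding e using L(1) by (rule integrable_mult_right)
    have b: "(\<integral>\<omega>. X (t, j) \<omega> * X (s, i) \<omega> \<partial>M) = 0" if "(t, j) \<noteq> (s, i)"
      unfolding e integral_mult_right_zero L(2) unfolding pe expectation_\<epsilon>_quadruple(2)[OF tj si that] by simp
    have m': "(\<lambda>e :: nat \<Rightarrow> real. (e t * e j)\<^sup>2) \<in> borel_measurable (PiM {1..} (\<lambda>_. borel))"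
      using tj by (intro borel_measurable_power borel_measurable_times measurable_path_component) auto
    have mq': "(\<lambda>h. (vol \<phi> h t * vol \<phi> h j)\<^sup>2) \<in> borel_measurable (PiM {1..} (\<lambda>_. borel))" by measurable
    have i1': "integrable M (\<lambda>\<omega>. (?E \<omega> t * ?E \<omega> j)\<^sup>2)"
      using expectation_\<epsilon>_quadruple(1)[OF tj tj] tj by (simp add: power2_eq_square)
    have i2': "integrable M (\<lambda>\<omega>. (vol \<phi> (?H \<omega>) t * vol \<phi> (?H \<omega>) j)\<^sup>2)"
      using expectation_sig_sq_pair(1)[OF \<phi>, of t j] by (simp add: sig_path power_mult_distrib)
    note L' = expectation_product_\<epsilon>_\<eta>[OF m' mq' i1' i2']
    have e': "(X (t, j) \<omega>)\<^sup>2 = (b t j)\<^sup>2 * ((?E \<omega> t * ?E \<omega> j)\<^sup>2 * (vol \<phi> (?H \<omega>) t * vol \<phi> (?H \<omega>) j)\<^sup>2)" for \<omega>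
      using tj unfolding X_def inno_def sig_path by (simp add: power_mult_distrib)
    have "(\<integral>\<omega>. (X (t, j) \<omega>)\<^sup>2 \<partial>M) = (b t j)\<^sup>2 * ((\<integral>\<omega>. (\<epsilon> t \<omega> * \<epsilon> j \<omega>)\<^sup>2 \<partial>M) * (\<integral>\<omega>. (sig \<phi> t \<omega>)\<^sup>2 * (sig \<phi> j \<omega>)\<^sup>2 \<partial>M))"
      unfolding e' integral_mult_right_zero L'(2) using tj by (simp add: sig_path power_mult_distrib)
    also have "\<dots> \<le> (b t j)\<^sup>2 * msq \<phi> ^ 4"
      unfolding expectation_\<epsilon>_quadruple(3)[OF tj si] using expectation_sig_sq_pair(2)[OF \<phi>, of t j] by (intro mult_left_mono) auto
    finally show ?thesis using a b by blast
  qed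
  have i: "integrable M (\<lambda>\<omega>. X x \<omega> * X y \<omega>)" if "x \<in> P" "y \<in> P" for x y
    using XX[of "fst x" "snd x" "fst y" "snd y"] P(2)[of "fst x" "snd x"] P(2)[of "fst y" "snd y"] that by simp
  have o: "(\<integral>\<omega>. X x \<omega> * X y \<omega> \<partial>M) = 0" if "x \<in> P" "y \<in> P" "x \<noteq> y" for x y
    using XX[of "fst x" "snd x" "fst y" "snd y"] P(2)[of "fst x" "snd x"] P(2)[of "fst y" "snd y"] that by simp
  note L = expectation_square_orthogonal[OF P(1) i o]
  have e: "(\<Sum>(t, j)\<in>P. b t j * (inno \<phi> t \<omega> * inno \<phi> j \<omega>)) = (\<Sum>x\<in>P. X x \<omega>)" for \<omega>
    unfolding X_def by (simp add: case_prod_beta')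
  show "integrable M (\<lambda>\<omega>. (\<Sum>(t, j)\<in>P. b t j * (inno \<phi> t \<omega> * inno \<phi> j \<omega>))\<^sup>2)" unfolding e by (rule L(1))
  have "(\<integral>\<omega>. (\<Sum>(t, j)\<in>P. b t j * (inno \<phi> t \<omega> * inno \<phi> j \<omega>))\<^sup>2 \<partial>M) = (\<Sum>x\<in>P. \<integral>\<omega>. (X x \<omega>)\<^sup>2 \<partial>M)" unfolding e by (rule L(2))
  also have "\<dots> \<le> (\<Sum>(t, j)\<in>P. (b t j)\<^sup>2 * msq \<phi> ^ 4)"
  proof (rule sum_mono)
    fix x assume "x \<in> P"
    then show "(\<integral>\<omega>. (X x \<omega>)\<^sup>2 \<partial>M) \<le> (case x of (t, j) \<Rightarrow> (b t j)\<^sup>2 * msq \<phi> ^ 4)"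
      using XX[of "fst x" "snd x" "fst x" "snd x"] P(2)[of "fst x" "snd x"] by (simp add: case_prod_beta')
  qed
  finally show "(\<integral>\<omega>. (\<Sum>(t, j)\<in>P. b t j * (inno \<phi> t \<omega> * inno \<phi> j \<omega>))\<^sup>2 \<partial>M) \<le> msq \<phi> ^ 4 * (\<Sum>(t, j)\<in>P. (b t j)\<^sup>2)"
    by (simp add: sum_distrib_left case_prod_beta' mult.commute)
qed

lemma abs_cube: "\<bar>x\<bar> ^ 3 = \<bar>x\<bar> * x\<^sup>2" for x :: real
  by (simp add: power3_eq_cube power2_eq_square)

text \<open>Third-order agreement with the standard normal characteristic function: the first two moments coincide and the third
  absolute moment is finite.\<close>

lemma char_\<epsilon>_approx:
  obtains K where "K \<ge> 0" "\<And>x. cmod (char (distr M borel (\<epsilon> 1)) x - complex_of_real (exp (- x\<^sup>2 / 2))) \<le> K * \<bar>x\<bar> ^ 3"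
proof -
  have [measurable]: "\<epsilon> 1 \<in> borel_measurable M" by (rule measurable_\<epsilon>) simp
  define m3 where "m3 = (\<integral>\<omega>. \<bar>\<epsilon> 1 \<omega>\<bar> ^ 3 \<partial>M)"
  have i3: "integrable M (\<lambda>\<omega>. \<bar>\<epsilon> 1 \<omega>\<bar> ^ 3)"
    using integrable_\<epsilon>_power[of 1 3] by (subst power_abs[symmetric]) (rule integrable_abs, simp)
  have m3: "m3 \<ge> 0" unfolding m3_def by simp
  have i1: "integrable M (\<epsilon> 1)" and i2: "integrable M (\<lambda>\<omega>. (\<epsilon> 1 \<omega>)\<^sup>2)"
    using integrable_\<epsilon>_power[of 1 1] integrable_\<epsilon>_power[of 1 2] by simp_all
  have mean: "expectation (\<epsilon> 1) = 0" and var: "variance (\<epsilon> 1) = 1" using \<epsilon>_mean[of 1] \<epsilon>_var[of 1] by simp_all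
  have b: "cmod (char (distr M borel (\<epsilon> 1)) x - (1 - x\<^sup>2 / 2)) \<le> m3 * \<bar>x\<bar> ^ 3" for x
  proof -
    have "cmod (char (distr M borel (\<epsilon> 1)) x - (1 - x\<^sup>2 * 1 / 2))
       \<le> (x\<^sup>2 / 6) * expectation (\<lambda>\<omega>. min (6 * (\<epsilon> 1 \<omega>)\<^sup>2) (\<bar>x\<bar> * \<bar>\<epsilon> 1 \<omega>\<bar> ^ 3))"
      by (rule char_approx3'[OF measurable_\<epsilon>[OF order_refl] i1 i2 mean var refl])
    also have "\<dots> \<le> (x\<^sup>2 / 6) * expectation (\<lambda>\<omega>. \<bar>x\<bar> * \<bar>\<epsilon> 1 \<omega>\<bar> ^ 3)"
    proof (intro mult_left_mono integral_mono)
      show "integrable M (\<lambda>\<omega>. min (6 * (\<epsilon> 1 \<omega>)\<^sup>2) (\<bar>x\<bar> * \<bar>\<epsilon> 1 \<omega>\<bar> ^ 3))"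
        using i2 i3 by (intro integrable_min) auto
      show "integrable M (\<lambda>\<omega>. \<bar>x\<bar> * \<bar>\<epsilon> 1 \<omega>\<bar> ^ 3)" using i3 by simp
    qed auto
    also have "\<dots> = m3 * \<bar>x\<bar> ^ 3 / 6" by (simp add: m3_def abs_cube)
    also have "\<dots> \<le> m3 * \<bar>x\<bar> ^ 3" using m3 by simp
    finally show ?thesis by simp
  qed
  show ?thesis
  proof (rule that[of "m3 + 1"])
    show "0 \<le> m3 + 1" using m3 by simp
    fix x
    have "cmod (char (distr M borel (\<epsilon> 1)) x - complex_of_real (exp (- x\<^sup>2 / 2)))
       \<le> cmod (char (distr M borel (\<epsilon> 1)) x - (1 - x\<^sup>2 / 2)) + cmod (complex_of_real (1 - x\<^sup>2 / 2) - complex_of_real (exp (- x\<^sup>2 / 2)))"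
      by (rule order_trans[OF _ norm_triangle_ineq]) simp
    also have "cmod (complex_of_real (1 - x\<^sup>2 / 2) - complex_of_real (exp (- x\<^sup>2 / 2))) \<le> \<bar>x\<bar> ^ 3"
      unfolding of_real_diff[symmetric] norm_of_real using exp_minus_half_square_approx[of x] by (simp add: abs_minus_commute)
    finally show "cmod (char (distr M borel (\<epsilon> 1)) x - complex_of_real (exp (- x\<^sup>2 / 2))) \<le> (m3 + 1) * \<bar>x\<bar> ^ 3"
      using b[of x] by (simp add: algebra_simps)
  qed
qed

text \<open>Conditioning on the volatility path, as Fubini's theorem for the product of the laws of the two noise
  sequences.\<close>

lemma char_inno_linear:
  "(\<integral>\<omega>. iexp (\<Sum>t=1..n. a t * inno \<phi> t \<omega>) \<partial>M) = (\<integral>\<omega>. (\<Prod>t=1..n. char (distr M borel (\<epsilon> 1)) (a t * sig \<phi> t \<omega>)) \<partial>M)"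
proof -
  let ?P = "PiM {1..} (\<lambda>_::nat. borel :: real measure)"
  let ?E = "\<lambda>\<omega>. \<lambda>t\<in>{1..}. \<epsilon> t \<omega>" and ?H = "\<lambda>\<omega>. \<lambda>t\<in>{1..}. \<eta> t \<omega>"
  have Em[measurable]: "?E \<in> M \<rightarrow>\<^sub>M ?P" using \<epsilon>_\<eta>_indep by (rule indep_var_rv1)
  have Hm[measurable]: "?H \<in> M \<rightarrow>\<^sub>M ?P" using \<epsilon>_\<eta>_indep by (rule indep_var_rv2)
  have J: "distr M ?P ?E \<Otimes>\<^sub>M distr M ?P ?H = distr M (?P \<Otimes>\<^sub>M ?P) (\<lambda>\<omega>. (?E \<omega>, ?H \<omega>))"
    using \<epsilon>_\<eta>_indep unfolding indep_var_distribution_eq by blast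
  interpret PE: prob_space "distr M ?P ?E" by (rule prob_space_distr) measurable
  interpret PH: prob_space "distr M ?P ?H" by (rule prob_space_distr) measurable
  interpret PP: pair_prob_space "distr M ?P ?E" "distr M ?P ?H" ..
  define F where "F e h = iexp (\<Sum>t=1..n. a t * (vol \<phi> h t * e t))" for e h :: "nat \<Rightarrow> real"
  have c: "(\<lambda>x. fst x t) \<in> borel_measurable (?P \<Otimes>\<^sub>M ?P)" if "t \<in> {1..n}" for t
    using measurable_compose[OF measurable_fst measurable_path_component[of t]] that by auto
  have v: "(\<lambda>x. vol \<phi> (snd x) t) \<in> borel_measurable (?P \<Otimes>\<^sub>M ?P)" for t
    using measurable_compose[OF measurable_snd measurable_vol_path] .
  have s: "(\<lambda>x. \<Sum>t=1..n. a t * (vol \<phi> (snd x) t * fst x t)) \<in> borel_measurable (?P \<Otimes>\<^sub>M ?P)"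
    by (intro borel_measurable_sum borel_measurable_times borel_measurable_const v c)
  have Fm[measurable]: "(\<lambda>x. F (fst x) (snd x)) \<in> borel_measurable (?P \<Otimes>\<^sub>M ?P)"
    unfolding F_def using s by measurable
  have Fi: "integrable (distr M ?P ?E \<Otimes>\<^sub>M distr M ?P ?H) (\<lambda>x. F (fst x) (snd x))"
  proof (rule PP.integrable_const_bound[of _ 1])
    have eq: "sets (distr M ?P ?E \<Otimes>\<^sub>M distr M ?P ?H) = sets (?P \<Otimes>\<^sub>M ?P)"
      by (intro sets_pair_measure_cong sets_distr)
    show "(\<lambda>x. F (fst x) (snd x)) \<in> borel_measurable (distr M ?P ?E \<Otimes>\<^sub>M distr M ?P ?H)"
      unfolding measurable_cong_sets[OF eq refl] by (rule Fm)
    show "AE x in distr M ?P ?E \<Otimes>\<^sub>M distr M ?P ?H. cmod (F (fst x) (snd x)) \<le> 1"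
      unfolding F_def norm_exp_i_times by simp
  qed
  have FE: "(\<lambda>e. F e h) \<in> borel_measurable ?P" for h
  proof -
    have "(\<lambda>e. \<Sum>t=1..n. a t * (vol \<phi> h t * e t)) \<in> borel_measurable ?P"
      by (intro borel_measurable_sum borel_measurable_times borel_measurable_const measurable_path_component) simp
    from measurable_compose[OF this, of iexp borel] show ?thesis unfolding F_def by simp
  qed
  have "(\<integral>\<omega>. iexp (\<Sum>t=1..n. a t * inno \<phi> t \<omega>) \<partial>M) = (\<integral>\<omega>. F (?E \<omega>) (?H \<omega>) \<partial>M)"
    unfolding F_def inno_def sig_path by (simp cong: sum.cong_simp)
  also have "\<dots> = (\<integral>x. F (fst x) (snd x) \<partial>distr M (?P \<Otimes>\<^sub>M ?P) (\<lambda>\<omega>. (?E \<omega>, ?H \<omega>)))"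
    by (subst integral_distr[OF measurable_Pair[OF Em Hm] Fm]) simp
  also have "\<dots> = (\<integral>x. F (fst x) (snd x) \<partial>(distr M ?P ?E \<Otimes>\<^sub>M distr M ?P ?H))" unfolding J ..
  also have "\<dots> = (\<integral>h. (\<integral>e. F e h \<partial>distr M ?P ?E) \<partial>distr M ?P ?H)"
    using PP.integral_snd[of "\<lambda>e h. F e h"] Fi by (simp add: case_prod_beta')
  also have "\<dots> = (\<integral>h. (\<Prod>t=1..n. char (distr M borel (\<epsilon> 1)) (a t * vol \<phi> h t)) \<partial>distr M ?P ?H)"
  proof (rule Bochner_Integration.integral_cong[OF refl])
    fix h
    have "(\<integral>e. F e h \<partial>distr M ?P ?E) = (\<integral>\<omega>. F (?E \<omega>) h \<partial>M)" by (rule integral_distr[OF Em FE])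
    also have "\<dots> = (\<integral>\<omega>. iexp (1 * (\<Sum>t=1..n. (a t * vol \<phi> h t) * \<epsilon> t \<omega>)) \<partial>M)"
      unfolding F_def by (simp add: mult.assoc cong: sum.cong_simp)
    also have "\<dots> = char (distr M borel (\<lambda>\<omega>. \<Sum>t=1..n. (a t * vol \<phi> h t) * \<epsilon> t \<omega>)) 1"
    proof -
      have "(\<lambda>\<omega>. \<Sum>t=1..n. (a t * vol \<phi> h t) * \<epsilon> t \<omega>) \<in> borel_measurable M"
        by (intro borel_measurable_sum borel_measurable_times borel_measurable_const measurable_\<epsilon>) auto
      then show ?thesis unfolding char_def by (subst integral_distr) auto
    qed
    also have "\<dots> = (\<Prod>t=1..n. char (distr M borel (\<lambda>\<omega>. (a t * vol \<phi> h t) * \<epsilon> t \<omega>)) 1)"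
      by (rule char_distr_sum, rule indep_vars_compose2[OF indep_vars_subset[OF \<epsilon>_indep]]) auto
    also have "\<dots> = (\<Prod>t=1..n. char (distr M borel (\<epsilon> 1)) (a t * vol \<phi> h t))"
    proof (rule prod.cong[OF refl])
      fix t assume t: "t \<in> {1..n}"
      then have [measurable]: "\<epsilon> t \<in> borel_measurable M" by (intro measurable_\<epsilon>) auto
      have "char (distr M borel (\<lambda>\<omega>. (a t * vol \<phi> h t) * \<epsilon> t \<omega>)) 1 = char (distr M borel (\<epsilon> t)) (a t * vol \<phi> h t)"
        unfolding char_def by (simp add: integral_distr)
      then show "char (distr M borel (\<lambda>\<omega>. (a t * vol \<phi> h t) * \<epsilon> t \<omega>)) 1 = char (distr M borel (\<epsilon> 1)) (a t * vol \<phi> h t)"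
        using \<epsilon>_ident[of t] t by simp
    qed
    finally show "(\<integral>e. F e h \<partial>distr M ?P ?E) = (\<Prod>t=1..n. char (distr M borel (\<epsilon> 1)) (a t * vol \<phi> h t))" .
  qed
  also have "\<dots> = (\<integral>\<omega>. (\<Prod>t=1..n. char (distr M borel (\<epsilon> 1)) (a t * vol \<phi> (?H \<omega>) t)) \<partial>M)"
  proof (rule integral_distr[OF Hm])
    interpret R: real_distribution "distr M borel (\<epsilon> 1)" by (rule real_distribution_distr) (rule measurable_\<epsilon>, simp)
    have "(\<lambda>h. char (distr M borel (\<epsilon> 1)) (a t * vol \<phi> h t)) \<in> borel_measurable ?P" for t
      by (rule measurable_compose[OF _ R.char_measurable]) measurable
    then show "(\<lambda>h. \<Prod>t=1..n. char (distr M borel (\<epsilon> 1)) (a t * vol \<phi> h t)) \<in> borel_measurable ?P"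
      by (intro borel_measurable_prod)
  qed
  finally show ?thesis unfolding sig_path .
qed

text \<open>Two steps: the conditional characteristic function is replaced by that of a normal law with the same conditional
  variance $\sum_t a_t^2\sigma_t^2$, and this variance by $\ell \sum_t a_t^2$. The second replacement combines the fluctuation bound
  above with the distance of $E\sigma_t^2$ from its stationary value, which decays like $\phi^{2t}$.\<close>

lemma char_inno_linear_approx:
  assumes K: "K \<ge> 0" "\<And>x. cmod (char (distr M borel (\<epsilon> 1)) x - complex_of_real (exp (- x\<^sup>2 / 2))) \<le> K * \<bar>x\<bar> ^ 3"
    and \<phi>: "\<bar>\<phi>\<bar> < 1" and A: "0 \<le> A" and B: "0 \<le> B" and k: "k > 0"
    and aA: "\<And>t. t \<in> {1..n} \<Longrightarrow> (a t)\<^sup>2 \<le> A / (msq \<phi> * k)" and aB: "(\<Sum>t=1..n. (a t)\<^sup>2) \<le> B / msq \<phi>"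
  shows "cmod ((\<integral>\<omega>. iexp (\<Sum>t=1..n. a t * inno \<phi> t \<omega>) \<partial>M) - complex_of_real (exp (- (msq \<phi> * (\<Sum>t=1..n. (a t)\<^sup>2)) / 2)))
    \<le> K * B * sqrt (A * (msq \<phi> ^ 8 / k)) + (sqrt (4 * A * B / \<alpha>\<^sup>2 * (msq \<phi> ^ 8 / k)) + A / (2 * \<alpha>\<^sup>2) * (msq \<phi> ^ 8 / k)) / 2"
proof -
  interpret R: real_distribution "distr M borel (\<epsilon> 1)" by (rule real_distribution_distr) (rule measurable_\<epsilon>, simp)
  let ?c = "char (distr M borel (\<epsilon> 1))" and ?L = "msq \<phi>" and ?m = "\<lambda>t. \<integral>\<omega>. (sig \<phi> t \<omega>)\<^sup>2 \<partial>M"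
  have L1: "1 \<le> ?L" by (rule msq_ge_1[OF \<phi>])
  have Lp: "?L ^ i \<le> ?L ^ j" if "i \<le> j" for i j using L1 that by (rule power_increasing[rotated])
  define w where "w t = (a t)\<^sup>2" for t
  define Pr where "Pr \<omega> = (\<Prod>t=1..n. ?c (a t * sig \<phi> t \<omega>))" for \<omega>
  define Q where "Q \<omega> = (\<Sum>t=1..n. w t * (sig \<phi> t \<omega>)\<^sup>2)" for \<omega>
  define q where "q = ?L * (\<Sum>t=1..n. w t)"
  define Y where "Y \<omega> = (\<Sum>t=1..n. w t * ((sig \<phi> t \<omega>)\<^sup>2 - ?m t))" for \<omega>
  have [measurable]: "Pr \<in> borel_measurable M"
    unfolding Pr_def[abs_def] by (intro borel_measurable_prod measurable_compose[OF _ R.char_measurable]) measurable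
  have [measurable]: "Q \<in> borel_measurable M" "Y \<in> borel_measurable M" unfolding Q_def[abs_def] Y_def[abs_def] by measurable
  have w0: "0 \<le> w t" for t by (simp add: w_def)
  have Q0: "0 \<le> Q \<omega>" for \<omega> unfolding Q_def by (intro sum_nonneg mult_nonneg_nonneg w0) simp
  have q0: "0 \<le> q" unfolding q_def using L1 by (intro mult_nonneg_nonneg sum_nonneg w0) auto
  have iS: "integrable M (\<lambda>\<omega>. (sig \<phi> t \<omega>)\<^sup>2)" for t by (rule expectation_sig_sq(1)[OF \<phi>])
  note i3 = expectation_sig_cube(1)[OF \<phi>]
  have wA: "w t \<le> A / (?L * k)" if "t \<in> {1..n}" for t using aA[OF that] by (simp add: w_def)
  have iY2: "integrable M (\<lambda>\<omega>. (Y \<omega>)\<^sup>2)" and Y2: "(\<integral>\<omega>. (Y \<omega>)\<^sup>2 \<partial>M) \<le> 4 * ?L ^ 8 / \<alpha>\<^sup>2 * (A / (?L * k)) * (\<Sum>t=1..n. w t)"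
    unfolding Y_def by (rule variance_weighted_sig_sq[OF \<phi> w0 wA]; assumption)+
  have iY: "integrable M Y" by (rule expectation_abs_le_sqrt(1)[OF _ iY2]) simp
  \<comment> \<open>conditionally on the volatilities: a product of characteristic functions against a Gaussian one of the same variance\<close>
  have Pr1: "cmod (Pr \<omega> - complex_of_real (exp (- Q \<omega> / 2))) \<le> (\<Sum>t=1..n. K * (sqrt (A / (?L * k)) * w t) * sig \<phi> t \<omega> ^ 3)" for \<omega>
  proof -
    have eQ: "complex_of_real (exp (- Q \<omega> / 2)) = (\<Prod>t=1..n. complex_of_real (exp (- (a t * sig \<phi> t \<omega>)\<^sup>2 / 2)))"
      unfolding Q_def w_def of_real_prod[symmetric] by (simp add: exp_sum[symmetric] sum_negf sum_divide_distrib power_mult_distrib)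
    have "cmod (Pr \<omega> - complex_of_real (exp (- Q \<omega> / 2)))
       \<le> (\<Sum>t=1..n. cmod (?c (a t * sig \<phi> t \<omega>) - complex_of_real (exp (- (a t * sig \<phi> t \<omega>)\<^sup>2 / 2))))"
      unfolding Pr_def eQ by (rule norm_prod_diff) (rule R.cmod_char_le_1, simp)
    also have "\<dots> \<le> (\<Sum>t=1..n. K * (sqrt (A / (?L * k)) * w t) * sig \<phi> t \<omega> ^ 3)"
    proof (rule sum_mono)
      fix t assume t: "t \<in> {1..n}"
      have "\<bar>a t\<bar> \<le> sqrt (A / (?L * k))" using aA[OF t] by (simp add: real_le_rsqrt)
      then have "\<bar>a t\<bar> * w t \<le> sqrt (A / (?L * k)) * w t" by (intro mult_right_mono w0)
      moreover have "\<bar>a t * sig \<phi> t \<omega>\<bar> ^ 3 = (\<bar>a t\<bar> * w t) * sig \<phi> t \<omega> ^ 3"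
        by (simp add: abs_mult power_mult_distrib w_def abs_cube)
      ultimately have "K * \<bar>a t * sig \<phi> t \<omega>\<bar> ^ 3 \<le> K * ((sqrt (A / (?L * k)) * w t) * sig \<phi> t \<omega> ^ 3)"
        using K(1) by (intro mult_left_mono) (auto intro!: mult_right_mono)
      then show "cmod (?c (a t * sig \<phi> t \<omega>) - complex_of_real (exp (- (a t * sig \<phi> t \<omega>)\<^sup>2 / 2))) \<le> K * (sqrt (A / (?L * k)) * w t) * sig \<phi> t \<omega> ^ 3"
        using K(2)[of "a t * sig \<phi> t \<omega>"] by (simp add: mult.assoc)
    qed
    finally show ?thesis .
  qed
  have iPr: "integrable M Pr"
  proof (rule integrable_const_bound[of _ 1])
    have "cmod (Pr \<omega>) \<le> 1" for \<omega>
      unfolding Pr_def prod_norm[symmetric] by (rule prod_le_1) (simp add: R.cmod_char_le_1 del: One_nat_def)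
    then show "AE \<omega> in M. cmod (Pr \<omega>) \<le> 1" by simp
  qed simp
  have iEx: "integrable M (\<lambda>\<omega>. complex_of_real (exp (- Q \<omega> / 2)))"
    by (rule integrable_const_bound[of _ 1]) (auto simp: Q0)
  have T1: "cmod ((\<integral>\<omega>. Pr \<omega> \<partial>M) - (\<integral>\<omega>. complex_of_real (exp (- Q \<omega> / 2)) \<partial>M)) \<le> K * B * sqrt (A * (?L ^ 8 / k))"
  proof -
    have "cmod ((\<integral>\<omega>. Pr \<omega> \<partial>M) - (\<integral>\<omega>. complex_of_real (exp (- Q \<omega> / 2)) \<partial>M)) = cmod (\<integral>\<omega>. Pr \<omega> - complex_of_real (exp (- Q \<omega> / 2)) \<partial>M)"
      using iPr iEx by simp
    also have "\<dots> \<le> (\<integral>\<omega>. cmod (Pr \<omega> - complex_of_real (exp (- Q \<omega> / 2))) \<partial>M)" by (rule integral_norm_bound)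
    also have "\<dots> \<le> (\<integral>\<omega>. (\<Sum>t=1..n. K * (sqrt (A / (?L * k)) * w t) * sig \<phi> t \<omega> ^ 3) \<partial>M)"
      using iPr iEx Pr1 i3 by (intro integral_mono) auto
    also have "\<dots> = (\<Sum>t=1..n. K * (sqrt (A / (?L * k)) * w t) * (\<integral>\<omega>. sig \<phi> t \<omega> ^ 3 \<partial>M))"
      using i3 by (simp add: Bochner_Integration.integral_sum)
    also have "\<dots> \<le> (\<Sum>t=1..n. K * (sqrt (A / (?L * k)) * w t) * ?L ^ 4)"
      using K(1) w0 A L1 k by (intro sum_mono mult_left_mono expectation_sig_cube(2)[OF \<phi>] mult_nonneg_nonneg) auto
    also have "\<dots> = K * sqrt (A / (?L * k)) * ?L ^ 4 * (\<Sum>t=1..n. w t)"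
      unfolding sum_distrib_left by (intro sum.cong) simp_all
    also have "\<dots> \<le> K * sqrt (A / k) * ?L ^ 4 * B"
    proof (intro mult_mono)
      show "sqrt (A / (?L * k)) \<le> sqrt (A / k)"
        using A k L1 by (intro real_sqrt_le_mono divide_left_mono) (auto simp: mult_le_cancel_right1)
      have "B / ?L \<le> B" using B L1 by (simp add: divide_le_eq mult_le_cancel_left1)
      then show "(\<Sum>t=1..n. w t) \<le> B" using aB unfolding w_def by linarith
    qed (use K(1) A k L1 w0 in \<open>auto intro!: sum_nonneg mult_nonneg_nonneg\<close>)
    also have "\<dots> = K * B * sqrt (A * (?L ^ 8 / k))"
    proof -
      have eq: "A * (?L ^ 8 / k) = (A / k) * (?L ^ 4)\<^sup>2" by (simp flip: power_mult)
      have "sqrt (A * (?L ^ 8 / k)) = sqrt (A / k) * ?L ^ 4"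
        unfolding eq real_sqrt_mult real_sqrt_abs using L1 by simp
      then show ?thesis by simp
    qed
    finally show ?thesis .
  qed
  \<comment> \<open>the conditional variance \<open>Q\<close> differs from \<open>q\<close> by a centred fluctuation \<open>Y\<close> and a bias \<open>D\<close>\<close>
  have T2: "(\<integral>\<omega>. \<bar>Y \<omega>\<bar> \<partial>M) \<le> sqrt (4 * A * B / \<alpha>\<^sup>2 * (?L ^ 8 / k))"
  proof (rule order_trans[OF expectation_abs_le_sqrt(2)[OF _ iY2]])
    have "4 * ?L ^ 8 / \<alpha>\<^sup>2 * (A / (?L * k)) * (\<Sum>t=1..n. w t) \<le> 4 * ?L ^ 8 / \<alpha>\<^sup>2 * (A / k) * B"
    proof (intro mult_mono)
      show "A / (?L * k) \<le> A / k" using A k L1 by (intro divide_left_mono) (auto simp: mult_le_cancel_right1)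
      have "B / ?L \<le> B" using B L1 by (simp add: divide_le_eq mult_le_cancel_left1)
      then show "(\<Sum>t=1..n. w t) \<le> B" using aB unfolding w_def by linarith
    qed (use A k L1 w0 in \<open>auto intro!: sum_nonneg mult_nonneg_nonneg\<close>)
    also have "\<dots> = 4 * A * B / \<alpha>\<^sup>2 * (?L ^ 8 / k)" by simp
    finally show "sqrt (\<integral>\<omega>. (Y \<omega>)\<^sup>2 \<partial>M) \<le> sqrt (4 * A * B / \<alpha>\<^sup>2 * (?L ^ 8 / k))" using Y2 by (intro real_sqrt_le_mono) linarith
  qed simp
  define D where "D = (\<Sum>t=1..n. w t * (?L - ?m t))"
  have D0: "0 \<le> D" unfolding D_def using expectation_sig_sq(3)[OF \<phi>] by (intro sum_nonneg mult_nonneg_nonneg w0) simp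
  have D1: "D \<le> A / (2 * \<alpha>\<^sup>2) * (?L ^ 8 / k)"
  proof -
    have "D \<le> (\<Sum>t=1..n. (A / (?L * k)) * (?L * lvar \<phi> * (\<phi>\<^sup>2) ^ t / 2))"
      unfolding D_def
    proof (intro sum_mono mult_mono)
      fix t assume "t \<in> {1..n}" then show "w t \<le> A / (?L * k)" unfolding w_def by (rule aA)
      show "?L - ?m t \<le> ?L * lvar \<phi> * (\<phi>\<^sup>2) ^ t / 2" by (rule expectation_sig_sq(4)[OF \<phi>])
    qed (use A k L1 expectation_sig_sq(3)[OF \<phi>] in auto)
    also have "\<dots> = A * lvar \<phi> / (2 * k) * (\<Sum>t=1..n. (\<phi>\<^sup>2) ^ t)"
      unfolding sum_distrib_left using L1 by (intro sum.cong) simp_all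
    also have "\<dots> \<le> A * lvar \<phi> / (2 * k) * (1 / (1 - \<phi>\<^sup>2))"
      using \<phi> A k lvar_nonneg[OF \<phi>] by (intro mult_left_mono sum_distinct_powers_le) (auto simp: abs_square_less_1)
    also have "\<dots> = A / (2 * \<alpha>\<^sup>2) * (lvar \<phi> ^ 2 / k)" using \<alpha>_pos by (simp add: lvar_def power2_eq_square)
    also have "\<dots> \<le> A / (2 * \<alpha>\<^sup>2) * (?L ^ 8 / k)"
    proof (intro mult_left_mono divide_right_mono)
      have "lvar \<phi> ^ 2 \<le> (?L ^ 2) ^ 2" by (intro power_mono lvar_le_msq lvar_nonneg[OF \<phi>])
      also have "\<dots> = ?L ^ 4" by (simp flip: power_mult)
      also have "\<dots> \<le> ?L ^ 8" by (rule Lp) simp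
      finally show "lvar \<phi> ^ 2 \<le> ?L ^ 8" .
    qed (use A k in auto)
    finally show ?thesis .
  qed
  have QY: "Q \<omega> - q = Y \<omega> - D" for \<omega>
    unfolding Q_def q_def Y_def D_def by (simp add: sum_subtractf sum_distrib_left right_diff_distrib mult.commute)
  have T3: "cmod ((\<integral>\<omega>. complex_of_real (exp (- Q \<omega> / 2)) \<partial>M) - complex_of_real (exp (- q / 2)))
      \<le> (sqrt (4 * A * B / \<alpha>\<^sup>2 * (?L ^ 8 / k)) + A / (2 * \<alpha>\<^sup>2) * (?L ^ 8 / k)) / 2"
  proof -
    have "cmod ((\<integral>\<omega>. complex_of_real (exp (- Q \<omega> / 2)) \<partial>M) - complex_of_real (exp (- q / 2)))
        = cmod (\<integral>\<omega>. complex_of_real (exp (- Q \<omega> / 2)) - complex_of_real (exp (- q / 2)) \<partial>M)"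
      using iEx by (subst Bochner_Integration.integral_diff) (auto simp: prob_space)
    also have "\<dots> \<le> (\<integral>\<omega>. cmod (complex_of_real (exp (- Q \<omega> / 2)) - complex_of_real (exp (- q / 2))) \<partial>M)" by (rule integral_norm_bound)
    also have "\<dots> \<le> (\<integral>\<omega>. (\<bar>Y \<omega>\<bar> + D) / 2 \<partial>M)"
    proof (rule integral_mono)
      fix \<omega>
      have "\<bar>exp (- (Q \<omega> / 2)) - exp (- (q / 2))\<bar> \<le> \<bar>Q \<omega> / 2 - q / 2\<bar>"
        using Q0[of \<omega>] q0 by (intro abs_exp_neg_diff_le) auto
      also have "Q \<omega> / 2 - q / 2 = (Y \<omega> - D) / 2" using QY[of \<omega>] by (simp add: diff_divide_distrib[symmetric])
      also have "\<bar>(Y \<omega> - D) / 2\<bar> \<le> (\<bar>Y \<omega>\<bar> + D) / 2"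
        using abs_triangle_ineq4[of "Y \<omega>" D] D0 by (simp add: abs_divide)
      finally show "cmod (complex_of_real (exp (- Q \<omega> / 2)) - complex_of_real (exp (- q / 2))) \<le> (\<bar>Y \<omega>\<bar> + D) / 2"
        by (simp flip: of_real_diff)
    qed (use iEx iY in auto)
    also have "\<dots> = ((\<integral>\<omega>. \<bar>Y \<omega>\<bar> \<partial>M) + D) / 2" using iY by (simp add: prob_space)
    also have "\<dots> \<le> (sqrt (4 * A * B / \<alpha>\<^sup>2 * (?L ^ 8 / k)) + A / (2 * \<alpha>\<^sup>2) * (?L ^ 8 / k)) / 2"
      by (intro divide_right_mono add_mono T2 D1) simp
    finally show ?thesis .
  qed
  have "cmod ((\<integral>\<omega>. Pr \<omega> \<partial>M) - complex_of_real (exp (- q / 2))) \<le>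
     cmod ((\<integral>\<omega>. Pr \<omega> \<partial>M) - (\<integral>\<omega>. complex_of_real (exp (- Q \<omega> / 2)) \<partial>M)) + cmod ((\<integral>\<omega>. complex_of_real (exp (- Q \<omega> / 2)) \<partial>M) - complex_of_real (exp (- q / 2)))"
    by (rule order_trans[OF _ norm_triangle_ineq]) simp
  also have "\<dots> \<le> K * B * sqrt (A * (?L ^ 8 / k)) + (sqrt (4 * A * B / \<alpha>\<^sup>2 * (?L ^ 8 / k)) + A / (2 * \<alpha>\<^sup>2) * (?L ^ 8 / k)) / 2"
    by (rule add_mono[OF T1 T3])
  finally show ?thesis
    unfolding char_inno_linear Pr_def q_def w_def .
qed

end

section \<open>Explosive sums\<close>

text \<open>Telescoping geometric sum. The factor $\rho^2-1$ is kept on the left since it equals $2c/k$ to first order.\<close>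

lemma power_gap_sum:
  fixes g \<rho> :: real
  assumes "g * \<rho> = 1" "s \<le> m"
  shows "(\<rho>\<^sup>2 - 1) * (\<Sum>j=Suc s..m. g ^ (2 * j)) = g ^ (2 * s) - g ^ (2 * m)"
  using assms(2)
proof (induction m rule: dec_induct)
  case (step m)
  have "\<rho>\<^sup>2 * g ^ (2 * Suc m) = (g * \<rho>)\<^sup>2 * g ^ (2 * m)" by (simp add: power2_eq_square)
  then have a: "\<rho>\<^sup>2 * g ^ (2 * Suc m) = g ^ (2 * m)" using assms(1) by simp
  have "(\<Sum>j=Suc s..Suc m. g ^ (2 * j)) = (\<Sum>j=Suc s..m. g ^ (2 * j)) + g ^ (2 * Suc m)" using step.hyps by simp
  then have "(\<rho>\<^sup>2 - 1) * (\<Sum>j=Suc s..Suc m. g ^ (2 * j)) = (g ^ (2 * s) - g ^ (2 * m)) + (\<rho>\<^sup>2 * g ^ (2 * Suc m) - g ^ (2 * Suc m))"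
    by (simp only: distrib_left step.IH left_diff_distrib[of _ _ "g ^ (2 * Suc m)"] mult_1_left)
  then show ?case unfolding a by simp
qed simp

lemma sum_reflect: "(\<Sum>t=1..N. f (N + 1 - t)) = (\<Sum>t=1..N. f t)" for N :: nat
  by (rule sum.reindex_bij_witness[of _ "\<lambda>t. N + 1 - t" "\<lambda>t. N + 1 - t"]) auto

text \<open>Everything follows from $g^N y_{t-1} = g^{N+1-t} (S - D_t)$: the value just before time $t$ is the final value, discounted,
  minus the part \<open>D\<close> that is still to come.\<close>

lemma explosive_sums_decomposition:
  fixes g z :: real and u y D :: "nat \<Rightarrow> real" and S :: real
  assumes g: "g \<noteq> 0"
    and y: "\<And>t. y t = (z + (\<Sum>j=1..t. g ^ j * u j)) / g ^ t"
    and D: "\<And>t. D t = (\<Sum>j=t..N. g ^ j * u j)"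
    and S: "S = z + (\<Sum>j=1..N. g ^ j * u j)"
  shows "g ^ N * (\<Sum>t=1..N. y (t - 1) * u t) = S * (\<Sum>t=1..N. g ^ (N + 1 - t) * u t)
      - g ^ (N + 1) * (\<Sum>t=1..N. (u t)\<^sup>2)
      - (\<Sum>(t, j)\<in>(SIGMA t:{1..N}. {Suc t..N}). g ^ (N + 1 + (j - t)) * (u t * u j))"
    and "g ^ (2 * N) * (\<Sum>t=1..N. (y (t - 1))\<^sup>2) = S\<^sup>2 * (\<Sum>t=1..N. g ^ (2 * (N + 1 - t)))
      - 2 * S * (\<Sum>t=1..N. g ^ (2 * (N + 1 - t)) * D t) + (\<Sum>t=1..N. g ^ (2 * (N + 1 - t)) * (D t)\<^sup>2)"
proof -
  have key: "g ^ N * y (t - 1) = g ^ (N + 1 - t) * (S - D t)" if t: "t \<in> {1..N}" for t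
  proof -
    have "{1..N} = {1..t - 1} \<union> {t..N}" "{1..t - 1} \<inter> {t..N} = {}" using t by auto
    then have "(\<Sum>j=1..N. g ^ j * u j) = (\<Sum>j=1..t - 1. g ^ j * u j) + D t"
      unfolding D by (metis finite_atLeastAtMost sum.union_disjoint)
    then have "y (t - 1) = (S - D t) / g ^ (t - 1)" by (simp add: y S)
    moreover have "g ^ N = g ^ (N + 1 - t) * g ^ (t - 1)" using t by (simp flip: power_add)
    ultimately show ?thesis using g by simp
  qed
  have "g ^ N * (\<Sum>t=1..N. y (t - 1) * u t) = (\<Sum>t=1..N. S * (g ^ (N + 1 - t) * u t) - g ^ (N + 1 - t) * u t * D t)"
    unfolding sum_distrib_left
  proof (rule sum.cong[OF refl])
    fix t assume t: "t \<in> {1..N}"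
    have "g ^ N * (y (t - 1) * u t) = (g ^ N * y (t - 1)) * u t" by simp
    then show "g ^ N * (y (t - 1) * u t) = S * (g ^ (N + 1 - t) * u t) - g ^ (N + 1 - t) * u t * D t"
      unfolding key[OF t] by (simp add: algebra_simps)
  qed
  also have "\<dots> = S * (\<Sum>t=1..N. g ^ (N + 1 - t) * u t) - (\<Sum>t=1..N. g ^ (N + 1 - t) * u t * D t)"
    by (simp add: sum_subtractf sum_distrib_left)
  also have "(\<Sum>t=1..N. g ^ (N + 1 - t) * u t * D t)
      = (\<Sum>t=1..N. g ^ (N + 1) * (u t)\<^sup>2 + (\<Sum>j=Suc t..N. g ^ (N + 1 + (j - t)) * (u t * u j)))"
  proof (rule sum.cong[OF refl])
    fix t assume t: "t \<in> {1..N}"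
    have "D t = g ^ t * u t + (\<Sum>j=Suc t..N. g ^ j * u j)"
      unfolding D using t by (subst sum.atLeast_Suc_atMost) auto
    moreover have "g ^ (N + 1 - t) * u t * (g ^ t * u t) = g ^ (N + 1) * (u t)\<^sup>2"
    proof -
      have "g ^ (N + 1) = g ^ (N + 1 - t) * g ^ t" using t by (simp flip: power_add)
      then show ?thesis by (simp add: power2_eq_square)
    qed
    moreover have "g ^ (N + 1 - t) * u t * (\<Sum>j=Suc t..N. g ^ j * u j) = (\<Sum>j=Suc t..N. g ^ (N + 1 + (j - t)) * (u t * u j))"
      unfolding sum_distrib_left
    proof (rule sum.cong[OF refl])
      fix j assume j: "j \<in> {Suc t..N}"
      then have "N + 1 + (j - t) = (N + 1 - t) + j" using t by auto
      then have "g ^ (N + 1 + (j - t)) = g ^ (N + 1 - t) * g ^ j" by (simp only: power_add)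
      then show "g ^ (N + 1 - t) * u t * (g ^ j * u j) = g ^ (N + 1 + (j - t)) * (u t * u j)" by simp
    qed
    ultimately show "g ^ (N + 1 - t) * u t * D t = g ^ (N + 1) * (u t)\<^sup>2 + (\<Sum>j=Suc t..N. g ^ (N + 1 + (j - t)) * (u t * u j))"
      by (simp only: distrib_left)
  qed
  also have "\<dots> = g ^ (N + 1) * (\<Sum>t=1..N. (u t)\<^sup>2)
      + (\<Sum>(t, j)\<in>(SIGMA t:{1..N}. {Suc t..N}). g ^ (N + 1 + (j - t)) * (u t * u j))"
    unfolding sum.distrib sum_distrib_left[symmetric] by (subst sum.Sigma) simp_all
  finally show "g ^ N * (\<Sum>t=1..N. y (t - 1) * u t) = S * (\<Sum>t=1..N. g ^ (N + 1 - t) * u t)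
      - g ^ (N + 1) * (\<Sum>t=1..N. (u t)\<^sup>2)
      - (\<Sum>(t, j)\<in>(SIGMA t:{1..N}. {Suc t..N}). g ^ (N + 1 + (j - t)) * (u t * u j))"
    by simp
  have "g ^ (2 * N) * (\<Sum>t=1..N. (y (t - 1))\<^sup>2) = (\<Sum>t=1..N. S\<^sup>2 * g ^ (2 * (N + 1 - t)) - 2 * S * (g ^ (2 * (N + 1 - t)) * D t) + g ^ (2 * (N + 1 - t)) * (D t)\<^sup>2)"
    unfolding sum_distrib_left
  proof (rule sum.cong[OF refl])
    fix t assume t: "t \<in> {1..N}"
    have "g ^ (2 * N) * (y (t - 1))\<^sup>2 = (g ^ N * y (t - 1))\<^sup>2" by (simp add: power_mult_distrib power_even_eq)
    also have "\<dots> = g ^ (2 * (N + 1 - t)) * (S - D t)\<^sup>2" unfolding key[OF t] by (simp only: power_mult_distrib power_even_eq)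
    also have "\<dots> = S\<^sup>2 * g ^ (2 * (N + 1 - t)) - 2 * S * (g ^ (2 * (N + 1 - t)) * D t) + g ^ (2 * (N + 1 - t)) * (D t)\<^sup>2"
      by (simp add: power2_eq_square algebra_simps)
    finally show "g ^ (2 * N) * (y (t - 1))\<^sup>2 = S\<^sup>2 * g ^ (2 * (N + 1 - t)) - 2 * S * (g ^ (2 * (N + 1 - t)) * D t) + g ^ (2 * (N + 1 - t)) * (D t)\<^sup>2" .
  qed
  then show "g ^ (2 * N) * (\<Sum>t=1..N. (y (t - 1))\<^sup>2) = S\<^sup>2 * (\<Sum>t=1..N. g ^ (2 * (N + 1 - t)))
      - 2 * S * (\<Sum>t=1..N. g ^ (2 * (N + 1 - t)) * D t) + (\<Sum>t=1..N. g ^ (2 * (N + 1 - t)) * (D t)\<^sup>2)"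
    by (simp add: sum.distrib sum_subtractf sum_distrib_left)
qed

lemma weighted_sum_square_le:
  fixes h d :: "'i \<Rightarrow> real"
  assumes "\<And>i. i \<in> I \<Longrightarrow> 0 \<le> h i"
  shows "(\<Sum>i\<in>I. h i * d i)\<^sup>2 \<le> (\<Sum>i\<in>I. h i) * (\<Sum>i\<in>I. h i * (d i)\<^sup>2)"
proof -
  have "(\<Sum>i\<in>I. h i * d i)\<^sup>2 = (\<Sum>i\<in>I. sqrt (h i) * (sqrt (h i) * d i))\<^sup>2"
    using assms by (intro arg_cong[of _ _ "\<lambda>x. x\<^sup>2"] sum.cong) auto
  also have "\<dots> \<le> (\<Sum>i\<in>I. (sqrt (h i))\<^sup>2) * (\<Sum>i\<in>I. (sqrt (h i) * d i)\<^sup>2)" by (rule Cauchy_Schwarz_ineq_sum)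
  also have "\<dots> = (\<Sum>i\<in>I. h i) * (\<Sum>i\<in>I. h i * (d i)\<^sup>2)"
    using assms by (simp add: power_mult_distrib)
  finally show ?thesis .
qed

text \<open>$(1+c/k)^{-N} \le e^{-cN/(2k)}$ once $k \ge c$, and $N/k$ tends to infinity.\<close>

lemma explosive_decay:
  fixes c :: real and k :: "nat \<Rightarrow> real" and N :: "nat \<Rightarrow> nat"
  assumes c: "c > 0" and k: "\<And>n. k n > 0" and kt: "filterlim k at_top sequentially"
    and x: "filterlim (\<lambda>n. real (N n) / k n) at_top sequentially"
  shows "(\<lambda>n. (1 / (1 + c / k n)) ^ N n * (real (N n) / k n) ^ p) \<longlonglongrightarrow> 0"
proof -
  have "filterlim (\<lambda>n. (c / 2) * (real (N n) / k n)) at_top sequentially"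
    using c x by (intro filterlim_tendsto_pos_mult_at_top[OF tendsto_const]) auto
  from filterlim_compose[OF tendsto_power_div_exp_0[of p] this]
  have l: "(\<lambda>n. ((c / 2) * (real (N n) / k n)) ^ p / exp ((c / 2) * (real (N n) / k n)) * (2 / c) ^ p) \<longlonglongrightarrow> 0"
    by (intro tendsto_mult_left_zero)
  have "eventually (\<lambda>n. norm ((1 / (1 + c / k n)) ^ N n * (real (N n) / k n) ^ p)
      \<le> ((c / 2) * (real (N n) / k n)) ^ p / exp ((c / 2) * (real (N n) / k n)) * (2 / c) ^ p) sequentially"
    using filterlim_at_top[THEN iffD1, OF kt, rule_format, of c]
  proof eventually_elim
    case (elim n)
    let ?z = "c / k n"
    have z: "0 < ?z" "?z \<le> 1" using c k[of n] elim by auto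
    have "ln (1 / (1 + ?z)) \<le> 1 / (1 + ?z) - 1" using z by (intro ln_le_minus_one) simp
    also have "1 / (1 + ?z) - 1 \<le> - (?z / 2)"
    proof -
      have "1 / (1 + x) - 1 \<le> - (x / 2)" if "0 < x" "x \<le> 1" for x :: real
        using that mult_left_le[of x x] by (simp add: field_simps)
      then show ?thesis using z .
    qed
    finally have "exp (ln (1 / (1 + ?z))) \<le> exp (- (?z / 2))" by (simp only: exp_le_cancel_iff)
    then have "1 / (1 + ?z) \<le> exp (- (?z / 2))" using z by (subst (asm) exp_ln) auto
    then have "(1 / (1 + ?z)) ^ N n \<le> exp (- (?z / 2)) ^ N n" using z by (intro power_mono) auto
    also have "\<dots> = exp (real (N n) * - (?z / 2))" by (rule exp_of_nat_mult[symmetric])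
    also have "real (N n) * - (?z / 2) = - ((c / 2) * (real (N n) / k n))" by (simp add: mult.commute)
    finally have "(1 / (1 + ?z)) ^ N n * (real (N n) / k n) ^ p \<le> exp (- ((c / 2) * (real (N n) / k n))) * (real (N n) / k n) ^ p"
      using k[of n] by (intro mult_right_mono) auto
    also have "\<dots> = ((c / 2) * (real (N n) / k n)) ^ p / exp ((c / 2) * (real (N n) / k n)) * (2 / c) ^ p"
    proof -
      have "((c / 2) * (real (N n) / k n)) ^ p * (2 / c) ^ p = (real (N n) / k n) ^ p"
        unfolding power_mult_distrib[symmetric] using c by (intro arg_cong[of _ _ "\<lambda>x. x ^ p"]) simp
      then show ?thesis unfolding exp_minus divide_inverse[of "_ ^ p"] by (metis mult.assoc mult.commute)
    qed
    finally show ?case using z k[of n] by simp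
  qed
  then show ?thesis by (rule Lim_null_comparison[OF _ l])
qed

text \<open>The array is indexed through a sequence of positive sample sizes \<open>N\<close>; this avoids the degenerate sample of size 0, on which the
  hypotheses of the model say nothing. The rate conditions are stated for powers of the stationary mean of $\sigma_t^2$.\<close>

locale sv_array = sv_noise M \<alpha> \<epsilon> \<eta> for M :: "'a measure" and \<alpha> \<epsilon> \<eta> +
  fixes c :: real and k \<phi> :: "nat \<Rightarrow> real" and N :: "nat \<Rightarrow> nat" and y0 :: "nat \<Rightarrow> 'a \<Rightarrow> real"
  assumes c_pos: "c > 0" and k_pos: "\<And>n. k n > 0" and N_pos: "\<And>n. N n > 0"
    and \<phi>_stat: "\<And>n. \<bar>\<phi> n\<bar> < 1"
    and rate_k: "\<And>p. (\<lambda>n. msq (\<phi> n) ^ p / k n) \<longlonglongrightarrow> 0"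
    and rate_N: "\<And>p. (\<lambda>n. k n * msq (\<phi> n) ^ p / real (N n)) \<longlonglongrightarrow> 0"
    and y0_meas: "\<And>n. y0 n \<in> borel_measurable M"
    and y0_small: "small_o_prob M y0 (\<lambda>n. sqrt (k n))"
begin

abbreviation "L n \<equiv> msq (\<phi> n)"
abbreviation "u n \<equiv> inno (\<phi> n)"

definition rho :: "nat \<Rightarrow> real" where "rho n = 1 + c / k n"
definition g :: "nat \<Rightarrow> real" where "g n = 1 / rho n"
definition scale :: "nat \<Rightarrow> real" where "scale n = sqrt (L n * k n)"
definition \<kappa> :: "nat \<Rightarrow> real" where "\<kappa> n = (\<Sum>t=1..N n. g n ^ (2 * t)) / k n"

lemma rho_gt_1: "1 < rho n" using c_pos k_pos[of n] by (simp add: rho_def)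

lemma g_bounds: "0 < g n" "g n < 1" "g n * rho n = 1"
  using rho_gt_1[of n] by (simp_all add: g_def)

lemma L_ge_1: "1 \<le> L n" by (rule msq_ge_1[OF \<phi>_stat])

lemma scale_pos: "0 < scale n" "(scale n)\<^sup>2 = L n * k n"
  using L_ge_1[of n] k_pos[of n] by (simp_all add: scale_def)

lemma rho_gap: "k n * ((rho n)\<^sup>2 - 1) = 2 * c + c\<^sup>2 / k n"
  using k_pos[of n] by (simp add: rho_def power2_eq_square field_simps)

lemma gap_bound: "0 < (rho n)\<^sup>2 - 1" "1 / ((rho n)\<^sup>2 - 1) \<le> k n / (2 * c)"
proof -
  show p: "0 < (rho n)\<^sup>2 - 1" using rho_gt_1[of n] by simp
  have "2 * c \<le> k n * ((rho n)\<^sup>2 - 1)" unfolding rho_gap using k_pos[of n] by simp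
  then show "1 / ((rho n)\<^sup>2 - 1) \<le> k n / (2 * c)" using p c_pos by (simp add: field_simps)
qed

lemma g_power_tail: "s \<le> m \<Longrightarrow> (\<Sum>j=Suc s..m. g n ^ (2 * j)) \<le> g n ^ (2 * s) * (k n / (2 * c))"
proof -
  assume s: "s \<le> m"
  have "(\<Sum>j=Suc s..m. g n ^ (2 * j)) = (g n ^ (2 * s) - g n ^ (2 * m)) * (1 / ((rho n)\<^sup>2 - 1))"
    using power_gap_sum[OF g_bounds(3) s, of n] gap_bound(1)[of n] by (simp add: field_simps)
  also have "\<dots> \<le> g n ^ (2 * s) * (k n / (2 * c))"
    using gap_bound[of n] g_bounds[of n] by (intro mult_mono) auto
  finally show ?thesis .
qed

lemma \<kappa>_bounds: "0 \<le> \<kappa> n" "\<kappa> n \<le> 1 / (2 * c)"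
proof -
  show "0 \<le> \<kappa> n" unfolding \<kappa>_def using g_bounds(1)[of n] k_pos[of n] by (intro divide_nonneg_pos sum_nonneg) auto
  have "(\<Sum>t=1..N n. g n ^ (2 * t)) \<le> k n / (2 * c)" using g_power_tail[of 0 "N n" n] by simp
  then show "\<kappa> n \<le> 1 / (2 * c)" unfolding \<kappa>_def using k_pos[of n] c_pos by (simp add: field_simps)
qed

lemma k_at_top: "filterlim k at_top sequentially"
proof -
  have "(\<lambda>n. inverse (k n)) \<longlonglongrightarrow> 0" using rate_k[of 0] by (simp add: divide_inverse)
  from filterlim_inverse_at_top[OF this] show ?thesis using k_pos by simp
qed

lemma N_over_k_at_top: "filterlim (\<lambda>n. real (N n) / k n) at_top sequentially"
proof -
  have "(\<lambda>n. inverse (real (N n) / k n)) \<longlonglongrightarrow> 0" using rate_N[of 0] by simp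
  from filterlim_inverse_at_top[OF this] show ?thesis using k_pos N_pos by simp
qed

lemma g_decay: "(\<lambda>n. g n ^ N n * (real (N n) / k n) ^ p) \<longlonglongrightarrow> 0"
  using explosive_decay[OF c_pos k_pos k_at_top N_over_k_at_top] unfolding g_def rho_def .

lemma \<kappa>_tendsto: "\<kappa> \<longlonglongrightarrow> 1 / (2 * c)"
proof -
  have "\<kappa> = (\<lambda>n. (1 - (g n ^ N n)\<^sup>2) / (2 * c + c\<^sup>2 * (1 / k n)))"
  proof (rule ext)
    fix n
    show "\<kappa> n = (1 - (g n ^ N n)\<^sup>2) / (2 * c + c\<^sup>2 * (1 / k n))"
  proof -
    have "((rho n)\<^sup>2 - 1) * (\<Sum>t=1..N n. g n ^ (2 * t)) = 1 - (g n ^ N n)\<^sup>2"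
      using power_gap_sum[OF g_bounds(3)[of n], of 0 "N n"] by (simp add: power_even_eq)
    then have "\<kappa> n * (k n * ((rho n)\<^sup>2 - 1)) = 1 - (g n ^ N n)\<^sup>2"
      using k_pos[of n] unfolding \<kappa>_def by (simp add: mult.commute)
    then have "\<kappa> n * (2 * c + c\<^sup>2 * (1 / k n)) = 1 - (g n ^ N n)\<^sup>2" unfolding rho_gap by simp
    moreover have "0 < 2 * c + c\<^sup>2 * (1 / k n)" using c_pos k_pos[of n] by (intro add_pos_nonneg) auto
    ultimately show ?thesis by (simp add: eq_divide_eq)
  qed
  qed
  moreover have "(\<lambda>n. (1 - (g n ^ N n)\<^sup>2) / (2 * c + c\<^sup>2 * (1 / k n))) \<longlonglongrightarrow> (1 - 0\<^sup>2) / (2 * c + c\<^sup>2 * 0)"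
    using g_decay[of 0] rate_k[of 0] c_pos by (intro tendsto_intros) auto
  ultimately show ?thesis by simp
qed

definition W :: "nat \<Rightarrow> 'a \<Rightarrow> real" where "W n \<omega> = (\<Sum>t=1..N n. g n ^ t * u n t \<omega>) / scale n"
definition V :: "nat \<Rightarrow> 'a \<Rightarrow> real" where "V n \<omega> = (\<Sum>t=1..N n. g n ^ (N n + 1 - t) * u n t \<omega>) / scale n"
definition tail :: "nat \<Rightarrow> nat \<Rightarrow> 'a \<Rightarrow> real" where "tail n t \<omega> = (\<Sum>j=t..N n. g n ^ j * u n j \<omega>) / scale n"

lemma measurable_sum_inno: "(\<And>t. t \<in> T \<Longrightarrow> 1 \<le> t) \<Longrightarrow> (\<lambda>\<omega>. \<Sum>t\<in>T. b t * u n t \<omega>) \<in> borel_measurable M"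
  by (intro borel_measurable_sum borel_measurable_times borel_measurable_const measurable_inno) auto

lemma measurable_WV: "W n \<in> borel_measurable M" "V n \<in> borel_measurable M"
  unfolding W_def[abs_def] V_def[abs_def] by (intro borel_measurable_divide borel_measurable_const measurable_sum_inno; simp)+

lemma N_g_over_k: "(\<lambda>n. real (N n) * g n ^ (N n + 1) / k n) \<longlonglongrightarrow> 0"
proof (rule Lim_null_comparison[OF always_eventually[OF allI] g_decay[of 1]])
  fix n
  have "g n * (g n ^ N n * (real (N n) / k n)) \<le> 1 * (g n ^ N n * (real (N n) / k n))"
    using g_bounds[of n] k_pos[of n] by (intro mult_right_mono) auto
  then show "norm (real (N n) * g n ^ (N n + 1) / k n) \<le> g n ^ N n * (real (N n) / k n) ^ 1"
    using g_bounds[of n] k_pos[of n] by (simp add: mult_ac)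
qed

text \<open>The weights of the combination $sW + rV$ are of order $(\ell k)^{-1/2}$, so the approximation error is a
  power of \<open>msq\<close> over \<open>k\<close>. Their squares sum to $(s^2+r^2)\kappa/\ell$ up to the cross term, in which
  $g^t g^{N+1-t}$ does not depend on \<open>t\<close>.\<close>

lemma joint_char_WV:
  "(\<lambda>n. \<integral>\<omega>. iexp (s * W n \<omega> + r * V n \<omega>) \<partial>M) \<longlonglongrightarrow> char (normal_law 0 (1 / (2 * c))) s * char (normal_law 0 (1 / (2 * c))) r"
proof -
  obtain K where K: "K \<ge> 0" "\<And>x. cmod (char (distr M borel (\<epsilon> 1)) x - complex_of_real (exp (- x\<^sup>2 / 2))) \<le> K * \<bar>x\<bar> ^ 3"
    using char_\<epsilon>_approx by blast
  define a where "a n t = (s * g n ^ t + r * g n ^ (N n + 1 - t)) / scale n" for n t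
  define q where "q n = L n * (\<Sum>t=1..N n. (a n t)\<^sup>2)" for n
  \<comment> \<open>\<open>A\<close> bounds $\ell k$ times a squared weight, \<open>B\<close> bounds $\ell$ times the sum of the squared weights\<close>
  define A where "A = (\<bar>s\<bar> + \<bar>r\<bar>)\<^sup>2"
  define B where "B = (s\<^sup>2 + r\<^sup>2) / c"
  have lin: "s * W n \<omega> + r * V n \<omega> = (\<Sum>t=1..N n. a n t * u n t \<omega>)" for n \<omega>
    unfolding W_def V_def a_def by (simp add: sum_distrib_left sum_divide_distrib sum.distrib[symmetric] add_divide_distrib algebra_simps)
  have q_eq: "q n = s\<^sup>2 * \<kappa> n + r\<^sup>2 * \<kappa> n + 2 * s * r * (real (N n) * g n ^ (N n + 1) / k n)" for n
  proof -
    have "(a n t)\<^sup>2 = (s\<^sup>2 * g n ^ (2 * t) + r\<^sup>2 * g n ^ (2 * (N n + 1 - t)) + 2 * s * r * g n ^ (N n + 1)) / (L n * k n)" if "t \<in> {1..N n}" for t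
    proof -
      have gg: "g n ^ t * g n ^ (N n + 1 - t) = g n ^ (N n + 1)" using that by (simp flip: power_add)
      have "(s * g n ^ t + r * g n ^ (N n + 1 - t))\<^sup>2 = s\<^sup>2 * (g n ^ t)\<^sup>2 + r\<^sup>2 * (g n ^ (N n + 1 - t))\<^sup>2 + 2 * s * r * (g n ^ t * g n ^ (N n + 1 - t))"
        by (simp add: power2_eq_square algebra_simps)
      then show ?thesis unfolding a_def power_divide scale_pos gg by (simp only: power_even_eq)
    qed
    then have "(\<Sum>t=1..N n. (a n t)\<^sup>2) = (\<Sum>t=1..N n. (s\<^sup>2 * g n ^ (2 * t) + r\<^sup>2 * g n ^ (2 * (N n + 1 - t)) + 2 * s * r * g n ^ (N n + 1)) / (L n * k n))"
      by (intro sum.cong) auto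
    also have "\<dots> = (s\<^sup>2 * (\<Sum>t=1..N n. g n ^ (2 * t)) + r\<^sup>2 * (\<Sum>t=1..N n. g n ^ (2 * (N n + 1 - t))) + real (N n) * (2 * s * r * g n ^ (N n + 1))) / (L n * k n)"
      by (simp only: sum_divide_distrib[symmetric] sum.distrib sum_distrib_left[symmetric] sum_constant card_atLeastAtMost) simp
    also have "(\<Sum>t=1..N n. g n ^ (2 * (N n + 1 - t))) = (\<Sum>t=1..N n. g n ^ (2 * t))" by (rule sum_reflect)
    finally show ?thesis using L_ge_1[of n] k_pos[of n] unfolding q_def \<kappa>_def by (simp add: field_simps)
  qed
  have "q \<longlonglongrightarrow> s\<^sup>2 * (1 / (2 * c)) + r\<^sup>2 * (1 / (2 * c)) + 2 * s * r * 0"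
    unfolding q_eq[abs_def] by (intro tendsto_intros \<kappa>_tendsto N_g_over_k)
  then have ql: "(\<lambda>n. complex_of_real (exp (- q n / 2))) \<longlonglongrightarrow> complex_of_real (exp (- (s\<^sup>2 * (1 / (2 * c)) + r\<^sup>2 * (1 / (2 * c)) + 2 * s * r * 0) / 2))"
    by (intro tendsto_intros) auto
  have aA: "(a n t)\<^sup>2 \<le> A / (L n * k n)" for n t
  proof -
    have gp: "0 \<le> g n ^ j" "g n ^ j \<le> 1" for j using g_bounds[of n] by (auto intro: power_le_one)
    have "\<bar>s * g n ^ t + r * g n ^ (N n + 1 - t)\<bar> \<le> \<bar>s\<bar> * g n ^ t + \<bar>r\<bar> * g n ^ (N n + 1 - t)"
      using abs_triangle_ineq[of "s * g n ^ t" "r * g n ^ (N n + 1 - t)"] gp by (simp add: abs_mult)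
    also have "\<dots> \<le> \<bar>s\<bar> * 1 + \<bar>r\<bar> * 1" using gp by (intro add_mono mult_left_mono) auto
    finally have "\<bar>s * g n ^ t + r * g n ^ (N n + 1 - t)\<bar>\<^sup>2 \<le> A" unfolding A_def by (intro power_mono) auto
    then show ?thesis unfolding a_def power_divide scale_pos using L_ge_1[of n] k_pos[of n] by (intro divide_right_mono) auto
  qed
  have aB: "(\<Sum>t=1..N n. (a n t)\<^sup>2) \<le> B / L n" for n
  proof -
    have "(a n t)\<^sup>2 \<le> (2 * s\<^sup>2 * g n ^ (2 * t) + 2 * r\<^sup>2 * g n ^ (2 * (N n + 1 - t))) / (L n * k n)" for t
    proof -
      have "(x + y)\<^sup>2 \<le> 2 * x\<^sup>2 + 2 * y\<^sup>2" for x y :: real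
        using sum_squares_bound[of x y] by (simp add: power2_sum)
      from this[of "s * g n ^ t" "r * g n ^ (N n + 1 - t)"]
      have "(s * g n ^ t + r * g n ^ (N n + 1 - t))\<^sup>2 \<le> 2 * s\<^sup>2 * g n ^ (2 * t) + 2 * r\<^sup>2 * g n ^ (2 * (N n + 1 - t))"
        by (simp only: power_mult_distrib power_even_eq mult.assoc)
      then show ?thesis unfolding a_def power_divide scale_pos using L_ge_1[of n] k_pos[of n] by (intro divide_right_mono) auto
    qed
    then have "(\<Sum>t=1..N n. (a n t)\<^sup>2) \<le> (\<Sum>t=1..N n. (2 * s\<^sup>2 * g n ^ (2 * t) + 2 * r\<^sup>2 * g n ^ (2 * (N n + 1 - t))) / (L n * k n))"
      by (intro sum_mono)
    also have "\<dots> = (2 * s\<^sup>2 * (\<Sum>t=1..N n. g n ^ (2 * t)) + 2 * r\<^sup>2 * (\<Sum>t=1..N n. g n ^ (2 * (N n + 1 - t)))) / (L n * k n)"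
      by (simp only: sum_divide_distrib[symmetric] sum.distrib sum_distrib_left[symmetric])
    also have "(\<Sum>t=1..N n. g n ^ (2 * (N n + 1 - t))) = (\<Sum>t=1..N n. g n ^ (2 * t))" by (rule sum_reflect)
    also have "(2 * s\<^sup>2 * (\<Sum>t=1..N n. g n ^ (2 * t)) + 2 * r\<^sup>2 * (\<Sum>t=1..N n. g n ^ (2 * t))) / (L n * k n) = 2 * (s\<^sup>2 + r\<^sup>2) * \<kappa> n / L n"
      unfolding \<kappa>_def by (simp add: algebra_simps add_divide_distrib)
    also have "\<dots> \<le> 2 * (s\<^sup>2 + r\<^sup>2) * (1 / (2 * c)) / L n"
      using \<kappa>_bounds[of n] L_ge_1[of n] by (intro divide_right_mono mult_left_mono) auto
    also have "2 * (s\<^sup>2 + r\<^sup>2) * (1 / (2 * c)) = B"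
    proof -
      have "2 * x * (1 / (2 * c)) = x / c" for x by simp
      then show ?thesis unfolding B_def .
    qed
    finally show ?thesis .
  qed
  let ?b = "\<lambda>n. K * B * sqrt (A * (L n ^ 8 / k n)) + (sqrt (4 * A * B / \<alpha>\<^sup>2 * (L n ^ 8 / k n)) + A / (2 * \<alpha>\<^sup>2) * (L n ^ 8 / k n)) / 2"
  have bnd: "cmod ((\<integral>\<omega>. iexp (s * W n \<omega> + r * V n \<omega>) \<partial>M) - complex_of_real (exp (- q n / 2))) \<le> ?b n" for n
    unfolding lin q_def
    by (rule char_inno_linear_approx[OF K \<phi>_stat _ _ k_pos aA aB]) (use c_pos in \<open>auto simp: A_def B_def\<close>)
  have "?b \<longlonglongrightarrow> K * B * sqrt (A * 0) + (sqrt (4 * A * B / \<alpha>\<^sup>2 * 0) + A / (2 * \<alpha>\<^sup>2) * 0) / 2"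
    by (intro tendsto_intros rate_k) simp
  then have bl: "?b \<longlonglongrightarrow> 0" by (simp only: mult_zero_right real_sqrt_zero add_0_right div_0)
  have "(\<lambda>n. (\<integral>\<omega>. iexp (s * W n \<omega> + r * V n \<omega>) \<partial>M) - complex_of_real (exp (- q n / 2))) \<longlonglongrightarrow> 0"
    by (rule Lim_null_comparison[OF always_eventually[OF allI[OF bnd]] bl])
  from tendsto_add[OF this ql]
  have "(\<lambda>n. \<integral>\<omega>. iexp (s * W n \<omega> + r * V n \<omega>) \<partial>M) \<longlonglongrightarrow> complex_of_real (exp (- (s\<^sup>2 * (1 / (2 * c)) + r\<^sup>2 * (1 / (2 * c)) + 2 * s * r * 0) / 2))"
    by (simp only: diff_add_cancel add_0)
  moreover have "complex_of_real (exp (- (s\<^sup>2 * (1 / (2 * c)) + r\<^sup>2 * (1 / (2 * c)) + 2 * s * r * 0) / 2)) = char (normal_law 0 (1 / (2 * c))) s * char (normal_law 0 (1 / (2 * c))) r"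
  proof -
    have v: "0 < 1 / (2 * c)" using c_pos by simp
    have e: "- (s\<^sup>2 * (1 / (2 * c)) + r\<^sup>2 * (1 / (2 * c)) + 2 * s * r * 0) / 2 = - (1 / (2 * c)) * s\<^sup>2 / 2 + - (1 / (2 * c)) * r\<^sup>2 / 2"
      by (simp add: add_divide_distrib)
    show ?thesis unfolding char_normal_law[OF v] e exp_add of_real_mult ..
  qed
  ultimately show ?thesis by (simp only:)
qed

lemma weak_conv_WV:
  "weak_conv_top (\<lambda>n. distr M borel (\<lambda>\<omega>. (W n \<omega>, V n \<omega>))) (distr (normal_law 0 (1 / (2 * c)) \<Otimes>\<^sub>M normal_law 0 (1 / (2 * c))) borel (\<lambda>z. z))"
  using c_pos by (intro joint_levy_continuity prob_space_axioms real_distribution_normal_law measurable_WV joint_char_WV) auto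

end

section \<open>Remainder terms\<close>

context sv_array
begin

text \<open>The explicit solution $y_t$ of the autoregression.\<close>

definition path :: "nat \<Rightarrow> nat \<Rightarrow> 'a \<Rightarrow> real" where
  "path n t \<omega> = (y0 n \<omega> + (\<Sum>j=1..t. g n ^ j * u n j \<omega>)) / g n ^ t"

definition init :: "nat \<Rightarrow> 'a \<Rightarrow> real" where "init n \<omega> = y0 n \<omega> / scale n"

definition diag :: "nat \<Rightarrow> 'a \<Rightarrow> real" where
  "diag n \<omega> = g n ^ (N n + 1) / (L n * k n) * (\<Sum>t=1..N n. (u n t \<omega>)\<^sup>2)"

definition offdiag :: "nat \<Rightarrow> 'a \<Rightarrow> real" where
  "offdiag n \<omega> = (\<Sum>(t, j)\<in>(SIGMA t:{1..N n}. {Suc t..N n}). g n ^ (N n + 1 + (j - t)) / (L n * k n) * (u n t \<omega> * u n j \<omega>))"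

definition weight :: "nat \<Rightarrow> nat \<Rightarrow> real" where "weight n t = g n ^ (2 * (N n + 1 - t)) / k n"

definition err1 :: "nat \<Rightarrow> 'a \<Rightarrow> real" where "err1 n \<omega> = (\<Sum>t=1..N n. weight n t * tail n t \<omega>)"

definition err2 :: "nat \<Rightarrow> 'a \<Rightarrow> real" where "err2 n \<omega> = (\<Sum>t=1..N n. weight n t * (tail n t \<omega>)\<^sup>2)"

text \<open>The two coordinates of the pair in the theorem, with $\rho^{-1}$ written as \<open>g\<close>.\<close>

definition numer :: "nat \<Rightarrow> 'a \<Rightarrow> real" where
  "numer n \<omega> = g n ^ N n * (\<Sum>t=1..N n. path n (t - 1) \<omega> * u n t \<omega>) / (L n * k n)"

definition denom :: "nat \<Rightarrow> 'a \<Rightarrow> real" where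
  "denom n \<omega> = g n ^ (2 * N n) * (\<Sum>t=1..N n. (path n (t - 1) \<omega>)\<^sup>2) / (L n * (k n)\<^sup>2)"

lemma sum_weight: "(\<Sum>t=1..N n. weight n t) = \<kappa> n"
proof -
  have "(\<Sum>t=1..N n. weight n t) = (\<Sum>t=1..N n. g n ^ (2 * (N n + 1 - t))) / k n"
    unfolding weight_def by (rule sum_divide_distrib[symmetric])
  also have "(\<Sum>t=1..N n. g n ^ (2 * (N n + 1 - t))) = (\<Sum>t=1..N n. g n ^ (2 * t))" by (rule sum_reflect)
  finally show ?thesis unfolding \<kappa>_def .
qed

lemma weight_nonneg: "0 \<le> weight n t"
  unfolding weight_def using g_bounds(1)[of n] k_pos[of n] by simp

lemma numer_denom_decomposition:
  "numer n \<omega> = (init n \<omega> + W n \<omega>) * V n \<omega> - diag n \<omega> - offdiag n \<omega>"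
  "denom n \<omega> = \<kappa> n * (init n \<omega> + W n \<omega>)\<^sup>2 - 2 * (init n \<omega> + W n \<omega>) * err1 n \<omega> + err2 n \<omega>"
proof -
  let ?K = "scale n"
  have K: "?K > 0" "?K * ?K = L n * k n" using scale_pos[of n] by (simp_all add: power2_eq_square)
  have g0: "g n \<noteq> 0" using g_bounds(1)[of n] by simp
  have S: "?K * (init n \<omega> + W n \<omega>) = y0 n \<omega> + (\<Sum>j=1..N n. g n ^ j * u n j \<omega>)"
    unfolding init_def W_def using K(1) by (simp add: distrib_left)
  have D: "?K * tail n t \<omega> = (\<Sum>j=t..N n. g n ^ j * u n j \<omega>)" for t
    unfolding tail_def using K(1) by simp
  have V: "?K * V n \<omega> = (\<Sum>t=1..N n. g n ^ (N n + 1 - t) * u n t \<omega>)"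
    unfolding V_def using K(1) by simp
  note dec = explosive_sums_decomposition[where y = "\<lambda>t. path n t \<omega>" and D = "\<lambda>t. ?K * tail n t \<omega>", OF g0 path_def D S]
  have L0: "L n * k n \<noteq> 0" using L_ge_1[of n] k_pos[of n] by simp
  have off: "(\<Sum>(t, j)\<in>(SIGMA t:{1..N n}. {Suc t..N n}). g n ^ (N n + 1 + (j - t)) * (u n t \<omega> * u n j \<omega>)) = L n * k n * offdiag n \<omega>"
    unfolding offdiag_def using L0 by (simp add: sum_distrib_left case_prod_beta')
  have dg: "g n ^ (N n + 1) * (\<Sum>t=1..N n. (u n t \<omega>)\<^sup>2) = L n * k n * diag n \<omega>"
    unfolding diag_def using L0 by simp
  have "g n ^ N n * (\<Sum>t=1..N n. path n (t - 1) \<omega> * u n t \<omega>)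
     = (?K * (init n \<omega> + W n \<omega>)) * (?K * V n \<omega>) - L n * k n * diag n \<omega> - L n * k n * offdiag n \<omega>"
    unfolding dec(1) off dg V ..
  also have "\<dots> = (L n * k n) * ((init n \<omega> + W n \<omega>) * V n \<omega> - diag n \<omega> - offdiag n \<omega>)"
    unfolding K(2)[symmetric] by (simp add: algebra_simps)
  finally show "numer n \<omega> = (init n \<omega> + W n \<omega>) * V n \<omega> - diag n \<omega> - offdiag n \<omega>"
    unfolding numer_def using L0 by simp
  have w: "g n ^ (2 * (N n + 1 - t)) = k n * weight n t" for t unfolding weight_def using k_pos[of n] by simp
  have "g n ^ (2 * N n) * (\<Sum>t=1..N n. (path n (t - 1) \<omega>)\<^sup>2)
     = (?K * (init n \<omega> + W n \<omega>))\<^sup>2 * (\<Sum>t=1..N n. k n * weight n t)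
       - 2 * (?K * (init n \<omega> + W n \<omega>)) * (\<Sum>t=1..N n. k n * weight n t * (?K * tail n t \<omega>))
       + (\<Sum>t=1..N n. k n * weight n t * (?K * tail n t \<omega>)\<^sup>2)"
    unfolding dec(2) w ..
  also have "(\<Sum>t=1..N n. k n * weight n t) = k n * \<kappa> n" unfolding sum_weight[symmetric] by (rule sum_distrib_left[symmetric])
  also have "(\<Sum>t=1..N n. k n * weight n t * (?K * tail n t \<omega>)) = k n * ?K * err1 n \<omega>"
    unfolding err1_def sum_distrib_left by (intro sum.cong) simp_all
  also have "(\<Sum>t=1..N n. k n * weight n t * (?K * tail n t \<omega>)\<^sup>2) = k n * (?K * ?K) * err2 n \<omega>"
    unfolding err2_def sum_distrib_left by (intro sum.cong) (simp_all add: power2_eq_square)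
  also have "(?K * (init n \<omega> + W n \<omega>))\<^sup>2 * (k n * \<kappa> n) - 2 * (?K * (init n \<omega> + W n \<omega>)) * (k n * ?K * err1 n \<omega>) + k n * (?K * ?K) * err2 n \<omega>
     = (k n * (?K * ?K)) * (\<kappa> n * (init n \<omega> + W n \<omega>)\<^sup>2 - 2 * (init n \<omega> + W n \<omega>) * err1 n \<omega> + err2 n \<omega>)"
    by (simp add: power2_eq_square algebra_simps)
  also have "k n * (?K * ?K) = L n * (k n)\<^sup>2" unfolding K(2) by (simp add: power2_eq_square)
  finally show "denom n \<omega> = \<kappa> n * (init n \<omega> + W n \<omega>)\<^sup>2 - 2 * (init n \<omega> + W n \<omega>) * err1 n \<omega> + err2 n \<omega>"
    unfolding denom_def using L_ge_1[of n] k_pos[of n] by simp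
qed

lemma init_small: "small_o_prob M init (\<lambda>_. 1)" and measurable_init: "init n \<in> borel_measurable M"
proof -
  have m: "init n \<in> borel_measurable M" for n unfolding init_def[abs_def] using y0_meas[of n] by simp
  then show "init n \<in> borel_measurable M" .
  note [measurable] = m y0_meas
  show "small_o_prob M init (\<lambda>_. 1)"
    unfolding small_o_prob_def
  proof (intro allI impI)
    fix \<delta> :: real assume \<delta>: "\<delta> > 0"
    have bnd: "norm (measure M {\<omega> \<in> space M. \<bar>init n \<omega> / 1\<bar> > \<delta>}) \<le> measure M {\<omega> \<in> space M. \<bar>y0 n \<omega> / sqrt (k n)\<bar> > \<delta>}" for n
    proof -
      have le: "\<bar>init n \<omega>\<bar> \<le> \<bar>y0 n \<omega> / sqrt (k n)\<bar>" for \<omega>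
      proof -
        have "k n \<le> L n * k n" using L_ge_1[of n] k_pos[of n] by simp
        then have "sqrt (k n) \<le> scale n" unfolding scale_def by (rule real_sqrt_le_mono)
        then have "\<bar>y0 n \<omega>\<bar> / scale n \<le> \<bar>y0 n \<omega>\<bar> / sqrt (k n)" using k_pos[of n] scale_pos(1)[of n] by (intro divide_left_mono) auto
        then show ?thesis unfolding init_def abs_divide using scale_pos(1)[of n] k_pos[of n] by simp
      qed
      have "{\<omega> \<in> space M. \<bar>init n \<omega> / 1\<bar> > \<delta>} \<subseteq> {\<omega> \<in> space M. \<bar>y0 n \<omega> / sqrt (k n)\<bar> > \<delta>}"
        using less_le_trans[OF _ le] by auto
      then have "measure M {\<omega> \<in> space M. \<bar>init n \<omega> / 1\<bar> > \<delta>} \<le> measure M {\<omega> \<in> space M. \<bar>y0 n \<omega> / sqrt (k n)\<bar> > \<delta>}"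
        by (rule finite_measure_mono) measurable
      then show ?thesis by simp
    qed
    show "(\<lambda>n. measure M {\<omega> \<in> space M. \<bar>init n \<omega> / 1\<bar> > \<delta>}) \<longlonglongrightarrow> 0"
      by (rule Lim_null_comparison[OF always_eventually[OF allI[OF bnd]] y0_small[unfolded small_o_prob_def, rule_format, OF \<delta>]])
  qed
qed

lemma diag_small: "small_o_prob M diag (\<lambda>_. 1)" and integrable_diag: "integrable M (diag n)"
proof -
  have i: "integrable M (diag n)" for n
    unfolding diag_def[abs_def] by (intro integrable_mult_right expectation_inno_sum_sq(1) \<phi>_stat)
  then show "integrable M (diag n)" .
  have "norm (\<integral>\<omega>. \<bar>diag n \<omega>\<bar> \<partial>M) \<le> real (N n) * g n ^ (N n + 1) / k n" for n
  proof -
    let ?a = "g n ^ (N n + 1) / (L n * k n)"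
    have a0: "0 \<le> ?a" using g_bounds(1)[of n] L_ge_1[of n] k_pos[of n] by (intro divide_nonneg_nonneg) auto
    have "(\<integral>\<omega>. \<bar>diag n \<omega>\<bar> \<partial>M) = (\<integral>\<omega>. ?a * (\<Sum>t=1..N n. (u n t \<omega>)\<^sup>2) \<partial>M)"
    proof -
      have d0: "0 \<le> diag n \<omega>" for \<omega> unfolding diag_def by (intro mult_nonneg_nonneg a0 sum_nonneg) simp
      have "\<bar>diag n \<omega>\<bar> = ?a * (\<Sum>t=1..N n. (u n t \<omega>)\<^sup>2)" for \<omega> unfolding abs_of_nonneg[OF d0] by (rule diag_def)
      then show ?thesis by (simp only:)
    qed
    also have "\<dots> = ?a * (\<integral>\<omega>. (\<Sum>t=1..N n. (u n t \<omega>)\<^sup>2) \<partial>M)" by (rule integral_mult_right_zero)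
    also have "\<dots> \<le> ?a * (real (N n) * L n)" by (intro mult_left_mono expectation_inno_sum_sq(2) \<phi>_stat a0)
    also have "\<dots> = real (N n) * g n ^ (N n + 1) / k n" using L_ge_1[of n] by simp
    finally show ?thesis by simp
  qed
  then have "(\<lambda>n. \<integral>\<omega>. \<bar>diag n \<omega>\<bar> \<partial>M) \<longlonglongrightarrow> 0"
    by (rule Lim_null_comparison[OF always_eventually[OF allI] N_g_over_k])
  then show "small_o_prob M diag (\<lambda>_. 1)" by (rule small_o_prob_if_L1[OF prob_space_axioms i])
qed

text \<open>By orthogonality the second moment is at most $(2c)^{-1} g^{2N} \ell^2 N / k$. Writing it as
  $(g^N N/k)^2$ times $k\ell^2/N$ shows that both rates are used.\<close>

lemma offdiag_small: "small_o_prob M offdiag (\<lambda>_. 1)" and measurable_offdiag: "offdiag n \<in> borel_measurable M"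
proof -
  have m: "offdiag n \<in> borel_measurable M" for n
    unfolding offdiag_def[abs_def] case_prod_beta'
    by (intro borel_measurable_sum borel_measurable_times borel_measurable_const measurable_inno) auto
  then show "offdiag n \<in> borel_measurable M" .
  have fP: "finite (SIGMA t:{1..N n}. {Suc t..N n})" for n by simp
  have P: "1 \<le> t \<and> t < j" if "(t, j) \<in> (SIGMA t:{1..N n}. {Suc t..N n})" for t j n using that by auto
  note B = expectation_inno_bilinear_sq[OF \<phi>_stat fP P]
  have i: "integrable M (\<lambda>\<omega>. (offdiag n \<omega>)\<^sup>2)" for n unfolding offdiag_def by (rule B(1))
  have bound: "norm (\<integral>\<omega>. (offdiag n \<omega>)\<^sup>2 \<partial>M) \<le> (1 / (2 * c)) * ((g n ^ N n * (real (N n) / k n) ^ 1)\<^sup>2 * (k n * L n ^ 2 / real (N n)))" for n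
  proof -
    have "(\<integral>\<omega>. (offdiag n \<omega>)\<^sup>2 \<partial>M) \<le> L n ^ 4 * (\<Sum>(t, j)\<in>(SIGMA t:{1..N n}. {Suc t..N n}). (g n ^ (N n + 1 + (j - t)) / (L n * k n))\<^sup>2)"
      unfolding offdiag_def by (rule B(2))
    also have "(\<Sum>(t, j)\<in>(SIGMA t:{1..N n}. {Suc t..N n}). (g n ^ (N n + 1 + (j - t)) / (L n * k n))\<^sup>2)
       = (\<Sum>t=1..N n. \<Sum>j=Suc t..N n. (g n ^ (N n + 1 + (j - t)) / (L n * k n))\<^sup>2)"
      by (subst sum.Sigma) simp_all
    also have "\<dots> \<le> (\<Sum>t=1..N n. g n ^ (2 * N n) / (L n * k n)\<^sup>2 * (k n / (2 * c)))"
    proof (rule sum_mono)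
      fix t assume t: "t \<in> {1..N n}"
      have "(\<Sum>j=Suc t..N n. (g n ^ (N n + 1 + (j - t)) / (L n * k n))\<^sup>2)
         \<le> (\<Sum>j=Suc t..N n. g n ^ (2 * N n) / (L n * k n)\<^sup>2 * (rho n ^ (2 * t) * g n ^ (2 * j)))"
      proof (rule sum_mono)
        fix j assume j: "j \<in> {Suc t..N n}"
        have "rho n ^ (2 * t) * g n ^ (2 * j) = (g n * rho n) ^ (2 * t) * g n ^ (2 * (j - t))"
        proof -
          have "2 * j = 2 * t + 2 * (j - t)" using j by auto
          then show ?thesis by (simp only: power_add power_mult_distrib mult_ac)
        qed
        then have rg: "rho n ^ (2 * t) * g n ^ (2 * j) = g n ^ (2 * (j - t))" using g_bounds(3)[of n] by simp
        have "(g n ^ (N n + 1 + (j - t)))\<^sup>2 = g n ^ (2 * N n) * g n ^ (2 * (j - t)) * (g n)\<^sup>2"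
          by (simp add: power_add power_mult_distrib power_even_eq)
        also have "\<dots> \<le> g n ^ (2 * N n) * g n ^ (2 * (j - t)) * 1"
          using g_bounds[of n] by (intro mult_left_mono power_le_one mult_nonneg_nonneg) auto
        finally have "(g n ^ (N n + 1 + (j - t)))\<^sup>2 / (L n * k n)\<^sup>2 \<le> g n ^ (2 * N n) * g n ^ (2 * (j - t)) / (L n * k n)\<^sup>2"
          by (intro divide_right_mono) auto
        then show "(g n ^ (N n + 1 + (j - t)) / (L n * k n))\<^sup>2 \<le> g n ^ (2 * N n) / (L n * k n)\<^sup>2 * (rho n ^ (2 * t) * g n ^ (2 * j))"
          unfolding rg power_divide by simp
      qed
      also have "\<dots> = g n ^ (2 * N n) / (L n * k n)\<^sup>2 * (rho n ^ (2 * t) * (\<Sum>j=Suc t..N n. g n ^ (2 * j)))"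
        by (simp only: sum_distrib_left)
      also have "\<dots> \<le> g n ^ (2 * N n) / (L n * k n)\<^sup>2 * (rho n ^ (2 * t) * (g n ^ (2 * t) * (k n / (2 * c))))"
        using t g_bounds(1)[of n] rho_gt_1[of n] by (intro mult_left_mono g_power_tail) auto
      also have "rho n ^ (2 * t) * (g n ^ (2 * t) * (k n / (2 * c))) = (g n * rho n) ^ (2 * t) * (k n / (2 * c))"
        by (simp only: power_mult_distrib mult_ac)
      also have "\<dots> = k n / (2 * c)" unfolding g_bounds(3) by simp
      finally show "(\<Sum>j=Suc t..N n. (g n ^ (N n + 1 + (j - t)) / (L n * k n))\<^sup>2) \<le> g n ^ (2 * N n) / (L n * k n)\<^sup>2 * (k n / (2 * c))" .
    qed
    also have "\<dots> = real (N n) * (g n ^ (2 * N n) / (L n * k n)\<^sup>2 * (k n / (2 * c)))" by simp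
    also have "L n ^ 4 * (real (N n) * (g n ^ (2 * N n) / (L n * k n)\<^sup>2 * (k n / (2 * c))))
        = (1 / (2 * c)) * ((g n ^ N n * (real (N n) / k n) ^ 1)\<^sup>2 * (k n * L n ^ 2 / real (N n)))"
    proof -
      have "l ^ 4 * (m * (G\<^sup>2 / (l * x)\<^sup>2 * (x / (2 * c)))) = (1 / (2 * c)) * ((G * (m / x) ^ 1)\<^sup>2 * (x * l ^ 2 / m))"
        if "l > 0" "x > 0" "m > 0" for l x m G :: real
        using that c_pos by (simp add: field_simps power2_eq_square power4_eq_xxxx)
      from this[of "L n" "k n" "real (N n)" "g n ^ N n"] show ?thesis
        using L_ge_1[of n] k_pos[of n] N_pos[of n] by (simp add: power_even_eq)
    qed
    finally show ?thesis using L_ge_1[of n] by (simp add: mult_left_mono)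
  qed
  have "(\<lambda>n. (1 / (2 * c)) * ((g n ^ N n * (real (N n) / k n) ^ 1)\<^sup>2 * (k n * L n ^ 2 / real (N n)))) \<longlonglongrightarrow> (1 / (2 * c)) * (0\<^sup>2 * 0)"
    by (intro tendsto_intros g_decay rate_N)
  then have "(\<lambda>n. (1 / (2 * c)) * ((g n ^ N n * (real (N n) / k n) ^ 1)\<^sup>2 * (k n * L n ^ 2 / real (N n)))) \<longlonglongrightarrow> 0" by simp
  then have "(\<lambda>n. \<integral>\<omega>. (offdiag n \<omega>)\<^sup>2 \<partial>M) \<longlonglongrightarrow> 0"
    by (rule Lim_null_comparison[OF always_eventually[OF allI[OF bound]]])
  then show "small_o_prob M offdiag (\<lambda>_. 1)" by (rule small_o_prob_if_L2[OF prob_space_axioms m i])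
qed

text \<open>The discounted future after time $t$ carries the factor $g^{2(t-1)}$, which exactly compensates the growth of
  the weights in the denominator.\<close>

lemma expectation_tail_sq:
  assumes t: "t \<in> {1..N n}"
  shows "integrable M (\<lambda>\<omega>. (tail n t \<omega>)\<^sup>2)" "(\<integral>\<omega>. (tail n t \<omega>)\<^sup>2 \<partial>M) \<le> g n ^ (2 * (t - 1)) / (2 * c)"
proof -
  have T: "finite {t..N n}" "{t..N n} \<subseteq> {1..}" using t by auto
  note E = expectation_inno_linear_sq[OF \<phi>_stat[of n] T, of "\<lambda>j. g n ^ j"]
  have e: "(tail n t \<omega>)\<^sup>2 = (\<Sum>j=t..N n. g n ^ j * u n j \<omega>)\<^sup>2 / (L n * k n)" for \<omega>
    unfolding tail_def power_divide scale_pos ..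
  show "integrable M (\<lambda>\<omega>. (tail n t \<omega>)\<^sup>2)" unfolding e by (intro integrable_divide E(1))
  have "(\<integral>\<omega>. (tail n t \<omega>)\<^sup>2 \<partial>M) = (\<integral>\<omega>. (\<Sum>j=t..N n. g n ^ j * u n j \<omega>)\<^sup>2 \<partial>M) / (L n * k n)"
    unfolding e by (rule integral_divide_zero)
  also have "\<dots> \<le> (L n * (\<Sum>j=t..N n. (g n ^ j)\<^sup>2)) / (L n * k n)"
    using L_ge_1[of n] k_pos[of n] by (intro divide_right_mono E(2)) auto
  also have "\<dots> = (\<Sum>j=t..N n. g n ^ (2 * j)) / k n" using L_ge_1[of n] by (simp add: power_even_eq)
  also have "(\<Sum>j=t..N n. g n ^ (2 * j)) \<le> g n ^ (2 * (t - 1)) * (k n / (2 * c))"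
    using g_power_tail[of "t - 1" "N n" n] t by auto
  also have "g n ^ (2 * (t - 1)) * (k n / (2 * c)) / k n = g n ^ (2 * (t - 1)) / (2 * c)" using k_pos[of n] by simp
  finally show "(\<integral>\<omega>. (tail n t \<omega>)\<^sup>2 \<partial>M) \<le> g n ^ (2 * (t - 1)) / (2 * c)"
    using k_pos[of n] by (simp add: divide_right_mono)
qed

lemma measurable_tail: "t \<ge> 1 \<Longrightarrow> tail n t \<in> borel_measurable M"
  unfolding tail_def[abs_def] by (intro borel_measurable_divide borel_measurable_const measurable_sum_inno) auto

lemma err2_nonneg: "0 \<le> err2 n \<omega>"
  unfolding err2_def by (intro sum_nonneg mult_nonneg_nonneg weight_nonneg) simp

lemma integrable_err2: "integrable M (err2 n)"
  unfolding err2_def[abs_def] by (intro Bochner_Integration.integrable_sum integrable_mult_right expectation_tail_sq)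

lemma expectation_err2_tendsto: "(\<lambda>n. \<integral>\<omega>. err2 n \<omega> \<partial>M) \<longlonglongrightarrow> 0"
proof -
  have bound: "norm (\<integral>\<omega>. err2 n \<omega> \<partial>M) \<le> (1 / (2 * c)) * (g n ^ N n * (real (N n) / k n) ^ 1)" for n
  proof -
    have "(\<integral>\<omega>. err2 n \<omega> \<partial>M) = (\<Sum>t=1..N n. weight n t * (\<integral>\<omega>. (tail n t \<omega>)\<^sup>2 \<partial>M))"
      unfolding err2_def using expectation_tail_sq(1) by (subst Bochner_Integration.integral_sum) auto
    also have "\<dots> \<le> (\<Sum>t=1..N n. g n ^ N n / (2 * c * k n))"
    proof (rule sum_mono)
      fix t assume t: "t \<in> {1..N n}"
      have "weight n t * (\<integral>\<omega>. (tail n t \<omega>)\<^sup>2 \<partial>M) \<le> weight n t * (g n ^ (2 * (t - 1)) / (2 * c))"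
        by (intro mult_left_mono expectation_tail_sq(2)[OF t] weight_nonneg)
      also have "\<dots> = g n ^ (2 * (N n + 1 - t) + 2 * (t - 1)) / (2 * c * k n)"
        unfolding weight_def power_add by simp
      also have "2 * (N n + 1 - t) + 2 * (t - 1) = N n + N n" using t by auto
      also have "g n ^ (N n + N n) / (2 * c * k n) \<le> g n ^ N n / (2 * c * k n)"
        using g_bounds[of n] c_pos k_pos[of n] by (intro divide_right_mono power_decreasing) auto
      finally show "weight n t * (\<integral>\<omega>. (tail n t \<omega>)\<^sup>2 \<partial>M) \<le> g n ^ N n / (2 * c * k n)" .
    qed
    also have "\<dots> = (1 / (2 * c)) * (g n ^ N n * (real (N n) / k n) ^ 1)" by simp
    finally show ?thesis using err2_nonneg[of n] by (simp add: integral_nonneg_AE)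
  qed
  have "(\<lambda>n. (1 / (2 * c)) * (g n ^ N n * (real (N n) / k n) ^ 1)) \<longlonglongrightarrow> (1 / (2 * c)) * 0"
    by (intro tendsto_intros g_decay)
  then have "(\<lambda>n. (1 / (2 * c)) * (g n ^ N n * (real (N n) / k n) ^ 1)) \<longlonglongrightarrow> 0" by simp
  then show ?thesis by (rule Lim_null_comparison[OF always_eventually[OF allI[OF bound]]])
qed

lemma err2_small: "small_o_prob M err2 (\<lambda>_. 1)"
proof (rule small_o_prob_if_L1[OF prob_space_axioms integrable_err2])
  show "(\<lambda>n. \<integral>\<omega>. \<bar>err2 n \<omega>\<bar> \<partial>M) \<longlonglongrightarrow> 0"
    unfolding abs_of_nonneg[OF err2_nonneg] by (rule expectation_err2_tendsto)
qed

text \<open>Cauchy--Schwarz with respect to the weights reduces the linear error to the quadratic one.\<close>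

lemma err1_small: "small_o_prob M err1 (\<lambda>_. 1)" and measurable_err1: "err1 n \<in> borel_measurable M"
proof -
  have m: "err1 n \<in> borel_measurable M" for n
    unfolding err1_def[abs_def] by (intro borel_measurable_sum borel_measurable_times borel_measurable_const measurable_tail) auto
  then show "err1 n \<in> borel_measurable M" .
  have le: "(err1 n \<omega>)\<^sup>2 \<le> 1 / (2 * c) * err2 n \<omega>" for n \<omega>
  proof -
    have "(err1 n \<omega>)\<^sup>2 \<le> \<kappa> n * err2 n \<omega>"
      unfolding err1_def err2_def sum_weight[symmetric] by (rule weighted_sum_square_le) (rule weight_nonneg)
    also have "\<dots> \<le> 1 / (2 * c) * err2 n \<omega>" by (intro mult_right_mono \<kappa>_bounds err2_nonneg)
    finally show ?thesis .
  qed
  have i: "integrable M (\<lambda>\<omega>. (err1 n \<omega>)\<^sup>2)" for n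
  proof (rule Bochner_Integration.integrable_bound)
    show "integrable M (\<lambda>\<omega>. 1 / (2 * c) * err2 n \<omega>)" by (intro integrable_mult_right integrable_err2)
    show "(\<lambda>\<omega>. (err1 n \<omega>)\<^sup>2) \<in> borel_measurable M" by (intro borel_measurable_power m)
    have "norm ((err1 n \<omega>)\<^sup>2) \<le> norm (1 / (2 * c) * err2 n \<omega>)" for \<omega>
      using order_trans[OF le[of n \<omega>] abs_ge_self] by simp
    then show "AE \<omega> in M. norm ((err1 n \<omega>)\<^sup>2) \<le> norm (1 / (2 * c) * err2 n \<omega>)" by simp
  qed
  have bound: "norm (\<integral>\<omega>. (err1 n \<omega>)\<^sup>2 \<partial>M) \<le> 1 / (2 * c) * (\<integral>\<omega>. err2 n \<omega> \<partial>M)" for n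
  proof -
    have "(\<integral>\<omega>. (err1 n \<omega>)\<^sup>2 \<partial>M) \<le> (\<integral>\<omega>. 1 / (2 * c) * err2 n \<omega> \<partial>M)"
      by (intro integral_mono i integrable_mult_right integrable_err2 le)
    then show ?thesis by simp
  qed
  have "(\<lambda>n. 1 / (2 * c) * (\<integral>\<omega>. err2 n \<omega> \<partial>M)) \<longlonglongrightarrow> 0"
    by (intro tendsto_mult_right_zero expectation_err2_tendsto)
  then have "(\<lambda>n. \<integral>\<omega>. (err1 n \<omega>)\<^sup>2 \<partial>M) \<longlonglongrightarrow> 0"
    by (rule Lim_null_comparison[OF always_eventually[OF allI[OF bound]]])
  then show "small_o_prob M err1 (\<lambda>_. 1)" by (rule small_o_prob_if_L2[OF prob_space_axioms m i])
qed

lemma \<kappa>_small: "small_o_prob M (\<lambda>n \<omega>. \<kappa> n - 1 / (2 * c)) (\<lambda>_. 1)"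
proof (rule small_o_prob_if_L1[OF prob_space_axioms])
  have "(\<lambda>n. \<bar>\<kappa> n - 1 / (2 * c)\<bar>) \<longlonglongrightarrow> \<bar>1 / (2 * c) - 1 / (2 * c)\<bar>" by (intro tendsto_intros \<kappa>_tendsto)
  then show "(\<lambda>n. \<integral>\<omega>. \<bar>\<kappa> n - 1 / (2 * c)\<bar> \<partial>M) \<longlonglongrightarrow> 0" by (simp add: prob_space)
qed simp

text \<open>The pair $(W,V)$ is extended by the initial value, the four remainders and the deviation of $\kappa$ from its limit,
  all of which converge to 0. Numerator and denominator are then one continuous function \<open>G\<close> of this vector.\<close>

theorem weak_conv_numer_denom:
  "weak_conv_top (\<lambda>n. distr M borel (\<lambda>\<omega>. (numer n \<omega>, denom n \<omega>))) (limit_law c)"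
proof -
  define v where "v = 1 / (2 * c)"
  have v: "v > 0" using c_pos by (simp add: v_def)
  interpret Nv: real_distribution "normal_law 0 v" by (rule real_distribution_normal_law[OF v])
  interpret Q: pair_prob_space "normal_law 0 v" "normal_law 0 v" ..
  let ?Q = "normal_law 0 v \<Otimes>\<^sub>M normal_law 0 v"
  have "sets ?Q = sets (borel \<Otimes>\<^sub>M borel)" by (intro sets_pair_measure_cong) simp_all
  then have T0: "(\<lambda>z. z) \<in> ?Q \<rightarrow>\<^sub>M borel" by (intro measurable_ident_sets) (simp only: borel_prod)
  note pr = prob_space_axioms and Qp = Q.prob_space_axioms
  note mp = borel_measurable_Pair
  have c0: "(\<lambda>z. 0::real) \<in> borel_measurable ?Q" by simp
  have ms: "init n \<in> borel_measurable M" "diag n \<in> borel_measurable M" "offdiag n \<in> borel_measurable M"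
     "err1 n \<in> borel_measurable M" "err2 n \<in> borel_measurable M" "(\<lambda>\<omega>. \<kappa> n - 1 / (2 * c)) \<in> borel_measurable M" for n
    using measurable_init integrable_diag measurable_offdiag measurable_err1 integrable_err2 by auto
  note X0 = mp[OF measurable_WV]
  note X1 = mp[OF X0 ms(1)]
  note X2 = mp[OF X1 ms(2)]
  note X3 = mp[OF X2 ms(3)]
  note X4 = mp[OF X3 ms(4)]
  note X5 = mp[OF X4 ms(5)]
  note X6 = mp[OF X5 ms(6)]
  note T1 = mp[OF T0 c0] note T2 = mp[OF T1 c0] note T3 = mp[OF T2 c0] note T4 = mp[OF T3 c0]
  note T5 = mp[OF T4 c0] note T6 = mp[OF T5 c0]
  note w0 = weak_conv_WV[folded v_def]
  note w1 = weak_conv_top_append_null_distr[OF pr X0 ms(1) Qp T0 w0 init_small]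
  note w2 = weak_conv_top_append_null_distr[OF pr X1 ms(2) Qp T1 w1 diag_small]
  note w3 = weak_conv_top_append_null_distr[OF pr X2 ms(3) Qp T2 w2 offdiag_small]
  note w4 = weak_conv_top_append_null_distr[OF pr X3 ms(4) Qp T3 w3 err1_small]
  note w5 = weak_conv_top_append_null_distr[OF pr X4 ms(5) Qp T4 w4 err2_small]
  note w6 = weak_conv_top_append_null_distr[OF pr X5 ms(6) Qp T5 w5 \<kappa>_small]
  define G :: "((((((real \<times> real) \<times> real) \<times> real) \<times> real) \<times> real) \<times> real) \<times> real \<Rightarrow> real \<times> real"
    where "G = (\<lambda>(((((((w, x), z), d), f), e1), e2), q).
      ((z + w) * x - d - f, (q + v) * (z + w)\<^sup>2 - 2 * (z + w) * e1 + e2))"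
  have Gc: "continuous_on UNIV G" unfolding G_def case_prod_beta' by (intro continuous_intros)
  have Gm: "G \<in> borel_measurable borel" using Gc by (rule borel_measurable_continuous_onI)
  have lim: "distr (distr ?Q borel (\<lambda>z. ((((((z, 0), 0), 0), 0), 0), 0))) borel G = limit_law c"
  proof -
    have "distr (distr ?Q borel (\<lambda>z. ((((((z, 0), 0), 0), 0), 0), 0))) borel G
        = distr ?Q borel (G \<circ> (\<lambda>z. ((((((z, 0), 0), 0), 0), 0), 0)))"
      by (rule distr_distr[OF Gm T6])
    also have "G \<circ> (\<lambda>z. ((((((z, 0), 0), 0), 0), 0), 0)) = (\<lambda>(w, x). (w * x, w\<^sup>2 / (2 * c)))"
      unfolding G_def comp_def by (auto simp: v_def fun_eq_iff)
    finally show ?thesis unfolding limit_law_def v_def .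
  qed
  have "G (((((((W n \<omega>, V n \<omega>), init n \<omega>), diag n \<omega>), offdiag n \<omega>), err1 n \<omega>), err2 n \<omega>), \<kappa> n - 1 / (2 * c))
      = (numer n \<omega>, denom n \<omega>)" for n \<omega>
    unfolding G_def numer_denom_decomposition by (simp add: v_def)
  then show ?thesis
    using weak_conv_top_continuous_map[OF X6 sets_distr w6 Gc] unfolding lim by (simp only:)
qed

lemma measurable_numer_denom: "numer n \<in> borel_measurable M" "denom n \<in> borel_measurable M"
proof -
  note [measurable] = measurable_WV measurable_init measurable_offdiag measurable_err1
  have [measurable]: "diag n \<in> borel_measurable M" "err2 n \<in> borel_measurable M"
    using integrable_diag integrable_err2 by auto
  show "numer n \<in> borel_measurable M" "denom n \<in> borel_measurable M"
    unfolding numer_denom_decomposition[abs_def] by measurable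
qed

end

section \<open>The limit theorem\<close>

text \<open>Limits do not see the first term; this discards the sample size 0.\<close>

lemma weak_conv_top_Suc: "weak_conv_top (\<lambda>n. \<mu> (Suc n)) \<nu> \<Longrightarrow> weak_conv_top \<mu> \<nu>"
  unfolding weak_conv_top_def using LIMSEQ_imp_Suc[of "\<lambda>n. \<integral>x. f x \<partial>\<mu> n" for f] by blast

lemma weak_conv_m_Suc: "weak_conv_m (\<lambda>n. \<mu> (Suc n)) \<nu> \<Longrightarrow> weak_conv_m \<mu> \<nu>"
  unfolding weak_conv_m_def weak_conv_def using LIMSEQ_imp_Suc[of "\<lambda>n. cdf (\<mu> n) x" for x] by blast

text \<open>If $r_n \to \infty$ then $1-\phi_n^2 \ge d/\log r_n$ eventually, so the exponent is at most a multiple of $\log r_n$; if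
  $r_n$ is constant, so is the left-hand side.\<close>

lemma stationary_moment_poly_bound:
  fixes r \<phi> :: "nat \<Rightarrow> real" and d \<alpha> :: real and p :: nat
  assumes d: "d > 0"
    and r_gt1: "\<And>n. n \<ge> 1 \<Longrightarrow> r n > 1"
    and r_cases: "filterlim r at_top sequentially \<or> (\<exists>C. \<forall>n\<ge>1. r n = C)"
    and \<phi>_eq: "\<And>n. n \<ge> 1 \<Longrightarrow> \<phi> n = 1 - d / ln (r n)"
  obtains q Q where "q > 0" "eventually (\<lambda>n. exp (\<alpha>\<^sup>2 / (1 - (\<phi> n)\<^sup>2) / 2) ^ p \<le> Q * r n powr q) sequentially"
  using r_cases
proof (elim disjE exE)
  assume rt: "filterlim r at_top sequentially"
  define q where "q = real p * \<alpha>\<^sup>2 / (2 * d) + 1"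
  have q: "q > 0" unfolding q_def using d by (intro add_nonneg_pos) auto
  have "eventually (\<lambda>n. exp (\<alpha>\<^sup>2 / (1 - (\<phi> n)\<^sup>2) / 2) ^ p \<le> 1 * r n powr q) sequentially"
    using filterlim_at_top[THEN iffD1, OF rt, rule_format, of "exp d"] eventually_ge_at_top[of 1]
  proof eventually_elim
    case (elim n)
    have r: "r n > 1" using r_gt1 elim(2) by simp
    have "ln (exp d) \<le> ln (r n)" using elim(1) r by (subst ln_le_cancel_iff) auto
    then have l: "d \<le> ln (r n)" "0 < ln (r n)" using d by auto
    define \<delta> where "\<delta> = d / ln (r n)"
    have \<delta>: "0 < \<delta>" "\<delta> \<le> 1" using l d by (auto simp: \<delta>_def)
    have \<phi>\<delta>: "\<phi> n = 1 - \<delta>" using \<phi>_eq[OF elim(2)] by (simp add: \<delta>_def)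
    have "1 - (\<phi> n)\<^sup>2 = \<delta> * (2 - \<delta>)" unfolding \<phi>\<delta> by (simp add: power2_eq_square algebra_simps)
    also have "\<dots> \<ge> \<delta> * 1" using \<delta> by (intro mult_left_mono) auto
    finally have "\<alpha>\<^sup>2 / (1 - (\<phi> n)\<^sup>2) \<le> \<alpha>\<^sup>2 / \<delta>" using \<delta> by (intro divide_left_mono) auto
    also have "\<dots> = \<alpha>\<^sup>2 * ln (r n) / d" by (simp add: \<delta>_def)
    finally have "real p * (\<alpha>\<^sup>2 / (1 - (\<phi> n)\<^sup>2) / 2) \<le> real p * (\<alpha>\<^sup>2 * ln (r n) / d / 2)"
      by (intro mult_left_mono divide_right_mono) auto
    also have "\<dots> = (real p * \<alpha>\<^sup>2 / (2 * d)) * ln (r n)" by simp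
    also have "\<dots> \<le> q * ln (r n)" unfolding q_def using l by (intro mult_right_mono) auto
    finally have "exp (real p * (\<alpha>\<^sup>2 / (1 - (\<phi> n)\<^sup>2) / 2)) \<le> exp (q * ln (r n))"
      by (simp only: exp_le_cancel_iff)
    also have "exp (q * ln (r n)) = 1 * r n powr q" using r by (simp add: powr_def)
    finally show ?case by (simp only: exp_of_nat_mult)
  qed
  then show ?thesis by (rule that[OF q])
next
  fix C assume C: "\<forall>n\<ge>1. r n = C"
  define Q where "Q = exp (\<alpha>\<^sup>2 / (1 - (\<phi> 1)\<^sup>2) / 2) ^ p"
  have "eventually (\<lambda>n. exp (\<alpha>\<^sup>2 / (1 - (\<phi> n)\<^sup>2) / 2) ^ p \<le> Q * r n powr 1) sequentially"
    using eventually_ge_at_top[of 1]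
  proof eventually_elim
    case (elim n)
    have "\<phi> n = \<phi> 1" using C elim \<phi>_eq by simp
    then have "exp (\<alpha>\<^sup>2 / (1 - (\<phi> n)\<^sup>2) / 2) ^ p = Q * 1" by (simp add: Q_def)
    also have "\<dots> \<le> Q * r n powr 1" using r_gt1[OF elim] by (intro mult_left_mono) (auto simp: Q_def)
    finally show ?case .
  qed
  then show ?thesis by (rule that[OF zero_less_one])
qed

theorem theorem4p4:
  fixes M :: "'a measure"
    and c d \<alpha> :: real
    and k r \<phi> \<rho> ell :: "nat \<Rightarrow> real"
    and \<epsilon> \<eta> :: "nat \<Rightarrow> 'a \<Rightarrow> real"
    and \<sigma> u y :: "nat \<Rightarrow> nat \<Rightarrow> 'a \<Rightarrow> real"
    and \<rho>hat :: "nat \<Rightarrow> 'a \<Rightarrow> real"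
  assumes prob: "prob_space M"
    and params: "c > 0" "d > 0" "\<alpha> > 0"
    and k_pos: "\<And>n. n \<ge> 1 \<Longrightarrow> k n > 0"
    and k_top: "filterlim k at_top sequentially"
    and k_small: "k \<in> o(\<lambda>n. real n)"
    and r_gt1: "\<And>n. n \<ge> 1 \<Longrightarrow> r n > 1"
    and r_cases: "filterlim r at_top sequentially \<or> (\<exists>C. \<forall>n\<ge>1. r n = C)"
    and \<phi>_eq: "\<And>n. n \<ge> 1 \<Longrightarrow> \<phi> n = 1 - d / ln (r n)"
    and \<phi>_stat: "\<And>n. n \<ge> 1 \<Longrightarrow> \<bar>\<phi> n\<bar> < 1"
    and \<rho>_eq: "\<And>n. n \<ge> 1 \<Longrightarrow> \<rho> n = 1 + c / k n"
    and ell_eq: "\<And>n. n \<ge> 1 \<Longrightarrow> ell n = exp (\<alpha>\<^sup>2 / (2 * (1 - (\<phi> n)\<^sup>2)))"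
    and rate1: "\<And>q::real. q > 0 \<Longrightarrow> (\<lambda>n. r n powr q) \<in> o(k)"
    and rate2: "\<And>q::real. q > 0 \<Longrightarrow> (\<lambda>n. k n * r n powr q) \<in> o(\<lambda>n. real n)"
    and \<epsilon>_indep: "prob_space.indep_vars M (\<lambda>_. borel) \<epsilon> {1..}"
    and \<epsilon>_ident: "\<And>t. t \<ge> 1 \<Longrightarrow> distr M borel (\<epsilon> t) = distr M borel (\<epsilon> 1)"
    and \<epsilon>_mean: "\<And>t. t \<ge> 1 \<Longrightarrow> (\<integral>\<omega>. \<epsilon> t \<omega> \<partial>M) = 0"
    and \<epsilon>_var: "\<And>t. t \<ge> 1 \<Longrightarrow> (\<integral>\<omega>. (\<epsilon> t \<omega>)\<^sup>2 \<partial>M) = 1"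
    and \<epsilon>_fourth: "\<And>t. t \<ge> 1 \<Longrightarrow> integrable M (\<lambda>\<omega>. (\<epsilon> t \<omega>) ^ 4)"
    and \<eta>_indep: "prob_space.indep_vars M (\<lambda>_. borel) \<eta> {1..}"
    and \<eta>_normal: "\<And>t. t \<ge> 1 \<Longrightarrow> distr M borel (\<eta> t) = normal_law 0 (\<alpha>\<^sup>2)"
    and \<epsilon>_\<eta>_indep: "prob_space.indep_var M
           (PiM {1..} (\<lambda>_. borel)) (\<lambda>\<omega>. \<lambda>t\<in>{1..}. \<epsilon> t \<omega>)
           (PiM {1..} (\<lambda>_. borel)) (\<lambda>\<omega>. \<lambda>t\<in>{1..}. \<eta> t \<omega>)"
    and y0_meas: "\<And>n. n \<ge> 1 \<Longrightarrow> y n 0 \<in> borel_measurable M"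
    and y0_indep: "\<And>n. n \<ge> 1 \<Longrightarrow> prob_space.indep_set M
           (sets (vimage_algebra (space M) (y n 0) borel))
           (sets (vimage_algebra (space M) (\<lambda>\<omega>. \<lambda>t\<in>{1..}. (\<epsilon> t \<omega>, \<eta> t \<omega>))
              (PiM {1..} (\<lambda>_. borel \<Otimes>\<^sub>M borel))))"
    and y0_small: "small_o_prob M (\<lambda>n. y n 0) (\<lambda>n. k n powr (1/2))"
    and \<sigma>_pos: "\<And>n t \<omega>. n \<ge> 1 \<Longrightarrow> t \<le> n \<Longrightarrow> \<omega> \<in> space M \<Longrightarrow> \<sigma> n t \<omega> > 0"
    and \<sigma>_init: "\<And>n \<omega>. n \<ge> 1 \<Longrightarrow> \<omega> \<in> space M \<Longrightarrow> \<sigma> n 0 \<omega> = 1"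
    and \<sigma>_rec: "\<And>n t \<omega>. 1 \<le> t \<Longrightarrow> t \<le> n \<Longrightarrow> \<omega> \<in> space M \<Longrightarrow>
           ln ((\<sigma> n t \<omega>)\<^sup>2) = \<phi> n * ln ((\<sigma> n (t - 1) \<omega>)\<^sup>2) + \<eta> t \<omega>"
    and u_eq: "\<And>n t \<omega>. 1 \<le> t \<Longrightarrow> t \<le> n \<Longrightarrow> \<omega> \<in> space M \<Longrightarrow> u n t \<omega> = \<sigma> n t \<omega> * \<epsilon> t \<omega>"
    and y_rec: "\<And>n t \<omega>. 1 \<le> t \<Longrightarrow> t \<le> n \<Longrightarrow> \<omega> \<in> space M \<Longrightarrow>
           y n t \<omega> = \<rho> n * y n (t - 1) \<omega> + u n t \<omega>"
    \<comment> \<open>the estimator is left unspecified where its denominator vanishes\<close>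
    and \<rho>hat_meas: "\<And>n. n \<ge> 1 \<Longrightarrow> \<rho>hat n \<in> borel_measurable M"
    and \<rho>hat_eq: "\<And>n \<omega>. n \<ge> 1 \<Longrightarrow> \<omega> \<in> space M \<Longrightarrow> (\<Sum>t=1..n. (y n (t - 1) \<omega>)\<^sup>2) \<noteq> 0 \<Longrightarrow>
           \<rho>hat n \<omega> = (\<Sum>t=1..n. y n (t - 1) \<omega> * y n t \<omega>) / (\<Sum>t=1..n. (y n (t - 1) \<omega>)\<^sup>2)"
  shows "weak_conv_top
           (\<lambda>n. distr M borel (\<lambda>\<omega>.
              (\<rho> n powi (- int n) * (\<Sum>t=1..n. y n (t - 1) \<omega> * u n t \<omega>) / (ell n * k n),
               \<rho> n powi (- 2 * int n) * (\<Sum>t=1..n. (y n (t - 1) \<omega>)\<^sup>2) / (ell n * (k n)\<^sup>2))))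
           (limit_law c)
       \<and> weak_conv_m
           (\<lambda>n. distr M borel (\<lambda>\<omega>. (k n * \<rho> n ^ n / (2 * c)) * (\<rho>hat n \<omega> - \<rho> n)))
           std_cauchy_law"
proof -
  interpret sv_noise M \<alpha> \<epsilon> \<eta>
    by (intro sv_noise.intro sv_noise_axioms.intro prob params(3) \<epsilon>_indep \<epsilon>_ident \<epsilon>_mean \<epsilon>_var \<epsilon>_fourth \<eta>_indep \<eta>_normal \<epsilon>_\<eta>_indep)
  have msq_eq: "msq x = exp (\<alpha>\<^sup>2 / (1 - x\<^sup>2) / 2)" for x unfolding msq_def lvar_def ..
  have rateL: "(\<lambda>n. msq (\<phi> n) ^ p / k n) \<longlonglongrightarrow> 0" "(\<lambda>n. k n * msq (\<phi> n) ^ p / real n) \<longlonglongrightarrow> 0" for p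
  proof -
    obtain q Q where q: "q > 0" and ev: "eventually (\<lambda>n. msq (\<phi> n) ^ p \<le> Q * r n powr q) sequentially"
      using stationary_moment_poly_bound[OF params(2) r_gt1 r_cases \<phi>_eq] unfolding msq_eq by blast
    have m0: "0 \<le> msq x" for x unfolding msq_def by simp
    have "(\<lambda>n. Q * (r n powr q / k n)) \<longlonglongrightarrow> 0"
      by (intro tendsto_mult_right_zero smalloD_tendsto rate1 q)
    moreover have "eventually (\<lambda>n. norm (msq (\<phi> n) ^ p / k n) \<le> Q * (r n powr q / k n)) sequentially"
      using ev eventually_ge_at_top[of 1]
    proof eventually_elim
      case (elim n)
      then show ?case using k_pos[of n] m0[of "\<phi> n"] by (simp add: divide_right_mono)
    qed
    ultimately show "(\<lambda>n. msq (\<phi> n) ^ p / k n) \<longlonglongrightarrow> 0" by (rule Lim_null_comparison[rotated])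
    have "(\<lambda>n. Q * (k n * r n powr q / real n)) \<longlonglongrightarrow> 0"
      by (intro tendsto_mult_right_zero smalloD_tendsto rate2 q)
    moreover have "eventually (\<lambda>n. norm (k n * msq (\<phi> n) ^ p / real n) \<le> Q * (k n * r n powr q / real n)) sequentially"
      using ev eventually_ge_at_top[of 1]
    proof eventually_elim
      case (elim n)
      have "k n * msq (\<phi> n) ^ p / real n \<le> k n * (Q * r n powr q) / real n"
        using elim k_pos[of n] by (intro divide_right_mono mult_left_mono) auto
      then show ?case using k_pos[OF elim(2)] m0[of "\<phi> n"] by (simp add: mult_ac)
    qed
    ultimately show "(\<lambda>n. k n * msq (\<phi> n) ^ p / real n) \<longlonglongrightarrow> 0" by (rule Lim_null_comparison[rotated])
  qed
  have y0s: "small_o_prob M (\<lambda>n. y (Suc n) 0) (\<lambda>n. sqrt (k (Suc n)))"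
    unfolding small_o_prob_def
  proof (intro allI impI)
    fix \<delta> :: real assume "\<delta> > 0"
    from LIMSEQ_Suc[OF y0_small[unfolded small_o_prob_def, rule_format, OF this]]
    show "(\<lambda>n. measure M {\<omega> \<in> space M. \<bar>y (Suc n) 0 \<omega> / sqrt (k (Suc n))\<bar> > \<delta>}) \<longlonglongrightarrow> 0"
      using k_pos by (simp add: powr_half_sqrt less_imp_le)
  qed
  interpret A: sv_array M \<alpha> \<epsilon> \<eta> c "\<lambda>n. k (Suc n)" "\<lambda>n. \<phi> (Suc n)" Suc "\<lambda>n. y (Suc n) 0"
  proof (unfold_locales)
    show "(\<lambda>n. msq (\<phi> (Suc n)) ^ p / k (Suc n)) \<longlonglongrightarrow> 0" for p by (rule LIMSEQ_Suc[OF rateL(1)])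
    show "(\<lambda>n. k (Suc n) * msq (\<phi> (Suc n)) ^ p / real (Suc n)) \<longlonglongrightarrow> 0" for p by (rule LIMSEQ_Suc[OF rateL(2)])
  qed (use params(1) k_pos \<phi>_stat y0_meas y0s in auto)
  have sig_eq: "\<sigma> n t \<omega> = sig (\<phi> n) t \<omega>" if n: "n \<ge> 1" and t: "t \<le> n" and \<omega>: "\<omega> \<in> space M" for n t \<omega>
  proof -
    have "ln ((\<sigma> n t \<omega>)\<^sup>2) = logvol (\<phi> n) (\<lambda>s. \<eta> s \<omega>) t" using t
    proof (induction t)
      case 0
      then show ?case using \<sigma>_init[OF n \<omega>] by (simp add: logvol_def)
    next
      case (Suc t)
      have "logvol (\<phi> n) (\<lambda>s. \<eta> s \<omega>) (Suc t) = \<phi> n * logvol (\<phi> n) (\<lambda>s. \<eta> s \<omega>) t + \<eta> (Suc t) \<omega>"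
        unfolding logvol_def by (simp add: sum_distrib_left Suc_diff_le mult.assoc)
      then show ?case using \<sigma>_rec[of "Suc t" n \<omega>] Suc \<omega> by simp
    qed
    moreover have "ln ((\<sigma> n t \<omega>)\<^sup>2) = 2 * ln (\<sigma> n t \<omega>)" using \<sigma>_pos[OF n t \<omega>] by (simp add: ln_realpow)
    ultimately have "exp (ln (\<sigma> n t \<omega>)) = sig (\<phi> n) t \<omega>" unfolding sig_def vol_def by simp
    then show ?thesis using \<sigma>_pos[OF n t \<omega>] by simp
  qed
  have u_inno: "u n t \<omega> = inno (\<phi> n) t \<omega>" if "1 \<le> t" "t \<le> n" "\<omega> \<in> space M" for n t \<omega>
    using u_eq[OF that] sig_eq[of n t \<omega>] that unfolding inno_def by simp
  have rho: "A.rho n = \<rho> (Suc n)" and g: "A.g n = 1 / \<rho> (Suc n)" for n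
    using \<rho>_eq[of "Suc n"] by (simp_all add: A.rho_def A.g_def)
  have \<rho>1: "\<rho> (Suc n) > 1" for n using A.rho_gt_1[of n] unfolding rho .
  have y_path: "y (Suc n) t \<omega> = A.path n t \<omega>" if t: "t \<le> Suc n" and \<omega>: "\<omega> \<in> space M" for n t \<omega>
    using t
  proof (induction t)
    case 0
    then show ?case by (simp add: A.path_def)
  next
    case (Suc t)
    have "y (Suc n) (Suc t) \<omega> = \<rho> (Suc n) * A.path n t \<omega> + inno (\<phi> (Suc n)) (Suc t) \<omega>"
      using y_rec[of "Suc t" "Suc n" \<omega>] u_inno[of "Suc t" "Suc n" \<omega>] Suc \<omega> by simp
    also have "\<dots> = A.path n (Suc t) \<omega>"
      using \<rho>1[of n] unfolding A.path_def g by (simp add: field_simps)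
    finally show ?case .
  qed
  have num: "\<rho> (Suc n) powi (- int (Suc n)) * (\<Sum>t=1..Suc n. y (Suc n) (t - 1) \<omega> * u (Suc n) t \<omega>) / (ell (Suc n) * k (Suc n)) = A.numer n \<omega>"
    and den: "\<rho> (Suc n) powi (- 2 * int (Suc n)) * (\<Sum>t=1..Suc n. (y (Suc n) (t - 1) \<omega>)\<^sup>2) / (ell (Suc n) * (k (Suc n))\<^sup>2) = A.denom n \<omega>"
    if \<omega>: "\<omega> \<in> space M" for n \<omega>
  proof -
    have l: "ell (Suc n) = msq (\<phi> (Suc n))" using ell_eq[of "Suc n"] by (simp add: msq_eq)
    have p1: "\<rho> (Suc n) powi (- int (Suc n)) = A.g n ^ Suc n"
      unfolding g power_int_minus power_int_of_nat by (simp add: power_one_over inverse_eq_divide)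
    have "- 2 * int (Suc n) = - int (2 * Suc n)" by simp
    then have p2: "\<rho> (Suc n) powi (- 2 * int (Suc n)) = A.g n ^ (2 * Suc n)"
      unfolding g by (simp only: power_int_minus power_int_of_nat power_one_over inverse_eq_divide)
    have s1: "(\<Sum>t=1..Suc n. y (Suc n) (t - 1) \<omega> * u (Suc n) t \<omega>) = (\<Sum>t=1..Suc n. A.path n (t - 1) \<omega> * inno (\<phi> (Suc n)) t \<omega>)"
      using \<omega> by (intro sum.cong) (auto simp: y_path u_inno)
    have s2: "(\<Sum>t=1..Suc n. (y (Suc n) (t - 1) \<omega>)\<^sup>2) = (\<Sum>t=1..Suc n. (A.path n (t - 1) \<omega>)\<^sup>2)"
      using \<omega> by (intro sum.cong) (auto simp: y_path)
    show "\<rho> (Suc n) powi (- int (Suc n)) * (\<Sum>t=1..Suc n. y (Suc n) (t - 1) \<omega> * u (Suc n) t \<omega>) / (ell (Suc n) * k (Suc n)) = A.numer n \<omega>"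
      unfolding A.numer_def p1 s1 l ..
    show "\<rho> (Suc n) powi (- 2 * int (Suc n)) * (\<Sum>t=1..Suc n. (y (Suc n) (t - 1) \<omega>)\<^sup>2) / (ell (Suc n) * (k (Suc n))\<^sup>2) = A.denom n \<omega>"
      unfolding A.denom_def p2 s2 l ..
  qed
  have part1: "weak_conv_top
           (\<lambda>n. distr M borel (\<lambda>\<omega>.
              (\<rho> n powi (- int n) * (\<Sum>t=1..n. y n (t - 1) \<omega> * u n t \<omega>) / (ell n * k n),
               \<rho> n powi (- 2 * int n) * (\<Sum>t=1..n. (y n (t - 1) \<omega>)\<^sup>2) / (ell n * (k n)\<^sup>2))))
           (limit_law c)"
  proof (rule weak_conv_top_Suc)
    have "distr M borel (\<lambda>\<omega>.
              (\<rho> (Suc n) powi (- int (Suc n)) * (\<Sum>t=1..Suc n. y (Suc n) (t - 1) \<omega> * u (Suc n) t \<omega>) / (ell (Suc n) * k (Suc n)),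
               \<rho> (Suc n) powi (- 2 * int (Suc n)) * (\<Sum>t=1..Suc n. (y (Suc n) (t - 1) \<omega>)\<^sup>2) / (ell (Suc n) * (k (Suc n))\<^sup>2)))
        = distr M borel (\<lambda>\<omega>. (A.numer n \<omega>, A.denom n \<omega>))" for n
      by (intro distr_cong refl) (simp only: num den)
    then show "weak_conv_top
           (\<lambda>n. distr M borel (\<lambda>\<omega>.
              (\<rho> (Suc n) powi (- int (Suc n)) * (\<Sum>t=1..Suc n. y (Suc n) (t - 1) \<omega> * u (Suc n) t \<omega>) / (ell (Suc n) * k (Suc n)),
               \<rho> (Suc n) powi (- 2 * int (Suc n)) * (\<Sum>t=1..Suc n. (y (Suc n) (t - 1) \<omega>)\<^sup>2) / (ell (Suc n) * (k (Suc n))\<^sup>2))))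
           (limit_law c)"
      using A.weak_conv_numer_denom by (simp only:)
  qed
  have part2: "weak_conv_m
           (\<lambda>n. distr M borel (\<lambda>\<omega>. (k n * \<rho> n ^ n / (2 * c)) * (\<rho>hat n \<omega> - \<rho> n)))
           std_cauchy_law"
  proof (rule weak_conv_m_Suc, rule weak_conv_m_ratio_cauchy[OF prob params(1) A.measurable_numer_denom _ A.weak_conv_numer_denom])
    show "(\<lambda>\<omega>. k (Suc n) * \<rho> (Suc n) ^ Suc n / (2 * c) * (\<rho>hat (Suc n) \<omega> - \<rho> (Suc n))) \<in> borel_measurable M" for n
      using \<rho>hat_meas[of "Suc n"] by simp
    show "\<forall>\<^sub>F n in sequentially. \<forall>\<omega>\<in>space M. A.denom n \<omega> \<noteq> 0 \<longrightarrow>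
        k (Suc n) * \<rho> (Suc n) ^ Suc n / (2 * c) * (\<rho>hat (Suc n) \<omega> - \<rho> (Suc n)) = A.numer n \<omega> / (2 * c * A.denom n \<omega>)"
    proof (intro always_eventually allI ballI impI)
      fix n \<omega> assume \<omega>: "\<omega> \<in> space M" and nz: "A.denom n \<omega> \<noteq> 0"
      let ?m = "Suc n"
      define X where "X = (\<Sum>t=1..?m. y ?m (t - 1) \<omega> * u ?m t \<omega>)"
      define Y where "Y = (\<Sum>t=1..?m. (y ?m (t - 1) \<omega>)\<^sup>2)"
      define G where "G = A.g n ^ ?m"
      define l where "l = msq (\<phi> ?m)"
      have num': "A.numer n \<omega> = G * X / (l * k ?m)"
      proof -
        have "X = (\<Sum>t=1..?m. A.path n (t - 1) \<omega> * inno (\<phi> ?m) t \<omega>)"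
          unfolding X_def using \<omega> by (intro sum.cong) (auto simp: y_path u_inno)
        then show ?thesis unfolding A.numer_def G_def l_def by (simp only:)
      qed
      have den': "A.denom n \<omega> = G\<^sup>2 * Y / (l * (k ?m)\<^sup>2)"
      proof -
        have "Y = (\<Sum>t=1..?m. (A.path n (t - 1) \<omega>)\<^sup>2)"
          unfolding Y_def using \<omega> by (intro sum.cong) (auto simp: y_path)
        then show ?thesis unfolding A.denom_def G_def l_def by (simp only: power_even_eq)
      qed
      have Y0: "Y \<noteq> 0" using nz unfolding den' by auto
      have "(\<Sum>t=1..?m. y ?m (t - 1) \<omega> * y ?m t \<omega>) = (\<Sum>t=1..?m. \<rho> ?m * (y ?m (t - 1) \<omega>)\<^sup>2 + y ?m (t - 1) \<omega> * u ?m t \<omega>)"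
      proof (rule sum.cong[OF refl])
        fix t assume "t \<in> {1..?m}"
        then have "y ?m t \<omega> = \<rho> ?m * y ?m (t - 1) \<omega> + u ?m t \<omega>" using y_rec[of t ?m \<omega>] \<omega> by simp
        then show "y ?m (t - 1) \<omega> * y ?m t \<omega> = \<rho> ?m * (y ?m (t - 1) \<omega>)\<^sup>2 + y ?m (t - 1) \<omega> * u ?m t \<omega>"
          by (simp only: power2_eq_square distrib_left mult_ac)
      qed
      then have "(\<Sum>t=1..?m. y ?m (t - 1) \<omega> * y ?m t \<omega>) = \<rho> ?m * Y + X"
        unfolding X_def Y_def by (simp only: sum.distrib sum_distrib_left)
      then have "\<rho>hat ?m \<omega> = (\<rho> ?m * Y + X) / Y" using \<rho>hat_eq[of ?m \<omega>] \<omega> Y0 unfolding Y_def by simp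
      then have d: "\<rho>hat ?m \<omega> - \<rho> ?m = X / Y" using Y0 by (simp add: field_simps)
      have "\<rho> ?m ^ ?m = 1 / G" unfolding G_def g by (simp add: power_one_over del: power_Suc)
      moreover have "G > 0" "l > 0" "k ?m > 0"
        using A.g_bounds(1)[of n] A.L_ge_1[of n] k_pos[of ?m] unfolding G_def l_def by auto
      ultimately show "k ?m * \<rho> ?m ^ ?m / (2 * c) * (\<rho>hat ?m \<omega> - \<rho> ?m) = A.numer n \<omega> / (2 * c * A.denom n \<omega>)"
        unfolding d num' den' using Y0 params(1) by (simp add: field_simps power2_eq_square)
    qed
  qed
  show ?thesis using part1 part2 by blast
qed

end
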